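(* Let $\mathcal M,\mathcal N$ be connected, compact, oriented smooth $2$-dimensional Riemannian manifolds (possibly with Lipschitz boundaries) with $V_{\mathcal N}\le V_{\mathcal M}$, and let $p\ge 2$. If $\mathcal M,\mathcal N$ are homothetic and $V_{\mathcal N}/V_{\mathcal M}\ge 1/4$, then the homotheties of $\mathcal M$ onto $\mathcal N$ are the unique minimizers of $E_p$ over $\operatorname{Lip}_+^{\mathrm{inj}}(\mathcal M,\mathcal N)$; that is, $\phi\in\operatorname{Lip}_+^{\mathrm{inj}}(\mathcal M,\mathcal N)$ minimizes $E_p$ if and only if $\phi$ is a surjective homothety.
   Context: Write $\mathfrak g,\mathfrak h$ for the metrics of $\mathcal M,\mathcal N$; $V_{X}$ denotes the (Riemannian) area of $X$. $\operatorname{Lip}_+^{\mathrm{inj}}(\mathcal M,\mathcal N)$ is the set of Lipschitz maps $\phi:\mathcal M\to\mathcal N$ whose (signed) Jacobian $J\phi$ is $\ge 0$ a.e. and which are injective a.e., meaning $|\phi^{-1}(q)|\le 1$ for a.e. $q\in\mathcal N$. For $x\in\mathcal M$, $\operatorname{SO}(\mathfrak g,\phi^*\mathfrak h)_x$ is the set of orientation-preserving linear isometries $T_x\mathcal M\to T_{\phi(x)}\mathcal N$; distances in $\operatorname{Hom}(T_x\mathcal M,T_{\phi(x)}\mathcal N)$ are measured with the inner product induced by $\mathfrak g,\mathfrak h$ (Frobenius inner product in orthonormal frames). With area integration, $$E_p(\phi)=\frac1{V_{\mathcal M}}\int_{\mathcal M}\operatorname{dist}^p\big(d\phi,\operatorname{SO}(\mathfrak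 g,\phi^*\mathfrak h)\big).$$ $\phi$ is a homothety if $\phi^*\mathfrak h=\lambda^2\mathfrak g$ for some constant $\lambda>0$ (for Lipschitz $\phi$: a.e.; a Lipschitz map with $d\phi\in\lambda\operatorname{SO}(\mathfrak g,\phi^*\mathfrak h)$ a.e. is automatically smooth). $\mathcal M,\mathcal N$ are homothetic if there is an orientation-preserving diffeomorphism $\mathcal M\to\mathcal N$ which is a homothety. *)

theory Defs
  imports "HOL-Analysis.Analysis"
begin

section \<open>Smooth functions on subsets of a Euclidean space\<close>

primrec times_cont_differentiable_on ::
    "nat \<Rightarrow> ('a::real_normed_vector \<Rightarrow> 'b::real_normed_vector) \<Rightarrow> 'a set \<Rightarrow> bool" where
  "times_cont_differentiable_on 0 f W \<longleftrightarrow> continuous_on W f"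
| "times_cont_differentiable_on (Suc k) f W \<longleftrightarrow>
     f differentiable_on W \<and>
     (\<forall>v. times_cont_differentiable_on k (\<lambda>z. frechet_derivative f (at z) v) W)"

text \<open>The set \<open>S\<close> need not be open: smoothness up to the boundary means that the function
  extends smoothly to a neighbourhood of every point of \<open>S\<close>.\<close>

definition smooth_on :: "'a::real_normed_vector set \<Rightarrow> ('a \<Rightarrow> 'b::real_normed_vector) \<Rightarrow> bool" where
  "smooth_on S f \<longleftrightarrow>
     (\<forall>z\<in>S. \<exists>W F. open W \<and> z \<in> W \<and> (\<forall>k. times_cont_differentiable_on k F W) \<and>
                  (\<forall>w\<in>S \<inter> W. F w = f w))"

text \<open>Near each of its points \<open>S\<close> is, after a rotation or reflection, the closed epigraph of a
  Lipschitz function. Interior points are included: there the function can be taken to be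
  constant with its graph below the neighbourhood \<open>W\<close>.\<close>

definition locally_lipschitz_epigraph :: "(real^2) set \<Rightarrow> bool" where
  "locally_lipschitz_epigraph S \<longleftrightarrow>
     (\<forall>z\<in>S. \<exists>W (R :: real^2 \<Rightarrow> real^2) L (f :: real \<Rightarrow> real).
        open W \<and> z \<in> W \<and> orthogonal_transformation R \<and> L-lipschitz_on UNIV f \<and>
        S \<inter> W = {w\<in>W. f (R w $ 1) \<le> R w $ 2})"


section \<open>Oriented Riemannian surfaces with Lipschitz boundary\<close>

text \<open>A chart carries the matrix field of the Riemannian metric in its coordinates. A surface is a
  set with a (not necessarily maximal) oriented atlas; its topology is the subspace topology of
  the ambient Hausdorff type. The fields and the maps below are only meaningful on \<open>pts\<close>,
  \<open>chart_dom\<close> and \<open>chart_map ` chart_dom\<close>.\<close>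

record 'a chart =
  chart_dom :: "'a set"
  chart_map :: "'a \<Rightarrow> real^2"
  chart_metric :: "real^2 \<Rightarrow> real^2^2"

record 'a surface =
  pts :: "'a set"
  atlas :: "'a chart set"

abbreviation chart_image :: "'a chart \<Rightarrow> (real^2) set" where
  "chart_image c \<equiv> chart_map c ` chart_dom c"

abbreviation chart_inv :: "'a chart \<Rightarrow> real^2 \<Rightarrow> 'a" where
  "chart_inv c \<equiv> inv_into (chart_dom c) (chart_map c)"

abbreviation metric_at :: "'a chart \<Rightarrow> 'a \<Rightarrow> real^2^2" where
  "metric_at c x \<equiv> chart_metric c (chart_map c x)"

definition chart_rep :: "'a chart \<Rightarrow> 'b chart \<Rightarrow> ('a \<Rightarrow> 'b) \<Rightarrow> real^2 \<Rightarrow> real^2" where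
  "chart_rep c d \<phi> = chart_map d \<circ> \<phi> \<circ> chart_inv c"

text \<open>The matrix of the differential of \<open>\<phi>\<close> at \<open>x\<close> in the charts \<open>c\<close> at \<open>x\<close> and \<open>d\<close> at \<open>\<phi> x\<close>.
  For a continuous \<open>\<phi>\<close> points near \<open>chart_map c x\<close> are sent into the domain of \<open>d\<close>.\<close>

definition chart_diff :: "'a chart \<Rightarrow> 'b chart \<Rightarrow> ('a \<Rightarrow> 'b) \<Rightarrow> 'a \<Rightarrow> real^2^2" where
  "chart_diff c d \<phi> x =
     matrix (frechet_derivative (chart_rep c d \<phi>) (at (chart_map c x) within chart_image c))"

text \<open>The matrix of the pulled back metric in the chart \<open>c\<close>.\<close>

definition chart_pullback :: "'a chart \<Rightarrow> 'b chart \<Rightarrow> ('a \<Rightarrow> 'b) \<Rightarrow> 'a \<Rightarrow> real^2^2" where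
  "chart_pullback c d \<phi> x =
     transpose (chart_diff c d \<phi> x) ** metric_at d (\<phi> x) ** chart_diff c d \<phi> x"

definition riemannian_chart :: "'a::t2_space set \<Rightarrow> 'a chart \<Rightarrow> bool" where
  "riemannian_chart M c \<longleftrightarrow>
     openin (top_of_set M) (chart_dom c) \<and>
     homeomorphism (chart_dom c) (chart_image c) (chart_map c) (chart_inv c) \<and>
     locally_lipschitz_epigraph (chart_image c) \<and>
     smooth_on (chart_image c) (chart_metric c) \<and>
     (\<forall>z\<in>chart_image c. transpose (chart_metric c z) = chart_metric c z \<and>
        (\<forall>v. v \<noteq> 0 \<longrightarrow> 0 < v \<bullet> (chart_metric c z *v v)))"

text \<open>The transition map from \<open>c\<close> to \<open>d\<close> is smooth, preserves orientation, and transforms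
  the metric of \<open>d\<close> into that of \<open>c\<close>.\<close>

definition compatible_charts :: "'a chart \<Rightarrow> 'a chart \<Rightarrow> bool" where
  "compatible_charts c d \<longleftrightarrow>
     smooth_on (chart_map c ` (chart_dom c \<inter> chart_dom d)) (chart_rep c d (\<lambda>x. x)) \<and>
     (\<forall>x\<in>chart_dom c \<inter> chart_dom d.
        0 < det (chart_diff c d (\<lambda>x. x) x) \<and>
        chart_pullback c d (\<lambda>x. x) x = metric_at c x)"

definition compact_oriented_riemannian_surface :: "'a::t2_space surface \<Rightarrow> bool" where
  "compact_oriented_riemannian_surface M \<longleftrightarrow>
     pts M \<noteq> {} \<and> connected (pts M) \<and> compact (pts M) \<and>
     (\<Union>c\<in>atlas M. chart_dom c) = pts M \<and>
     (\<forall>c\<in>atlas M. riemannian_chart (pts M) c) \<and>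
     (\<forall>c\<in>atlas M. \<forall>d\<in>atlas M. compatible_charts c d)"

text \<open>The tensorial quantities defined through \<open>chart_at\<close> do not depend on the choice of the
  chart, by compatibility.\<close>

definition chart_at :: "'a surface \<Rightarrow> 'a \<Rightarrow> 'a chart" where
  "chart_at M x = (SOME c. c \<in> atlas M \<and> x \<in> chart_dom c)"


section \<open>Area and Riemannian distance\<close>

text \<open>The complete area measure: \<open>sqrt (det g)\<close> times Lebesgue measure in every chart. There is
  exactly one such measure on a compact Riemannian surface.\<close>

definition area_measure :: "'a surface \<Rightarrow> 'a measure" where
  "area_measure M = (SOME \<mu>.
     space \<mu> = pts M \<and>
     sets \<mu> = {B. B \<subseteq> pts M \<and>
                 (\<forall>c\<in>atlas M. chart_map c ` (B \<inter> chart_dom c) \<in> sets lebesgue)} \<and>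
     (\<forall>c\<in>atlas M. \<forall>B\<in>sets \<mu>. B \<subseteq> chart_dom c \<longrightarrow>
        emeasure \<mu> B =
          (\<integral>\<^sup>+z\<in>chart_map c ` B. ennreal (sqrt (det (chart_metric c z))) \<partial>lebesgue)))"

definition area :: "'a surface \<Rightarrow> real" where
  "area M = measure (area_measure M) (pts M)"

definition piecewise_C1_path :: "'a::t2_space surface \<Rightarrow> (real \<Rightarrow> 'a) \<Rightarrow> bool" where
  "piecewise_C1_path M \<gamma> \<longleftrightarrow>
     path \<gamma> \<and> path_image \<gamma> \<subseteq> pts M \<and>
     (\<forall>t\<in>{0..1}. \<forall>c\<in>atlas M. \<gamma> t \<in> chart_dom c \<longrightarrow>
        (\<exists>e>0. (chart_map c \<circ> \<gamma>) piecewise_C1_differentiable_on ({t - e..t + e} \<inter> {0..1})))"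

definition path_speed :: "'a surface \<Rightarrow> (real \<Rightarrow> 'a) \<Rightarrow> real \<Rightarrow> real" where
  "path_speed M \<gamma> t =
     (let c = chart_at M (\<gamma> t); v = vector_derivative (chart_map c \<circ> \<gamma>) (at t)
      in sqrt (v \<bullet> (metric_at c (\<gamma> t) *v v)))"

text \<open>The length is extended-real-valued because the library's piecewise C1 paths may have an
  unbounded derivative near their finitely many exceptional points.\<close>

definition path_length :: "'a surface \<Rightarrow> (real \<Rightarrow> 'a) \<Rightarrow> ennreal" where
  "path_length M \<gamma> = (\<integral>\<^sup>+t\<in>{0..1}. ennreal (path_speed M \<gamma> t) \<partial>lborel)"

definition riemannian_dist :: "'a::t2_space surface \<Rightarrow> 'a \<Rightarrow> 'a \<Rightarrow> ennreal" where
  "riemannian_dist M x y =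
     Inf {path_length M \<gamma> |\<gamma>. piecewise_C1_path M \<gamma> \<and> pathstart \<gamma> = x \<and> pathfinish \<gamma> = y}"


section \<open>Maps between surfaces\<close>

definition lipschitz_map :: "'a::t2_space surface \<Rightarrow> 'b::t2_space surface \<Rightarrow> ('a \<Rightarrow> 'b) \<Rightarrow> bool" where
  "lipschitz_map M N \<phi> \<longleftrightarrow>
     \<phi> \<in> pts M \<rightarrow> pts N \<and>
     (\<exists>L\<ge>0. \<forall>x\<in>pts M. \<forall>y\<in>pts M.
        riemannian_dist N (\<phi> x) (\<phi> y) \<le> ennreal L * riemannian_dist M x y)"

definition differentiable_at_pt ::
    "'a surface \<Rightarrow> 'b surface \<Rightarrow> ('a \<Rightarrow> 'b) \<Rightarrow> 'a \<Rightarrow> bool" where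
  "differentiable_at_pt M N \<phi> x \<longleftrightarrow>
     (let c = chart_at M x; d = chart_at N (\<phi> x)
      in chart_rep c d \<phi> differentiable (at (chart_map c x) within chart_image c))"

definition jacobian :: "'a surface \<Rightarrow> 'b surface \<Rightarrow> ('a \<Rightarrow> 'b) \<Rightarrow> 'a \<Rightarrow> real" where
  "jacobian M N \<phi> x =
     (let c = chart_at M x; d = chart_at N (\<phi> x)
      in det (chart_diff c d \<phi> x) * sqrt (det (metric_at d (\<phi> x))) / sqrt (det (metric_at c x)))"

text \<open>``Non-negative Jacobian almost everywhere'' is read as: at almost every point the
  differential, and hence the Jacobian, exists and the latter is non-negative. Existence almost
  everywhere is no restriction on Lipschitz maps, by Rademacher's theorem.\<close>

definition lip_inj_plus ::
    "'a::t2_space surface \<Rightarrow> 'b::t2_space surface \<Rightarrow> ('a \<Rightarrow> 'b) set" where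
  "lip_inj_plus M N = {\<phi>. lipschitz_map M N \<phi> \<and>
     (AE x in area_measure M. differentiable_at_pt M N \<phi> x \<and> 0 \<le> jacobian M N \<phi> x) \<and>
     (AE q in area_measure N. \<exists>\<^sub>\<le>\<^sub>1x. x \<in> pts M \<and> \<phi> x = q)}"

text \<open>Linear maps between inner product spaces with Gram matrices \<open>G\<close> and \<open>H\<close>: the norm
  induced on Hom (the Frobenius norm with respect to orthonormal bases), and the orientation
  preserving isometries.\<close>

definition hom_norm :: "real^2^2 \<Rightarrow> real^2^2 \<Rightarrow> real^2^2 \<Rightarrow> real" where
  "hom_norm G H A = sqrt (trace (matrix_inv G ** transpose A ** H ** A))"

definition SO_iso :: "real^2^2 \<Rightarrow> real^2^2 \<Rightarrow> (real^2^2) set" where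
  "SO_iso G H = {Q. transpose Q ** H ** Q = G \<and> 0 < det Q}"

definition dist_SO :: "'a surface \<Rightarrow> 'b surface \<Rightarrow> ('a \<Rightarrow> 'b) \<Rightarrow> 'a \<Rightarrow> real" where
  "dist_SO M N \<phi> x =
     (let c = chart_at M x; d = chart_at N (\<phi> x);
          G = metric_at c x; H = metric_at d (\<phi> x)
      in INF Q\<in>SO_iso G H. hom_norm G H (chart_diff c d \<phi> x - Q))"

definition energy :: "real \<Rightarrow> 'a surface \<Rightarrow> 'b surface \<Rightarrow> ('a \<Rightarrow> 'b) \<Rightarrow> ennreal" where
  "energy p M N \<phi> =
     (\<integral>\<^sup>+x. ennreal (dist_SO M N \<phi> x powr p) \<partial>area_measure M) / ennreal (area M)"

definition minimizes_energy ::
    "real \<Rightarrow> 'a::t2_space surface \<Rightarrow> 'b::t2_space surface \<Rightarrow> ('a \<Rightarrow> 'b) \<Rightarrow> bool" where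
  "minimizes_energy p M N \<phi> \<longleftrightarrow>
     \<phi> \<in> lip_inj_plus M N \<and> (\<forall>\<psi>\<in>lip_inj_plus M N. energy p M N \<phi> \<le> energy p M N \<psi>)"

text \<open>Homotheties in the sense appropriate to Lipschitz maps, i.e. almost everywhere.\<close>

definition homothety :: "'a surface \<Rightarrow> 'b surface \<Rightarrow> ('a \<Rightarrow> 'b) \<Rightarrow> bool" where
  "homothety M N \<phi> \<longleftrightarrow>
     (\<exists>r>0. AE x in area_measure M. differentiable_at_pt M N \<phi> x \<and>
        chart_pullback (chart_at M x) (chart_at N (\<phi> x)) \<phi> x =
          r\<^sup>2 *\<^sub>R metric_at (chart_at M x) x)"

definition smooth_map :: "'a::t2_space surface \<Rightarrow> 'b::t2_space surface \<Rightarrow> ('a \<Rightarrow> 'b) \<Rightarrow> bool" where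
  "smooth_map M N \<phi> \<longleftrightarrow>
     \<phi> \<in> pts M \<rightarrow> pts N \<and> continuous_on (pts M) \<phi> \<and>
     (\<forall>c\<in>atlas M. \<forall>d\<in>atlas N.
        smooth_on (chart_map c ` (chart_dom c \<inter> \<phi> -` chart_dom d)) (chart_rep c d \<phi>))"

definition oriented_diffeomorphism ::
    "'a::t2_space surface \<Rightarrow> 'b::t2_space surface \<Rightarrow> ('a \<Rightarrow> 'b) \<Rightarrow> bool" where
  "oriented_diffeomorphism M N \<phi> \<longleftrightarrow>
     bij_betw \<phi> (pts M) (pts N) \<and>
     smooth_map M N \<phi> \<and> smooth_map N M (inv_into (pts M) \<phi>) \<and>
     (\<forall>x\<in>pts M. 0 < jacobian M N \<phi> x)"

definition homothetic :: "'a::t2_space surface \<Rightarrow> 'b::t2_space surface \<Rightarrow> bool" where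
  "homothetic M N \<longleftrightarrow>
     (\<exists>\<phi>. oriented_diffeomorphism M N \<phi> \<and>
        (\<exists>r>0. \<forall>x\<in>pts M.
           chart_pullback (chart_at M x) (chart_at N (\<phi> x)) \<phi> x =
             r\<^sup>2 *\<^sub>R metric_at (chart_at M x) x))"

end

theory Submission
  imports Defs
begin

text \<open>Let \<open>\<sigma>\<^sub>1, \<sigma>\<^sub>2\<close> be the singular values of the differential, \<open>s = \<sigma>\<^sub>1 + \<sigma>\<^sub>2\<close> and
  \<open>J = \<sigma>\<^sub>1 \<sigma>\<^sub>2\<close> the Jacobian. The squared distance to the isometries is \<open>s\<^sup>2 - 2 J - 2 s + 2\<close>,
  and \<open>J \<le> s\<^sup>2 / 4\<close> with equality exactly for conformal differentials. With
  \<open>r\<^sup>2 = V\<^sub>N / V\<^sub>M\<close>, which lies in \<open>[1/4, 1]\<close>, the squared distance exceeds the affine function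
  \<open>2 (r - 1)\<^sup>2 + (2 - 2 / r) (J - r\<^sup>2)\<close> by
  \<open>(s - 2 r)\<^sup>2 / (2 r) + (2 - 1 / r) (s\<^sup>2 / 2 - 2 J)\<close>, which is non-negative because \<open>r \<ge> 1/2\<close>.
  The power \<open>p / 2\<close> lies above its tangent at \<open>2 (r - 1)\<^sup>2\<close>. Since the slope in \<open>J\<close> is not positive
  and the area formula gives \<open>\<integral> J = area (\<phi> M) \<le> V\<^sub>N\<close>, integration yields the lower bound, and
  equality forces \<open>s = 2 r\<close>, \<open>J = r\<^sup>2\<close> and an image of full area, which is compact and hence all
  of \<open>N\<close>.\<close>

section \<open>Linear maps between inner product planes\<close>

text \<open>On conformal differentials the squared distance is the function
  \<open>2 * (sqrt J - 1)^2\<close> of the Jacobian alone; its tangent at \<open>J = r^2\<close> has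
  slope \<open>2 - 2 / r\<close>, which is where the affine function comes from. The slope plays the
  part of a Lagrange multiplier for the area constraint. The ratio 1/4 enters through the weight
  \<open>2 - 1 / r\<close> of the conformality deficit \<open>s^2 / 2 - 2 * J\<close>, half the
  squared difference of the singular values: the weight changes sign at \<open>r = 1/2\<close>. The
  two ends of the range degenerate in opposite ways. At \<open>r = 1/2\<close> the weight vanishes
  and conformality has to come from equality in the area bound; at \<open>r = 1\<close> the
  multiplier vanishes, the area bound says nothing, and conformality has to come from the weight.
  The other obstacle is regularity. Competitors are Lipschitz only for distances that are infima of
  path lengths, and charts may have boundary points. Hence distances are compared with Euclidean
  ones in charts, derivatives within a chart image are shown to be unique, and the planar theorems
  on substitution, critical values and null sets are applied on finitely many pieces, each governed
  by one pair of charts.\<close>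

definition spd :: "real^2^2 \<Rightarrow> bool" where
  "spd G \<longleftrightarrow> transpose G = G \<and> (\<forall>v. v \<noteq> 0 \<longrightarrow> 0 < v \<bullet> (G *v v))"

text \<open>The square of \<open>hom_norm\<close>: the sum of the squared singular values of
  \<open>A\<close> between the inner product planes with Gram matrices \<open>G\<close> and
  \<open>H\<close>.\<close>

definition energy_density :: "real^2^2 \<Rightarrow> real^2^2 \<Rightarrow> real^2^2 \<Rightarrow> real" where
  "energy_density G H A = trace (matrix_inv G ** transpose A ** H ** A)"

text \<open>The signed product of the same singular values; at a point of a surface it is the
  \<open>jacobian\<close>.\<close>

definition area_density :: "real^2^2 \<Rightarrow> real^2^2 \<Rightarrow> real^2^2 \<Rightarrow> real" where
  "area_density G H A = det A * sqrt (det H) / sqrt (det G)"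

lemmas mat2_simps = vec_eq_iff forall_2 matrix_matrix_mult_def sum_2 transpose_def
  matrix_vector_mult_def inner_vec_def

lemma spd_components:
  assumes "spd G"
  shows "0 < G$1$1" "G$2$1 = G$1$2" "0 < G$1$1 * G$2$2 - G$1$2 * G$1$2" "0 < det G"
proof -
  have t: "G$2$1 = G$1$2"
  proof -
    have "transpose G $ 1 $ 2 = G $ 1 $ 2" using assms by (simp add: spd_def)
    then show ?thesis by (simp add: transpose_def)
  qed
  have pos: "0 < v \<bullet> (G *v v)" if "v \<noteq> 0" for v
    using assms that by (auto simp: spd_def)
  have "vector [1,0] \<noteq> (0::real^2)" by (simp add: vec_eq_iff forall_2)
  from pos[OF this] show a: "0 < G$1$1" by (simp add: mat2_simps)
  \<comment> \<open>This vector is orthogonal to the first basis vector for the form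
    \<open>G\<close>, so the form takes the value \<open>G$1$1 * det G\<close> on it.\<close>
  have "vector [- G$1$2, G$1$1] \<noteq> (0::real^2)" using a by (simp add: vec_eq_iff forall_2)
  from pos[OF this] have "0 < G$1$1 * (G$1$1 * G$2$2 - G$1$2 * G$1$2)"
    by (simp add: mat2_simps t algebra_simps)
  with a show c: "0 < G$1$1 * G$2$2 - G$1$2 * G$1$2"
    by (simp add: zero_less_mult_iff)
  then show "0 < det G" by (simp add: det_2 t)
  show "G$2$1 = G$1$2" by (rule t)
qed

text \<open>The upper triangular Cholesky factor, written out. Its inverse is an orthonormal frame
  for \<open>G\<close>, and its determinant is the area density of \<open>G\<close>.\<close>

lemma spd_root:
  assumes "spd G"
  obtains S where "transpose S ** S = G" "det S = sqrt (det G)" "0 < det S"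
proof -
  note c = spd_components[OF assms]
  define u where "u = sqrt (G$1$1)"
  define w where "w = sqrt (det G) / u"
  have u: "0 < u" "u * u = G$1$1" using c by (auto simp: u_def)
  have w: "0 < w" "w * w = (G$1$1 * G$2$2 - G$1$2 * G$1$2) / (u * u)"
    using c u(1) by (auto simp: w_def det_2)
  define S :: "real^2^2" where "S = vector [vector [u, G$1$2 / u], vector [0, w]]"
  have "transpose S ** S = G"
    using u(1) w(2) c(1) by (simp add: S_def mat2_simps c(2) field_simps) (simp add: u(2) flip: mult.assoc)
  moreover have "det S = u * w" by (simp add: S_def det_2)
  moreover have "u * w = sqrt (det G)" using u by (simp add: w_def)
  ultimately show thesis using that[of S] u(1) w(1) c(4) by simp
qed

lemma invertible_inverses:
  fixes A :: "real^2^2"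
  assumes "det A \<noteq> 0"
  shows "A ** matrix_inv A = mat 1" "matrix_inv A ** A = mat 1"
proof -
  have "\<exists>B. A ** B = mat 1 \<and> B ** A = mat 1"
    using assms by (simp add: invertible_det_nz flip: invertible_def)
  from someI_ex[OF this] show "A ** matrix_inv A = mat 1" "matrix_inv A ** A = mat 1"
    by (simp_all add: matrix_inv_def)
qed

lemma matrix_inv_eqI:
  fixes A B :: "real^2^2"
  assumes "A ** B = mat 1"
  shows "matrix_inv A = B"
proof -
  have "det A * det B = 1" using assms by (metis det_I det_mul)
  then have "det A \<noteq> 0" by auto
  then have "matrix_inv A ** (A ** B) = B"
    by (simp add: matrix_mul_assoc invertible_inverses)
  then show ?thesis by (simp add: assms)
qed

lemma mat_cancel:
  fixes A X :: "real^2^2"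
  assumes "det A \<noteq> 0"
  shows "A ** (matrix_inv A ** X) = X" "matrix_inv A ** (A ** X) = X"
    "transpose A ** (transpose (matrix_inv A) ** X) = X"
    "transpose (matrix_inv A) ** (transpose A ** X) = X"
    "transpose A ** transpose (matrix_inv A) = mat 1"
    "transpose (matrix_inv A) ** transpose A = mat 1"
  using invertible_inverses[OF assms]
  by (simp_all add: matrix_mul_assoc flip: matrix_transpose_mul)

lemma det_matrix_inv:
  fixes A :: "real^2^2"
  assumes "det A \<noteq> 0"
  shows "det (matrix_inv A) = 1 / det A"
proof -
  have "det A * det (matrix_inv A) = 1"
    using invertible_inverses(1)[OF assms] by (metis det_I det_mul)
  then show ?thesis using assms by (simp add: field_simps)
qed

text \<open>\<open>T ** A ** matrix_inv S\<close> represents \<open>A\<close> in orthonormal frames,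
  where the induced norm is the Frobenius norm. Cyclicity of the trace moves one factor
  \<open>matrix_inv S\<close> to the other end.\<close>

lemma energy_density_normalize:
  assumes S: "transpose S ** S = G" "det S \<noteq> 0" and T: "transpose T ** T = H"
  shows "energy_density G H A = trace (transpose (T ** A ** matrix_inv S) ** (T ** A ** matrix_inv S))"
proof -
  have "matrix_inv G = matrix_inv S ** transpose (matrix_inv S)"
    by (rule matrix_inv_eqI) (simp add: S(1)[symmetric] matrix_mul_assoc[symmetric] mat_cancel S(2))
  then have "energy_density G H A
      = trace (matrix_inv S ** (transpose (matrix_inv S) ** transpose A ** transpose T ** T ** A))"
    by (simp add: energy_density_def T[symmetric] matrix_mul_assoc)
  also have "\<dots> = trace ((transpose (matrix_inv S) ** transpose A ** transpose T ** T ** A) ** matrix_inv S)"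
    by (rule trace_mul_sym)
  finally show ?thesis by (simp add: matrix_transpose_mul matrix_mul_assoc)
qed

lemma area_density_normalize:
  assumes S: "det S = sqrt (det G)" "0 < det S" and T: "det T = sqrt (det H)"
  shows "area_density G H A = det (T ** A ** matrix_inv S)"
  using S by (simp add: area_density_def det_mul det_matrix_inv T)

text \<open>In orthonormal frames the gap between energy and twice the area is
  \<open>(b11 - b22)^2 + (b12 + b21)^2\<close>, the anticonformal part of the matrix. When it
  vanishes the matrix is a scaled rotation, whose scale is read off from the area density.\<close>

lemma density_facts:
  assumes "spd G" "spd H"
  shows "2 * area_density G H A \<le> energy_density G H A" (is ?g1)
    and "energy_density G H A = 2 * r\<^sup>2 \<Longrightarrow> area_density G H A = r\<^sup>2 \<Longrightarrow>
           transpose A ** H ** A = r\<^sup>2 *\<^sub>R G" (is "?a \<Longrightarrow> ?b \<Longrightarrow> ?g3")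
proof -
  obtain S where S: "transpose S ** S = G" "det S = sqrt (det G)" "0 < det S"
    by (rule spd_root[OF assms(1)])
  obtain T where T: "transpose T ** T = H" "det T = sqrt (det H)" "0 < det T"
    by (rule spd_root[OF assms(2)])
  define B where "B = T ** A ** matrix_inv S"
  have S0: "det S \<noteq> 0" using S(3) by simp
  have e: "energy_density G H A = trace (transpose B ** B)"
    by (simp add: energy_density_normalize[OF S(1) S0 T(1)] B_def)
  have e': "energy_density G H A = (B$1$1)\<^sup>2 + (B$1$2)\<^sup>2 + (B$2$1)\<^sup>2 + (B$2$2)\<^sup>2"
    unfolding e by (simp add: trace_def mat2_simps power2_eq_square)
  have a: "area_density G H A = B$1$1 * B$2$2 - B$1$2 * B$2$1"
    by (simp add: area_density_normalize[OF S(2,3) T(2)] B_def[symmetric] det_2)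
  have 1: "energy_density G H A - 2 * area_density G H A = (B$1$1 - B$2$2)\<^sup>2 + (B$1$2 + B$2$1)\<^sup>2"
    unfolding e' a by (simp add: power2_eq_square algebra_simps)
  then show ?g1 by (smt (verit) zero_le_power2)
  assume ab: ?a ?b
  then have "(B$1$1 - B$2$2)\<^sup>2 + (B$1$2 + B$2$1)\<^sup>2 = 0" using 1 by simp
  then have BB: "B$1$1 = B$2$2" "B$1$2 = - B$2$1" by (auto simp: sum_power2_eq_zero_iff)
  have "transpose B ** B = r\<^sup>2 *\<^sub>R mat 1"
    using ab(2) unfolding a by (simp add: mat2_simps BB mat_def power2_eq_square)
  then have "transpose S ** (transpose B ** B) ** S = r\<^sup>2 *\<^sub>R G"
    by (simp add: S(1) matrix_scalar_ac flip: scalar_matrix_assoc)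
  moreover have "B ** S = T ** A"
    using invertible_inverses[OF S0] by (simp add: B_def flip: matrix_mul_assoc)
  then have "transpose S ** (transpose B ** B) ** S = transpose A ** H ** A"
    by (metis T(1) matrix_mul_assoc matrix_transpose_mul)
  ultimately show ?g3 by simp
qed

text \<open>Converse to the equality case. The pulled back metric determines the Jacobian only up to
  sign, through determinants, so the sign has to be supplied.\<close>

lemma densities_conformal:
  assumes "spd G" "spd H" and eq: "transpose A ** H ** A = r\<^sup>2 *\<^sub>R G"
    and "0 \<le> area_density G H A"
  shows "energy_density G H A = 2 * r\<^sup>2" "area_density G H A = r\<^sup>2"
proof -
  note G = spd_components(4)[OF assms(1)] and H = spd_components(4)[OF assms(2)]
  have "energy_density G H A = trace (matrix_inv G ** (r\<^sup>2 *\<^sub>R G))"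
    by (simp add: energy_density_def eq[symmetric] matrix_mul_assoc)
  also have "\<dots> = trace (r\<^sup>2 *\<^sub>R (mat 1 :: real^2^2))"
    using invertible_inverses(2)[of G] G by (simp add: matrix_scalar_ac flip: scalar_matrix_assoc)
  finally show "energy_density G H A = 2 * r\<^sup>2" by (simp add: trace_def mat_def sum_2)
  have "det (transpose A ** H ** A) = (r\<^sup>2)\<^sup>2 * det G"
    unfolding eq by (simp add: det_2 power2_eq_square algebra_simps)
  then have "(det A)\<^sup>2 * det H = (r\<^sup>2)\<^sup>2 * det G"
    by (simp add: det_mul power2_eq_square mult_ac)
  then have "(area_density G H A)\<^sup>2 = (r\<^sup>2)\<^sup>2"
    using G H by (simp add: area_density_def power_mult_distrib power_divide field_simps)
  then show "area_density G H A = r\<^sup>2"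
    using assms(4) by (metis power2_eq_iff_nonneg zero_le_power2)
qed

text \<open>In orthonormal frames the isometries become the rotations \<open>R\<close>, and the
  squared distance from \<open>B\<close> to \<open>R\<close> is the energy plus 2 minus twice the
  inner product of \<open>B\<close> and \<open>R\<close>. That inner product is the linear form with
  coefficients \<open>x\<close>, \<open>y\<close> on the unit circle, with maximum
  \<open>sqrt (x^2 + y^2)\<close>; the square of this maximum is the energy plus twice the area
  density.\<close>

lemma INF_SO_iso:
  assumes "spd G" "spd H"
  shows "(INF Q\<in>SO_iso G H. hom_norm G H (A - Q)) =
    sqrt (energy_density G H A - 2 * sqrt (energy_density G H A + 2 * area_density G H A) + 2)"
    (is "_ = ?R")
proof -
  obtain S where S: "transpose S ** S = G" "det S = sqrt (det G)" "0 < det S"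
    by (rule spd_root[OF assms(1)])
  obtain T where T: "transpose T ** T = H" "det T = sqrt (det H)" "0 < det T"
    by (rule spd_root[OF assms(2)])
  have S0: "det S \<noteq> 0" and T0: "det T \<noteq> 0" using S T by auto
  define B where "B = T ** A ** matrix_inv S"
  have e: "energy_density G H A = (B$1$1)\<^sup>2 + (B$1$2)\<^sup>2 + (B$2$1)\<^sup>2 + (B$2$2)\<^sup>2"
    unfolding energy_density_normalize[OF S(1) S0 T(1)] B_def[symmetric]
    by (simp add: trace_def mat2_simps power2_eq_square)
  have a: "area_density G H A = B$1$1 * B$2$2 - B$1$2 * B$2$1"
    by (simp add: area_density_normalize[OF S(2,3) T(2)] B_def[symmetric] det_2)
  define x y where "x = B$1$1 + B$2$2" and "y = B$2$1 - B$1$2"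
  define s where "s = sqrt (x\<^sup>2 + y\<^sup>2)"
  have xy: "energy_density G H A + 2 * area_density G H A = x\<^sup>2 + y\<^sup>2"
    unfolding e a x_def y_def by (simp add: power2_eq_square algebra_simps)
  have hn: "hom_norm G H (A - Q) = sqrt (energy_density G H A - 2 * (x * R$1$1 + y * R$2$1) + 2)
      \<and> R$1$1 * R$1$1 + R$2$1 * R$2$1 = 1"
    if Q: "Q \<in> SO_iso G H" and R: "R = T ** Q ** matrix_inv S" for Q R
  proof -
    have "transpose R ** R = transpose (matrix_inv S) ** (transpose Q ** H ** Q) ** matrix_inv S"
      by (simp add: R T(1)[symmetric] matrix_transpose_mul matrix_mul_assoc)
    also have "transpose Q ** H ** Q = transpose S ** S" using Q S by (simp add: SO_iso_def)
    finally have RR: "transpose R ** R = mat 1"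
      using S0 by (simp add: matrix_mul_assoc[symmetric] mat_cancel invertible_inverses)
    have "det R > 0" using Q S T by (simp add: R det_mul det_matrix_inv SO_iso_def)
    then have d: "R$1$1 * R$2$2 - R$1$2 * R$2$1 > 0" by (simp add: det_2)
    have o: "R$1$1 * R$1$1 + R$2$1 * R$2$1 = 1" "R$1$1 * R$1$2 + R$2$1 * R$2$2 = 0"
      "R$1$2 * R$1$2 + R$2$2 * R$2$2 = 1"
      using RR by (auto simp: mat2_simps mat_def)
    \<comment> \<open>\<open>D\<close> is the determinant of \<open>R\<close>. Orthogonality leaves
      the values 1 and -1, and with \<open>D = 1\<close> the second column is the first one turned
      by a right angle.\<close>
    define D where "D = R$1$1 * R$2$2 - R$1$2 * R$2$1"
    have "D * D = 1" unfolding D_def using o by algebra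
    then have D1: "D = 1" using d unfolding D_def[symmetric]
      by (metis less_asym mult_cancel_right1 square_eq_1_iff zero_less_one neg_less_0_iff_less)
    have R22: "R$2$2 = R$1$1" "R$1$2 = - R$2$1" using D1 o unfolding D_def by algebra+
    have "T ** (A - Q) ** matrix_inv S = B - R"
      by (simp add: B_def R mat2_simps algebra_simps)
    then have "hom_norm G H (A - Q) = sqrt (trace (transpose (B - R) ** (B - R)))"
      unfolding hom_norm_def
      using energy_density_normalize[OF S(1) S0 T(1), of "A - Q"] by (simp add: energy_density_def)
    also have "trace (transpose (B - R) ** (B - R)) =
        energy_density G H A - 2 * (x * R$1$1 + y * R$2$1) + 2 * (R$1$1 * R$1$1 + R$2$1 * R$2$1)"
      by (simp add: trace_def mat2_simps e x_def y_def R22 power2_eq_square algebra_simps)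
    finally show ?thesis by (simp add: o)
  qed
  have le: "x * R1 + y * R2 \<le> s" if "R1 * R1 + R2 * R2 = 1" for R1 R2
  proof -
    \<comment> \<open>Lagrange's identity, which gives the Cauchy-Schwarz bound.\<close>
    have "(x * R1 + y * R2)\<^sup>2 + (x * R2 - y * R1)\<^sup>2 = (x\<^sup>2 + y\<^sup>2) * (R1 * R1 + R2 * R2)"
      by (simp add: power2_eq_square algebra_simps)
    then have "(x * R1 + y * R2)\<^sup>2 \<le> x\<^sup>2 + y\<^sup>2" using that by (smt (verit) mult_cancel_left1 mult_1_right zero_le_power2)
    then show ?thesis unfolding s_def by (rule real_le_rsqrt)
  qed
  have lower: "?R \<le> hom_norm G H (A - Q)" if Q: "Q \<in> SO_iso G H" for Q
  proof -
    from hn[OF Q refl] le show ?thesis unfolding xy s_def[symmetric] by fastforce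
  qed
  \<comment> \<open>The maximizing rotation points in the direction of \<open>(x, y)\<close>; if
    that vector is zero, every rotation is nearest and the identity is taken.\<close>
  obtain R1 R2 where R12: "R1 * R1 + R2 * R2 = 1" "x * R1 + y * R2 = s"
  proof (cases "s = 0")
    case True
    then have "x = 0" "y = 0" by (auto simp: s_def sum_power2_eq_zero_iff)
    then show thesis using that[of 1 0] True by simp
  next
    case False
    then have s: "s > 0" "s * s = x * x + y * y"
      by (auto simp: s_def power2_eq_square less_le)
    have "x * (x / s) + y * (y / s) = s" using s by (simp add: field_simps)
    moreover have "(x / s) * (x / s) + (y / s) * (y / s) = (x * x + y * y) / (s * s)"
      by (simp add: add_divide_distrib)
    then have "(x / s) * (x / s) + (y / s) * (y / s) = 1" using s(1) unfolding s(2)[symmetric] by simp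
    ultimately show thesis using that by blast
  qed
  define R :: "real^2^2" where "R = vector [vector [R1, - R2], vector [R2, R1]]"
  define Q where "Q = matrix_inv T ** R ** S"
  have RR: "transpose R ** R = mat 1" using R12(1) by (simp add: R_def mat2_simps mat_def algebra_simps)
  have dR: "det R = 1" using R12(1) by (simp add: R_def det_2)
  have "transpose Q ** H ** Q = transpose S ** (transpose R ** R) ** S"
    using T0 by (simp add: Q_def T(1)[symmetric] matrix_transpose_mul matrix_mul_assoc[symmetric] mat_cancel)
  then have Q: "Q \<in> SO_iso G H"
    using S(1,3) T(3) RR dR by (simp add: SO_iso_def Q_def det_mul det_matrix_inv)
  have "R = T ** Q ** matrix_inv S"
    using T0 S0 by (simp add: Q_def matrix_mul_assoc[symmetric] mat_cancel invertible_inverses)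
  from hn[OF Q this] have att: "hom_norm G H (A - Q) = ?R"
    unfolding xy s_def[symmetric] using R12(2) by (simp add: R_def)
  show ?thesis
  proof (rule antisym)
    show "(INF Q\<in>SO_iso G H. hom_norm G H (A - Q)) \<le> ?R"
      unfolding att[symmetric] by (rule cINF_lower[OF _ Q]) (use lower in \<open>auto intro!: bdd_belowI\<close>)
    show "?R \<le> (INF Q\<in>SO_iso G H. hom_norm G H (A - Q))"
      using Q lower by (intro cINF_greatest) auto
  qed
qed

text \<open>\<open>E\<close> and \<open>F\<close> are the differentials of coordinate changes in
  target and source, under which Gram matrices transform by congruence. Positive determinants let
  \<open>sqrt (det (transpose F ** G ** F))\<close> factor without absolute values, so the sign of
  the area density is kept.\<close>

lemma densities_change:
  assumes "spd G" "spd H" "0 < det E" "0 < det F"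
  shows "energy_density (transpose F ** G ** F) H (E ** A ** F) =
           energy_density G (transpose E ** H ** E) A"
    and "area_density (transpose F ** G ** F) H (E ** A ** F) =
           area_density G (transpose E ** H ** E) A"
proof -
  have G0: "det G \<noteq> 0" and F0: "det F \<noteq> 0" using spd_components[OF assms(1)] assms by auto
  have "matrix_inv (transpose F ** G ** F) = matrix_inv F ** matrix_inv G ** transpose (matrix_inv F)"
    using G0 F0 by (intro matrix_inv_eqI) (simp add: matrix_mul_assoc[symmetric] mat_cancel)
  then have "energy_density (transpose F ** G ** F) H (E ** A ** F) =
      trace (matrix_inv F ** (matrix_inv G ** transpose (matrix_inv F) ** transpose F ** transpose A ** transpose E ** H ** E ** A ** F))"
    by (simp add: energy_density_def matrix_transpose_mul matrix_mul_assoc)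
  also have "\<dots> = trace ((matrix_inv G ** transpose (matrix_inv F) ** transpose F ** transpose A ** transpose E ** H ** E ** A ** F) ** matrix_inv F)"
    by (rule trace_mul_sym)
  also have "\<dots> = energy_density G (transpose E ** H ** E) A"
    using F0 by (simp add: energy_density_def matrix_mul_assoc[symmetric] mat_cancel invertible_inverses)
  finally show "energy_density (transpose F ** G ** F) H (E ** A ** F) =
           energy_density G (transpose E ** H ** E) A" .
  show "area_density (transpose F ** G ** F) H (E ** A ** F) =
           area_density G (transpose E ** H ** E) A"
    using assms(3,4) spd_components(4)[OF assms(1)]
    by (simp add: area_density_def det_mul real_sqrt_mult field_simps)
qed

text \<open>After substituting \<open>e = s^2 - 2 * J\<close> both sides are quadratic in
  \<open>s\<close> and affine in \<open>J\<close>. The linear term \<open>- 2 * s\<close> together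
  with vanishing at \<open>s = 2 * r\<close> forces the square to be divided by
  \<open>2 * r\<close>; what is left of the coefficient of \<open>s^2\<close> falls to the
  conformality deficit, and the coefficients of \<open>J\<close> then agree.\<close>

lemma dist_sq_bound:
  fixes e J r :: real
  assumes r: "1/2 \<le> r" and "0 \<le> J" "2 * J \<le> e"
  defines "s \<equiv> sqrt (e + 2 * J)"
  shows "2 * (r - 1)\<^sup>2 + (2 - 2 / r) * (J - r\<^sup>2) + (s - 2 * r)\<^sup>2 / (2 * r)
          + (2 - 1 / r) * (s\<^sup>2 / 2 - 2 * J) = e - 2 * s + 2"
    and "0 \<le> s\<^sup>2 / 2 - 2 * J"
proof -
  have s2: "s\<^sup>2 = e + 2 * J" using assms by simp
  have e: "e = s\<^sup>2 - 2 * J" using s2 by simp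
  have "r > 0" using r by simp
  then show "2 * (r - 1)\<^sup>2 + (2 - 2 / r) * (J - r\<^sup>2) + (s - 2 * r)\<^sup>2 / (2 * r)
          + (2 - 1 / r) * (s\<^sup>2 / 2 - 2 * J) = e - 2 * s + 2"
    unfolding e by (simp add: field_simps power2_eq_square)
  show "0 \<le> s\<^sup>2 / 2 - 2 * J" using s2 assms by simp
qed

section \<open>Charts and derivatives on Lipschitz epigraphs\<close>

lemma at_within_openin:
  assumes "openin (top_of_set S) V" "z \<in> V"
  shows "at z within V = at z within S"
proof -
  obtain W where "open W" "V = S \<inter> W" using assms(1) by (auto simp: openin_open)
  then show ?thesis using assms(2) by (intro at_within_nhd[of z W]) auto
qed

lemma has_derivative_openin_cong:
  assumes "openin (top_of_set S) V" "z \<in> V" "\<And>w. w \<in> V \<Longrightarrow> g w = f w"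
    and "(f has_derivative D) (at z within V)"
  shows "(g has_derivative D) (at z within S)"
  using has_derivative_transform[of z V g f D] assms at_within_openin[of S V z] by simp

lemma lipschitz_epigraph_frame:
  assumes "locally_lipschitz_epigraph S" "z \<in> S"
  obtains W R L f where "open W" "z \<in> W" "orthogonal_transformation R" "0 \<le> L"
    "\<And>x y. \<bar>f x - f y\<bar> \<le> L * \<bar>x - y\<bar>" "\<And>w. w \<in> W \<Longrightarrow> w \<in> S \<longleftrightarrow> f (R w $ 1) \<le> (R w :: real^2) $ 2"
proof -
  obtain W R L f where W: "open W" "z \<in> W" and R: "orthogonal_transformation R"
    and f: "L-lipschitz_on UNIV f"
    and eq: "S \<inter> W = {w\<in>W. f (R w $ 1) \<le> (R w :: real^2) $ 2}"
    using assms(1)[unfolded locally_lipschitz_epigraph_def, rule_format, OF assms(2)]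
    by blast
  have "w \<in> S \<longleftrightarrow> f (R w $ 1) \<le> R w $ 2" if "w \<in> W" for w
  proof -
    have "w \<in> S \<longleftrightarrow> w \<in> S \<inter> W" using that by simp
    then show ?thesis unfolding eq using that by simp
  qed
  note mem = this
  have L: "0 \<le> L" and f': "\<And>x y. \<bar>f x - f y\<bar> \<le> L * \<bar>x - y\<bar>"
    using f unfolding lipschitz_on_def dist_real_def by blast+
  show thesis by (rule that[OF W R L f' mem])
qed

text \<open>Near each point the complement is a strict subgraph, open because a Lipschitz function
  is continuous. Local closedness gives both Borel measurability of chart images and compactness of
  their intersections with small closed balls.\<close>

lemma lipschitz_epigraph_locally_closed:
  assumes "locally_lipschitz_epigraph S"
  obtains U where "open U" "open (U - S)" "S \<subseteq> U"
proof -
  have "\<exists>W. open W \<and> z \<in> W \<and> open (W - S)" if "z \<in> S" for z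
  proof -
    obtain W R L f where W: "open W" "z \<in> W" and R: "orthogonal_transformation R" and L: "0 \<le> L"
      and f: "\<And>x y. \<bar>f x - f y\<bar> \<le> L * \<bar>x - y\<bar>"
      and eq: "\<And>w. w \<in> W \<Longrightarrow> w \<in> S \<longleftrightarrow> f (R w $ 1) \<le> (R w :: real^2) $ 2"
      using lipschitz_epigraph_frame[OF assms \<open>z \<in> S\<close>] by metis
    have R': "continuous_on UNIV R"
      using orthogonal_transformation_linear[OF R] by (intro linear_continuous_on) (simp add: linear_conv_bounded_linear)
    have "L-lipschitz_on UNIV f" using f L by (simp add: lipschitz_on_def dist_real_def)
    then have fc: "continuous_on UNIV f" by (rule lipschitz_on_continuous_on)
    have "open {w. (R w) $ 2 < f (R w $ 1)}"
      by (intro open_Collect_less continuous_intros continuous_on_compose2[OF fc] R') auto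
    moreover have "W - S = W \<inter> {w. R w $ 2 < f (R w $ 1)}" using eq by (auto simp: not_le)
    ultimately have "open (W - S)" using W(1) by (simp add: open_Int)
    then show ?thesis using W by blast
  qed
  then obtain W where W: "\<And>z. z \<in> S \<Longrightarrow> open (W z) \<and> z \<in> W z \<and> open (W z - S)" by metis
  show thesis
  proof
    show "open (\<Union>z\<in>S. W z)" "S \<subseteq> (\<Union>z\<in>S. W z)" using W by auto
    have "(\<Union>z\<in>S. W z) - S = (\<Union>z\<in>S. W z - S)" by auto
    moreover have "open (\<Union>z\<in>S. W z - S)" using W by (intro open_UN) blast
    ultimately show "open ((\<Union>z\<in>S. W z) - S)" by simp
  qed
qed

lemma lipschitz_epigraph_borel:
  assumes "locally_lipschitz_epigraph S"
  shows "S \<in> sets borel"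
proof -
  obtain U where "open U" "open (U - S)" "S \<subseteq> U"
    using assms by (rule lipschitz_epigraph_locally_closed)
  moreover then have "S = U - (U - S)" by auto
  ultimately show ?thesis by (metis borel_open sets.Diff)
qed

text \<open>An epigraph contains a solid cone at each of its points, and a linear map is determined
  by its values on a solid cone.\<close>

lemma lipschitz_epigraph_derivative_unique:
  fixes g :: "real^2 \<Rightarrow> real^2"
  assumes S: "locally_lipschitz_epigraph S" "z \<in> S"
    and D: "(g has_derivative D1) (at z within S)" "(g has_derivative D2) (at z within S)"
  shows "D1 = D2"
proof -
  obtain W R L f where W: "open W" "z \<in> W" and R: "orthogonal_transformation R" and L: "0 \<le> L"
    and f: "\<And>x y. \<bar>f x - f y\<bar> \<le> L * \<bar>x - y\<bar>"
    and eq: "\<And>w. w \<in> W \<Longrightarrow> w \<in> S \<longleftrightarrow> f (R w $ 1) \<le> (R w :: real^2) $ 2"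
    using lipschitz_epigraph_frame[OF S] by metis
  have linR: "linear R" "inj R" "surj R"
    using R by (auto simp: orthogonal_transformation_linear orthogonal_transformation_inj orthogonal_transformation_surj)
  \<comment> \<open>\<open>K\<close> sends the two basis vectors to \<open>(1, L + 1)\<close> and
    \<open>(-1, L + 1)\<close>, which are steeper than any chord of the graph of \<open>f\<close>.
    Small positive multiples of them therefore lead from a point of the epigraph into the epigraph,
    and derivatives agreeing along two independent directions coincide.\<close>
  define K :: "real^2 \<Rightarrow> real^2" where "K y = vector [y$1 - y$2, (L + 1) * (y$1 + y$2)]" for y
  have linK: "linear K"
    by (intro linearI) (auto simp: K_def vec_eq_iff forall_2 algebra_simps)
  have linI: "linear (inv R)" 
    using inj_linear_imp_inv_bounded_linear[of R] linR by (simp add: linear_conv_bounded_linear)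
  define B where "B = inv R \<circ> K"
  have linB: "linear B" unfolding B_def by (intro linear_compose linK linI)
  have RB: "R (B y) = K y" for y by (simp add: B_def surj_f_inv_f linR)
  define T where "T = {y. z + B y \<in> S}"
  have der: "((\<lambda>y. g (z + B y)) has_derivative (\<lambda>y. D (B y))) (at 0 within T)"
    if "(g has_derivative D) (at z within S)" for D
  proof -
    have z0: "z + B 0 = z" using linB by (simp add: linear_0)
    have "((\<lambda>y. z + B y) has_derivative (\<lambda>y. B y)) (at 0 within T)"
      using linB by (auto intro!: derivative_eq_intros bounded_linear_imp_has_derivative
          simp: linear_conv_bounded_linear)
    moreover have "(g has_derivative D) (at (z + B 0) within (\<lambda>y. z + B y) ` T)"
      unfolding z0 by (rule has_derivative_subset[OF that]) (auto simp: T_def)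
    ultimately show ?thesis using diff_chain_within by (fastforce simp: o_def)
  qed
  have cone: "\<exists>d. 0 < \<bar>d\<bar> \<and> \<bar>d\<bar> < e \<and> 0 + d *\<^sub>R i \<in> T" if "i \<in> Basis" "e > 0" for i :: "real^2" and e :: real
  proof -
    have "isCont (\<lambda>t. z + t *\<^sub>R B i) 0" by (intro continuous_intros)
    then have "((\<lambda>t. z + t *\<^sub>R B i) \<longlongrightarrow> z) (at 0)"
      by (simp add: isCont_def)
    then have "eventually (\<lambda>t. z + t *\<^sub>R B i \<in> W) (at 0)" by (rule topological_tendstoD) (use W in auto)
    then obtain r where r: "r > 0" "\<And>t. t \<noteq> 0 \<Longrightarrow> \<bar>t\<bar> < r \<Longrightarrow> z + t *\<^sub>R B i \<in> W"
      unfolding eventually_at by (auto simp: dist_real_def)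
    define t where "t = min r e / 2"
    have t: "0 < t" "t < r" "t < e" using r(1) that(2) by (auto simp: t_def min_def)
    have w: "z + t *\<^sub>R B i \<in> W" using r(2)[of t] t by simp
    have Rw: "R (z + t *\<^sub>R B i) = R z + t *\<^sub>R K i"
      using linR(1) by (simp add: linear_add linear_scale RB)
    have Ki: "(K i $ 1 = 1 \<or> K i $ 1 = -1) \<and> K i $ 2 = L + 1"
      using that(1) by (auto simp: K_def Basis_vec_def axis_def UNIV_2 exhaust_2)
    have "f (R z $ 1) \<le> R z $ 2" using eq W S by blast
    moreover have "f (R z $ 1 + t * K i $ 1) \<le> f (R z $ 1) + L * t"
      using f[of "R z $ 1 + t * K i $ 1" "R z $ 1"] Ki t by (auto simp: abs_mult)
    ultimately have "f (R z $ 1 + t * K i $ 1) \<le> R z $ 2 + t * K i $ 2"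
      using Ki t by (simp add: algebra_simps)
    then have "z + t *\<^sub>R B i \<in> S" unfolding eq[OF w] Rw by simp
    then have "t *\<^sub>R i \<in> T" using linB by (simp add: T_def linear_scale)
    then show ?thesis using t by (intro exI[of _ t]) simp
  qed
  have BB: "(\<lambda>y. D1 (B y)) = (\<lambda>y. D2 (B y))"
    using cone by (intro frechet_derivative_unique_within[OF der[OF D(1)] der[OF D(2)]]) auto
  show ?thesis
  proof
    fix v
    define q where "q = R v $ 2 / (L + 1)"
    have q: "(L + 1) * q = R v $ 2" using L by (simp add: q_def)
    define y :: "real^2" where "y = vector [(q + R v $ 1) / 2, (q - R v $ 1) / 2]"
    have "y$1 - y$2 = R v $ 1" "y$1 + y$2 = q" by (simp_all add: y_def field_simps)
    then have "K y = R v" unfolding K_def by (simp add: vec_eq_iff forall_2 q)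
    then have "B y = v" using RB[of y] linR(2) by (simp add: inj_eq)
    then show "D1 v = D2 v" using fun_cong[OF BB, of y] by simp
  qed
qed

section \<open>Charts as homeomorphisms onto Lipschitz epigraphs, and derivatives of maps read in
  charts\<close>

lemma riemannian_chartD:
  assumes "riemannian_chart X c"
  shows "inj_on (chart_map c) (chart_dom c)" "chart_dom c \<subseteq> X"
    "continuous_on (chart_dom c) (chart_map c)" "continuous_on (chart_image c) (chart_inv c)"
    "locally_lipschitz_epigraph (chart_image c)"
    "z \<in> chart_image c \<Longrightarrow> spd (chart_metric c z)"
    "openin (top_of_set X) (chart_dom c)"
proof -
  have c: "openin (top_of_set X) (chart_dom c)"
    "homeomorphism (chart_dom c) (chart_image c) (chart_map c) (chart_inv c)"
    "locally_lipschitz_epigraph (chart_image c)"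
    using assms by (simp_all add: riemannian_chart_def)
  show "inj_on (chart_map c) (chart_dom c)"
    by (rule inj_on_inverseI) (rule homeomorphism_apply1[OF c(2)])
  show "chart_dom c \<subseteq> X" by (rule openin_imp_subset[OF c(1)])
  show "continuous_on (chart_dom c) (chart_map c)" "continuous_on (chart_image c) (chart_inv c)"
    using c(2) by (simp_all add: homeomorphism_def)
  show "spd (chart_metric c z)" if "z \<in> chart_image c"
    using assms that unfolding riemannian_chart_def spd_def by blast
qed (use assms in \<open>simp_all add: riemannian_chart_def\<close>)

lemma chart_inv_simps [simp]:
  "z \<in> chart_image c \<Longrightarrow> chart_map c (chart_inv c z) = z"
  "z \<in> chart_image c \<Longrightarrow> chart_inv c z \<in> chart_dom c"
  by (auto simp: f_inv_into_f inv_into_into)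

lemma chart_inv_map:
  "riemannian_chart X c \<Longrightarrow> x \<in> chart_dom c \<Longrightarrow> chart_inv c (chart_map c x) = x"
  by (simp add: inv_into_f_f riemannian_chartD)

lemma chart_image_openin:
  assumes c: "riemannian_chart X c" and U: "openin (top_of_set X) U"
  shows "openin (top_of_set (chart_image c)) (chart_map c ` (U \<inter> chart_dom c))"
proof -
  have "openin (top_of_set (chart_dom c)) (U \<inter> chart_dom c)"
    using U riemannian_chartD(2)[OF c] by (auto simp: openin_open)
  moreover have "homeomorphism (chart_dom c) (chart_image c) (chart_map c) (chart_inv c)"
    using c by (simp add: riemannian_chart_def)
  ultimately show ?thesis by (metis homeomorphism_imp_open_map)
qed

lemma chart_image_openin_borel:
  assumes c: "riemannian_chart X c" and U: "openin (top_of_set X) U"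
  shows "chart_map c ` (U \<inter> chart_dom c) \<in> sets borel"
proof -
  obtain W where "open W" "chart_map c ` (U \<inter> chart_dom c) = chart_image c \<inter> W"
    using chart_image_openin[OF assms] by (auto simp: openin_open)
  then show ?thesis
    using lipschitz_epigraph_borel[OF riemannian_chartD(5)[OF c]] by simp
qed

lemma chart_image_borel:
  assumes c: "riemannian_chart X c"
  shows "chart_image c \<in> sets borel"
  by (rule lipschitz_epigraph_borel[OF riemannian_chartD(5)[OF c]])

lemma smooth_on_differentiable:
  assumes "smooth_on S f" "z \<in> S"
  obtains W F where "open W" "z \<in> W" "\<And>w. w \<in> S \<inter> W \<Longrightarrow> F w = f w"
    "F differentiable_on W" "\<And>v. continuous_on W (\<lambda>z. frechet_derivative F (at z) v)"
proof -
  obtain W F where W: "open W" "z \<in> W" "\<forall>k. times_cont_differentiable_on k F W" "\<forall>w\<in>S \<inter> W. F w = f w"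
    using assms unfolding smooth_on_def by blast
  have "times_cont_differentiable_on (Suc 0) F W" using W(3) by blast
  then have "F differentiable_on W" "\<And>v. continuous_on W (\<lambda>z. frechet_derivative F (at z) v)"
    by simp_all
  then show thesis using W(4) by (intro that[OF W(1,2)]) auto
qed

lemma smooth_on_has_derivative:
  assumes "smooth_on S f" "z \<in> S"
  obtains D where "(f has_derivative D) (at z within S)"
proof -
  obtain W F where W: "open W" "z \<in> W" "\<And>w. w \<in> S \<inter> W \<Longrightarrow> F w = f w" "F differentiable_on W"
    using smooth_on_differentiable[OF assms] by metis
  have "F differentiable (at z)"
    using W by (metis at_within_open differentiable_on_def)
  then have "(F has_derivative frechet_derivative F (at z)) (at z within S \<inter> W)"
    by (metis frechet_derivative_works has_derivative_at_withinI)
  then have "(f has_derivative frechet_derivative F (at z)) (at z within S)"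
    using assms(2) W by (intro has_derivative_openin_cong[of S "S \<inter> W" z f F]) (auto simp: openin_open)
  then show thesis by (rule that)
qed

lemma smooth_on_continuous_on:
  assumes "smooth_on S f"
  shows "continuous_on S f"
  by (metis assms continuous_on_eq_continuous_within has_derivative_continuous smooth_on_has_derivative)

text \<open>\<open>frechet_derivative\<close> is a choice among all derivatives within the chart
  image. The solid cone in an epigraph leaves only one, so any derivative that is exhibited is the
  chosen one.\<close>

lemma chart_diff_eqI:
  assumes "locally_lipschitz_epigraph (chart_image c)" "x \<in> chart_dom c"
    and "(chart_rep c d \<phi> has_derivative D) (at (chart_map c x) within chart_image c)"
  shows "chart_diff c d \<phi> x = matrix D"
proof -
  have "(chart_rep c d \<phi> has_derivative frechet_derivative (chart_rep c d \<phi>) (at (chart_map c x) within chart_image c))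
     (at (chart_map c x) within chart_image c)"
    using assms(3) by (metis differentiable_def frechet_derivative_works)
  then show ?thesis
    unfolding chart_diff_def
    using lipschitz_epigraph_derivative_unique[OF assms(1) imageI[OF assms(2)] assms(3)] by metis
qed

lemma chart_diff_has_derivative:
  assumes "chart_rep c d \<phi> differentiable (at (chart_map c x) within chart_image c)"
  shows "(chart_rep c d \<phi> has_derivative (\<lambda>v. chart_diff c d \<phi> x *v v))
     (at (chart_map c x) within chart_image c)"
proof -
  let ?F = "at (chart_map c x) within chart_image c"
  have D: "(chart_rep c d \<phi> has_derivative frechet_derivative (chart_rep c d \<phi>) ?F) ?F"
    using assms by (simp add: frechet_derivative_works)
  have "chart_diff c d \<phi> x *v v = frechet_derivative (chart_rep c d \<phi>) ?F v" for v
    unfolding chart_diff_def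
    by (rule matrix_works) (simp add: linear_matrix_vector_mul_eq has_derivative_linear[OF D])
  then show ?thesis using D by simp
qed

section \<open>Existence of the area measure\<close>

text \<open>The finite values of a non-negative integral are described one at a time, since the
  substitution theorem for absolutely integrable functions is an equivalence for each prospective
  value.\<close>

lemma absolutely_integrable_nn_integral:
  fixes f :: "real^2 \<Rightarrow> real"
  assumes "\<And>x. x \<in> S \<Longrightarrow> 0 \<le> f x" "S \<in> sets lebesgue" "f \<in> borel_measurable (lebesgue_on S)"
  shows "(\<integral>\<^sup>+x\<in>S. ennreal (f x) \<partial>lebesgue) = ennreal r \<and> 0 \<le> r \<longleftrightarrow>
    f absolutely_integrable_on S \<and> integral S f = r"
proof -
  let ?F = "\<lambda>x. if x \<in> S then f x else 0"
  have F: "?F \<in> borel_measurable lebesgue" using assms by (simp add: borel_measurable_if)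
  have "(\<integral>\<^sup>+x\<in>S. ennreal (f x) \<partial>lebesgue) = (\<integral>\<^sup>+x. ennreal (?F x) \<partial>lebesgue)"
    by (intro nn_integral_cong) (auto simp: indicator_def)
  then have "(\<integral>\<^sup>+x\<in>S. ennreal (f x) \<partial>lebesgue) = ennreal r \<and> 0 \<le> r \<longleftrightarrow> (?F has_integral r) UNIV"
    using assms(1) F by (subst has_integral_iff_nn_integral_lebesgue) auto
  also have "\<dots> \<longleftrightarrow> (f has_integral r) S" by (rule has_integral_restrict_UNIV)
  also have "\<dots> \<longleftrightarrow> f integrable_on S \<and> integral S f = r" by (rule has_integral_iff)
  also have "f integrable_on S \<longleftrightarrow> f absolutely_integrable_on S"
    using assms(1) by (simp add: absolutely_integrable_on_iff_nonneg)
  finally show ?thesis .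
qed

text \<open>Both integrals are equal to the same finite numbers by the substitution theorem, so they
  agree even when they are infinite. The map \<open>vec\<close> into \<open>real^1\<close> only
  adapts scalar functions to that theorem.\<close>

lemma nn_integral_change_of_variables:
  fixes g :: "real^2 \<Rightarrow> real^2" and f :: "real^2 \<Rightarrow> real"
  assumes S: "S \<in> sets lebesgue"
    and der: "\<And>x. x \<in> S \<Longrightarrow> (g has_derivative g' x) (at x within S)"
    and inj: "inj_on g S"
    and pos: "\<And>y. y \<in> g ` S \<Longrightarrow> 0 \<le> f y"
    and f: "f \<in> borel_measurable (lebesgue_on (g ` S))"
    and fg: "(\<lambda>x. f (g x)) \<in> borel_measurable (lebesgue_on S)"
  shows "(\<integral>\<^sup>+x\<in>S. ennreal (\<bar>det (matrix (g' x))\<bar> * f (g x)) \<partial>lebesgue) =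
    (\<integral>\<^sup>+y\<in>g ` S. ennreal (f y) \<partial>lebesgue)" (is "?A = ?B")
proof -
  have gS: "g ` S \<in> sets lebesgue"
    using S der by (intro differentiable_image_in_sets_lebesgue) (auto simp: differentiable_on_def differentiable_def)
  have "(\<lambda>x. det (matrix (g' x))) \<in> borel_measurable (lebesgue_on S)"
    by (rule borel_measurable_det_Jacobian[OF S der])
  then have m: "(\<lambda>x. \<bar>det (matrix (g' x))\<bar> * f (g x)) \<in> borel_measurable (lebesgue_on S)"
    using fg by measurable
  have "?A = ennreal r \<and> 0 \<le> r \<longleftrightarrow> ?B = ennreal r \<and> 0 \<le> r" for r
  proof -
    have "?A = ennreal r \<and> 0 \<le> r \<longleftrightarrow>
        (\<lambda>x. \<bar>det (matrix (g' x))\<bar> *\<^sub>R (vec (f (g x)) :: real^1)) absolutely_integrable_on S \<and>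
        integral S (\<lambda>x. \<bar>det (matrix (g' x))\<bar> *\<^sub>R (vec (f (g x)) :: real^1)) = vec r"
      using absolutely_integrable_nn_integral[OF _ S m] pos
      by (simp add: absolutely_integrable_on_1_iff integral_on_1_eq)
    also have "\<dots> \<longleftrightarrow> (\<lambda>y. (vec (f y) :: real^1)) absolutely_integrable_on (g ` S) \<and>
        integral (g ` S) (\<lambda>y. (vec (f y) :: real^1)) = vec r"
      by (rule has_absolute_integral_change_of_variables[OF S der inj])
    also have "\<dots> \<longleftrightarrow> ?B = ennreal r \<and> 0 \<le> r"
      using absolutely_integrable_nn_integral[OF pos gS f]
      by (simp add: absolutely_integrable_on_1_iff integral_on_1_eq)
    finally show ?thesis .
  qed
  moreover have "a = b" if "\<And>r. a = ennreal r \<and> 0 \<le> r \<longleftrightarrow> b = ennreal r \<and> 0 \<le> r" for a b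
    using that by (cases a rule: ennreal_cases) (metis ennreal_cases)+
  ultimately show ?thesis by blast
qed

section \<open>Charts, measurable sets and area of a single surface\<close>

locale riemannian_surface =
  fixes M :: "'a::t2_space surface"
  assumes surface: "compact_oriented_riemannian_surface M"
begin

lemma chart: "c \<in> atlas M \<Longrightarrow> riemannian_chart (pts M) c"
  and compatible: "c \<in> atlas M \<Longrightarrow> d \<in> atlas M \<Longrightarrow> compatible_charts c d"
  and atlas_cover: "(\<Union>c\<in>atlas M. chart_dom c) = pts M"
  and compact_pts: "compact (pts M)"
  using surface by (auto simp: compact_oriented_riemannian_surface_def)

lemmas chart_inj = riemannian_chartD(1)[OF chart]
lemmas chart_dom_subset = riemannian_chartD(2)[OF chart]
lemmas chart_continuous = riemannian_chartD(3)[OF chart]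
lemmas chart_inv_continuous = riemannian_chartD(4)[OF chart]
lemmas chart_epigraph = riemannian_chartD(5)[OF chart]
lemmas chart_spd = riemannian_chartD(6)[OF chart]
lemmas chart_openin = riemannian_chartD(7)[OF chart]
lemmas inv_map = chart_inv_map[OF chart]

lemma chart_at:
  assumes "x \<in> pts M"
  shows "chart_at M x \<in> atlas M" "x \<in> chart_dom (chart_at M x)"
proof -
  have "\<exists>c. c \<in> atlas M \<and> x \<in> chart_dom c" using assms atlas_cover by blast
  from someI_ex[OF this] show "chart_at M x \<in> atlas M" "x \<in> chart_dom (chart_at M x)"
    by (simp_all add: chart_at_def)
qed

lemma metric_spd: "c \<in> atlas M \<Longrightarrow> x \<in> chart_dom c \<Longrightarrow> spd (metric_at c x)"
  using chart_spd by blast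

lemma chart_diff_det: "c \<in> atlas M \<Longrightarrow> d \<in> atlas M \<Longrightarrow> x \<in> chart_dom c \<Longrightarrow> x \<in> chart_dom d \<Longrightarrow>
    0 < det (chart_diff c d (\<lambda>x. x) x)"
  and chart_diff_metric: "c \<in> atlas M \<Longrightarrow> d \<in> atlas M \<Longrightarrow> x \<in> chart_dom c \<Longrightarrow> x \<in> chart_dom d \<Longrightarrow>
    transpose (chart_diff c d (\<lambda>x. x) x) ** metric_at d x ** chart_diff c d (\<lambda>x. x) x = metric_at c x"
  using compatible[of c d] unfolding compatible_charts_def chart_pullback_def by blast+

lemma transition_derivative:
  assumes cd: "c \<in> atlas M" "d \<in> atlas M" and x: "x \<in> chart_dom c" "x \<in> chart_dom d"
  shows "(chart_rep c d (\<lambda>x. x) has_derivative (\<lambda>v. chart_diff c d (\<lambda>x. x) x *v v))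
     (at (chart_map c x) within chart_image c)"
proof (rule chart_diff_has_derivative)
  let ?V = "chart_map c ` (chart_dom d \<inter> chart_dom c)"
  have "openin (top_of_set (chart_image c)) ?V"
    using chart_image_openin[OF chart chart_openin] cd by blast
  moreover have "chart_map c x \<in> ?V" using x by auto
  moreover have "smooth_on ?V (chart_rep c d (\<lambda>x. x))"
    using compatible[OF cd] by (simp add: compatible_charts_def Int_commute)
  ultimately show "chart_rep c d (\<lambda>x. x) differentiable (at (chart_map c x) within chart_image c)"
    using smooth_on_has_derivative at_within_openin by (metis differentiable_def)
qed

lemma finite_subcover:
  assumes "\<And>x. x \<in> pts M \<Longrightarrow> openin (top_of_set (pts M)) (U x) \<and> x \<in> U x"
  obtains n and x :: "nat \<Rightarrow> 'a" where "\<And>i. i < n \<Longrightarrow> x i \<in> pts M" "pts M = (\<Union>i<n. U (x i))"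
proof -
  have "\<forall>C. (\<forall>c\<in>C. openin (top_of_set (pts M)) c) \<and> pts M \<subseteq> \<Union>C \<longrightarrow> (\<exists>D\<subseteq>C. finite D \<and> pts M \<subseteq> \<Union>D)"
    using compact_pts unfolding compact_eq_openin_cover .
  moreover have "\<forall>c\<in>U ` pts M. openin (top_of_set (pts M)) c" "pts M \<subseteq> \<Union>(U ` pts M)"
    using assms by blast+
  ultimately obtain \<D> where "\<D> \<subseteq> U ` pts M" "finite \<D>" "pts M \<subseteq> \<Union>\<D>" by meson
  then obtain F where F: "F \<subseteq> pts M" "finite F" "pts M \<subseteq> (\<Union>x\<in>F. U x)"
    by (metis finite_subset_image)
  have "U x \<subseteq> pts M" if "x \<in> F" for x
    using assms that F(1) openin_imp_subset by blast
  moreover obtain h and n :: nat where h: "F = h ` {..<n}"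
    using F(2) by (metis finite_imp_nat_seg_image_inj_on lessThan_def)
  ultimately show thesis using F by (intro that[of n h]) auto
qed

lemma finite_charts:
  obtains n and c :: "nat \<Rightarrow> 'a chart" where "\<And>i. i < n \<Longrightarrow> c i \<in> atlas M" "pts M = (\<Union>i<n. chart_dom (c i))"
proof -
  have "openin (top_of_set (pts M)) (chart_dom (chart_at M x)) \<and> x \<in> chart_dom (chart_at M x)"
    if "x \<in> pts M" for x
    using chart_at[OF that] chart_openin by blast
  then obtain n and x :: "nat \<Rightarrow> 'a" where "\<And>i. i < n \<Longrightarrow> x i \<in> pts M"
      "pts M = (\<Union>i<n. chart_dom (chart_at M (x i)))"
    using finite_subcover[of "\<lambda>x. chart_dom (chart_at M x)"] by metis
  then show thesis using that[of n "\<lambda>i. chart_at M (x i)"] chart_at by auto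
qed

definition surface_sets :: "'a set set" where
  "surface_sets = {B. B \<subseteq> pts M \<and> (\<forall>c\<in>atlas M. chart_map c ` (B \<inter> chart_dom c) \<in> sets lebesgue)}"

lemma openin_surface_sets:
  assumes "openin (top_of_set (pts M)) U"
  shows "U \<in> surface_sets"
  using assms chart_image_openin_borel[OF chart assms] openin_imp_subset
  by (fastforce simp: surface_sets_def)

lemma chart_dom_surface_sets: "c \<in> atlas M \<Longrightarrow> chart_dom c \<in> surface_sets"
  using openin_surface_sets chart_openin by blast

lemma surface_sets_image:
  assumes "B \<in> surface_sets" "B \<subseteq> chart_dom c" "c \<in> atlas M"
  shows "chart_map c ` B \<in> sets lebesgue"
  using assms by (auto simp: surface_sets_def dest!: bspec[of _ _ c] simp: Int_absorb2)

lemma sigma_algebra_surface_sets: "sigma_algebra (pts M) surface_sets"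
  unfolding sigma_algebra_iff2
proof (intro conjI ballI allI impI)
  show "surface_sets \<subseteq> Pow (pts M)" "{} \<in> surface_sets" by (auto simp: surface_sets_def)
  fix s assume s: "s \<in> surface_sets"
  have "chart_map c ` ((pts M - s) \<inter> chart_dom c) \<in> sets lebesgue" if c: "c \<in> atlas M" for c
  proof -
    have "chart_map c ` ((pts M - s) \<inter> chart_dom c) = chart_image c - chart_map c ` (s \<inter> chart_dom c)"
      using chart_inj[OF c] chart_dom_subset[OF c] by (auto simp: inj_on_def)
    then show ?thesis
      using s c chart_image_borel[OF chart[OF c]] by (auto simp: surface_sets_def)
  qed
  then show "pts M - s \<in> surface_sets" by (simp add: surface_sets_def)
next
  fix A :: "nat \<Rightarrow> 'a set" assume A: "range A \<subseteq> surface_sets"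
  have eq: "chart_map c ` ((\<Union>i. A i) \<inter> chart_dom c) = (\<Union>i. chart_map c ` (A i \<inter> chart_dom c))" for c by auto
  have "(\<Union>i. chart_map c ` (A i \<inter> chart_dom c)) \<in> sets lebesgue" if "c \<in> atlas M" for c
    using A that by (intro sets.countable_UN) (auto simp: surface_sets_def)
  moreover have "(\<Union>i. A i) \<subseteq> pts M" using A by (auto simp: surface_sets_def)
  ultimately show "(\<Union>i. A i) \<in> surface_sets" unfolding surface_sets_def mem_Collect_eq eq by blast
qed

text \<open>The area form in coordinates as a measure on the whole plane; the density is set to zero
  off the chart image, where the matrix field is meaningless.\<close>

definition chart_area :: "'a chart \<Rightarrow> (real^2) measure" where
  "chart_area c = density lebesgue
     (\<lambda>z. ennreal (if z \<in> chart_image c then sqrt (det (chart_metric c z)) else 0))"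

lemma chart_metric_continuous: "c \<in> atlas M \<Longrightarrow> continuous_on (chart_image c) (chart_metric c)"
  using chart[of c] by (intro smooth_on_continuous_on) (simp add: riemannian_chart_def)

lemma chart_density_continuous:
  "c \<in> atlas M \<Longrightarrow> continuous_on (chart_image c) (\<lambda>z. sqrt (det (chart_metric c z)))"
  unfolding det_2 by (intro continuous_intros chart_metric_continuous)

lemma chart_area_density_measurable:
  assumes "c \<in> atlas M"
  shows "(\<lambda>z. if z \<in> chart_image c then sqrt (det (chart_metric c z)) else 0) \<in> borel_measurable lebesgue"
  using chart_image_borel[OF chart[OF assms]] assms
  by (subst borel_measurable_if)
    (auto intro!: continuous_imp_measurable_on_sets_lebesgue chart_density_continuous)

lemma emeasure_chart_area:
  assumes "c \<in> atlas M" "B \<in> surface_sets" "B \<subseteq> chart_dom c"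
  shows "emeasure (chart_area c) (chart_map c ` B) =
    (\<integral>\<^sup>+z\<in>chart_map c ` B. ennreal (sqrt (det (chart_metric c z))) \<partial>lebesgue)"
proof -
  have sub: "z \<in> chart_map c ` B \<Longrightarrow> z \<in> chart_image c" for z using assms(3) by blast
  show ?thesis
    unfolding chart_area_def
    using chart_area_density_measurable[OF assms(1)] surface_sets_image[OF assms(2,3,1)]
    by (subst emeasure_density) (use sub in \<open>auto intro!: nn_integral_cong simp: indicator_def simp del: image_iff\<close>)
qed

text \<open>Determinants in the congruence between the two metric fields give the ratio of their
  area densities as the absolute value of the Jacobian of the transition map, which is the factor in
  the substitution formula.\<close>

lemma chart_area_transition:
  assumes cd: "c \<in> atlas M" "d \<in> atlas M" and B: "B \<in> surface_sets" "B \<subseteq> chart_dom c" "B \<subseteq> chart_dom d"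
  shows "emeasure (chart_area c) (chart_map c ` B) = emeasure (chart_area d) (chart_map d ` B)"
proof -
  let ?g = "chart_rep c d (\<lambda>x. x)" and ?S = "chart_map c ` B"
  let ?D = "\<lambda>z v. chart_diff c d (\<lambda>x. x) (chart_inv c z) *v v"
  have inv: "chart_inv c (chart_map c x) = x" if "x \<in> B" for x
    using inv_map[OF cd(1)] that B by blast
  have S: "?S \<in> sets lebesgue" using surface_sets_image B cd by blast
  have gS: "?g ` ?S = chart_map d ` B"
    by (force simp: chart_rep_def image_iff inv)
  have sub: "?S \<subseteq> chart_image c" "chart_map d ` B \<subseteq> chart_image d" using B by auto
  have der: "(?g has_derivative ?D z) (at z within ?S)" if z: "z \<in> ?S" for z
  proof -
    obtain x where x: "x \<in> B" "z = chart_map c x" using z by blast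
    then have "(?g has_derivative (\<lambda>v. chart_diff c d (\<lambda>x. x) x *v v)) (at z within chart_image c)"
      using transition_derivative[OF cd] B by blast
    then show ?thesis using x inv by (simp add: has_derivative_subset[OF _ sub(1)])
  qed
  have inj: "inj_on ?g ?S"
  proof (rule inj_onI)
    fix z w assume "z \<in> ?S" "w \<in> ?S" and eq: "?g z = ?g w"
    then obtain x y where xy: "x \<in> B" "y \<in> B" "z = chart_map c x" "w = chart_map c y" by blast
    then have "chart_map d x = chart_map d y" using eq by (simp add: chart_rep_def inv)
    then have "x = y" using inj_onD[OF chart_inj[OF cd(2)]] xy B by blast
    then show "z = w" using xy by simp
  qed
  have m: "(\<lambda>z. sqrt (det (chart_metric d z))) \<in> borel_measurable (lebesgue_on (?g ` ?S))"
    unfolding gS using sub(2) surface_sets_image B cd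
    by (intro continuous_imp_measurable_on_sets_lebesgue continuous_on_subset[OF chart_density_continuous]) auto
  have "continuous_on ?S ?g"
    using der by (meson continuous_on_eq_continuous_within has_derivative_continuous)
  then have m': "(\<lambda>z. sqrt (det (chart_metric d (?g z)))) \<in> borel_measurable (lebesgue_on ?S)"
    using S gS sub(2) cd
    by (intro continuous_imp_measurable_on_sets_lebesgue continuous_on_compose2[OF chart_density_continuous]) auto
  have eq: "sqrt (det (metric_at c x)) =
      \<bar>det (chart_diff c d (\<lambda>x. x) x)\<bar> * sqrt (det (metric_at d x))" if "x \<in> B" for x
  proof -
    have "x \<in> chart_dom c" "x \<in> chart_dom d" using that B by auto
    from chart_diff_metric[OF cd this, symmetric] show ?thesis
      by (simp add: det_mul real_sqrt_mult)
  qed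
  have "(\<integral>\<^sup>+z\<in>?S. ennreal (sqrt (det (chart_metric c z))) \<partial>lebesgue) =
      (\<integral>\<^sup>+z\<in>?S. ennreal (\<bar>det (matrix (?D z))\<bar> * sqrt (det (chart_metric d (?g z)))) \<partial>lebesgue)"
    using eq by (intro nn_integral_cong) (auto simp: indicator_def inv chart_rep_def)
  also have "\<dots> = (\<integral>\<^sup>+z\<in>?g ` ?S. ennreal (sqrt (det (chart_metric d z))) \<partial>lebesgue)"
    using spd_components(4) metric_spd[OF cd(2)] B(3) unfolding gS
    by (intro nn_integral_change_of_variables[OF S der inj _ m m', unfolded gS]) (auto intro: less_imp_le)
  finally show ?thesis unfolding gS using cd B by (simp add: emeasure_chart_area)
qed

lemma emeasure_chart_area_UN:
  fixes A :: "nat \<Rightarrow> 'a set"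
  assumes c: "c \<in> atlas M" and A: "\<And>i. A i \<in> surface_sets" "\<And>i. A i \<subseteq> chart_dom c" "disjoint_family A"
  shows "(\<Sum>i. emeasure (chart_area c) (chart_map c ` A i)) = emeasure (chart_area c) (chart_map c ` (\<Union>i. A i))"
proof -
  have "disjoint_family (\<lambda>i. chart_map c ` A i)"
    using A(2,3) chart_inj[OF c]
    by (simp add: disjoint_family_on_def) (metis (no_types, lifting) image_empty inj_on_image_Int)
  then show ?thesis
    using surface_sets_image A c by (subst suminf_emeasure) (auto simp: chart_area_def image_UN)
qed

text \<open>The choice behind \<open>area_measure\<close> is usable once one such measure is known.
  It is built by cutting the surface into disjoint pieces that each lie in one chart and adding
  their coordinate areas; invariance under transitions shows that within any other chart the sum is
  again the coordinate area.\<close>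

lemma area_measure:
  shows space_area: "space (area_measure M) = pts M"
    and sets_area: "sets (area_measure M) = surface_sets"
    and emeasure_area: "\<And>c B. \<lbrakk>c \<in> atlas M; B \<in> surface_sets; B \<subseteq> chart_dom c\<rbrakk> \<Longrightarrow>
          emeasure (area_measure M) B = emeasure (chart_area c) (chart_map c ` B)"
proof -
  interpret S: sigma_algebra "pts M" surface_sets by (rule sigma_algebra_surface_sets)
  obtain n and c :: "nat \<Rightarrow> 'a chart" where c: "\<And>i. i < n \<Longrightarrow> c i \<in> atlas M"
      and cov: "pts M = (\<Union>i<n. chart_dom (c i))"
    using finite_charts by metis
  \<comment> \<open>From index \<open>n\<close> on the sequence is filled up with empty sets, so the
    finite cover can be made disjoint as a sequence and finite sums can be read as series.\<close>
  define D where "D i = disjointed (\<lambda>i. if i < n then chart_dom (c i) else {}) i" for i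
  have D: "D i \<in> surface_sets" for i
    unfolding D_def
    using S.range_disjointed_sets[of "\<lambda>i. if i < n then chart_dom (c i) else {}"] c chart_dom_surface_sets
    by auto
  have Dc: "D i \<subseteq> chart_dom (c i)" if "i < n" for i
    unfolding D_def using disjointed_subset[of "\<lambda>i. if i < n then chart_dom (c i) else {}" i] that by simp
  have Dd: "disjoint_family D" unfolding D_def by (rule disjoint_family_disjointed)
  have Dn: "D i = {}" if "\<not> i < n" for i
    unfolding D_def using disjointed_subset[of "\<lambda>i. if i < n then chart_dom (c i) else {}" i] that by simp
  have "(\<Union>i. D i) = (\<Union>i. if i < n then chart_dom (c i) else {})"
    unfolding D_def by (rule UN_disjointed_eq)
  also have "\<dots> = pts M" unfolding cov by (auto split: if_splits)
  finally have DU: "(\<Union>i. D i) = pts M" .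
  define m where "m B = (\<Sum>i<n. emeasure (chart_area (c i)) (chart_map (c i) ` (B \<inter> D i)))" for B
  have pos: "positive surface_sets m" by (simp add: positive_def m_def)
  have "countably_additive surface_sets m"
  proof (rule countably_additiveI)
    fix A :: "nat \<Rightarrow> 'a set"
    assume A: "range A \<subseteq> surface_sets" "disjoint_family A"
    have AD: "A k \<inter> D i \<in> surface_sets" for k i using A(1) D by (intro S.Int) auto
    have ADc: "A k \<inter> D i \<subseteq> chart_dom (c i)" if "i < n" for k i using Dc[OF that] by blast
    have "(\<Sum>k. m (A k)) = (\<Sum>i<n. \<Sum>k. emeasure (chart_area (c i)) (chart_map (c i) ` (A k \<inter> D i)))"
      unfolding m_def by (rule suminf_sum) simp
    also have "\<dots> = (\<Sum>i<n. emeasure (chart_area (c i)) (chart_map (c i) ` (\<Union>k. A k \<inter> D i)))"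
      using A c AD ADc
      by (intro sum.cong refl emeasure_chart_area_UN) (auto simp: disjoint_family_on_def)
    also have "\<dots> = m (\<Union>k. A k)" by (simp add: m_def)
    finally show "(\<Sum>k. m (A k)) = m (\<Union>k. A k)" .
  qed
  from emeasure_measure_of_sigma[OF sigma_algebra_surface_sets pos this]
  have em: "B \<in> surface_sets \<Longrightarrow> emeasure (measure_of (pts M) surface_sets m) B = m B" for B .
  have mc: "m B = emeasure (chart_area d) (chart_map d ` B)"
    if "d \<in> atlas M" "B \<in> surface_sets" "B \<subseteq> chart_dom d" for d B
  proof -
    have "m B = (\<Sum>i<n. emeasure (chart_area d) (chart_map d ` (B \<inter> D i)))"
      unfolding m_def using that D Dc c by (intro sum.cong refl chart_area_transition) auto
    also have "\<dots> = (\<Sum>i. emeasure (chart_area d) (chart_map d ` (B \<inter> D i)))"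
      using Dn by (subst suminf_finite[of "{..<n}"]) auto
    also have "\<dots> = emeasure (chart_area d) (chart_map d ` (\<Union>i. B \<inter> D i))"
    proof (rule emeasure_chart_area_UN[OF that(1)])
      show "disjoint_family (\<lambda>i. B \<inter> D i)" using Dd unfolding disjoint_family_on_def by blast
    qed (use that D in auto)
    also have "(\<Union>i. B \<inter> D i) = B" using DU that chart_dom_subset by blast
    finally show ?thesis .
  qed
  have "\<exists>\<mu>. space \<mu> = pts M \<and>
     sets \<mu> = {B. B \<subseteq> pts M \<and>
                 (\<forall>c\<in>atlas M. chart_map c ` (B \<inter> chart_dom c) \<in> sets lebesgue)} \<and>
     (\<forall>c\<in>atlas M. \<forall>B\<in>sets \<mu>. B \<subseteq> chart_dom c \<longrightarrow>
        emeasure \<mu> B =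
          (\<integral>\<^sup>+z\<in>chart_map c ` B. ennreal (sqrt (det (chart_metric c z))) \<partial>lebesgue))"
    using S.sets_measure_of_eq S.space_measure_of_eq
    by (intro exI[of _ "measure_of (pts M) surface_sets m"])
      (auto simp: em mc emeasure_chart_area simp flip: surface_sets_def)
  from someI_ex[OF this, folded area_measure_def surface_sets_def]
  show "space (area_measure M) = pts M" "sets (area_measure M) = surface_sets"
    "\<And>c B. \<lbrakk>c \<in> atlas M; B \<in> surface_sets; B \<subseteq> chart_dom c\<rbrakk> \<Longrightarrow>
          emeasure (area_measure M) B = emeasure (chart_area c) (chart_map c ` B)"
    by (simp_all add: emeasure_chart_area)
qed

end

text \<open>Moving a point of the epigraph slightly upwards puts it strictly above the graph, where
  the epigraph is a neighbourhood. This is what gives relatively open sets positive area even near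
  the boundary.\<close>

lemma lipschitz_epigraph_open_subset:
  assumes S: "locally_lipschitz_epigraph S" and V: "openin (top_of_set S) V" "V \<noteq> {}"
  obtains B where "open B" "B \<noteq> {}" "B \<subseteq> V"
proof -
  obtain z where z: "z \<in> V" using V by blast
  obtain W' where W': "open W'" "V = S \<inter> W'" using V by (auto simp: openin_open)
  obtain W R L f where W: "open W" "z \<in> W" and R: "orthogonal_transformation R" and L: "0 \<le> L"
    and f: "\<And>x y. \<bar>f x - f y\<bar> \<le> L * \<bar>x - y\<bar>"
    and eq: "\<And>w. w \<in> W \<Longrightarrow> w \<in> S \<longleftrightarrow> f (R w $ 1) \<le> (R w :: real^2) $ 2"
    using lipschitz_epigraph_frame[OF S, of z] z W' by (metis IntD1)
  have linR: "linear R" "surj R"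
    using R by (auto simp: orthogonal_transformation_linear orthogonal_transformation_surj)
  have R': "continuous_on UNIV R"
    using linR(1) by (intro linear_continuous_on) (simp add: linear_conv_bounded_linear)
  have "L-lipschitz_on UNIV f" using f L by (simp add: lipschitz_on_def dist_real_def)
  then have fc: "continuous_on UNIV f" by (rule lipschitz_on_continuous_on)
  define B where "B = W \<inter> W' \<inter> {w. f (R w $ 1) < R w $ 2}"
  have "open {w. f (R w $ 1) < R w $ 2}"
    by (intro open_Collect_less continuous_intros continuous_on_compose2[OF fc] R') auto
  then have "open B" using W W' by (auto simp: B_def open_Int)
  moreover have "B \<subseteq> V" using eq W'(2) by (auto simp: B_def)
  moreover have "B \<noteq> {}"
  proof -
    obtain u where u: "R u = vector [0, 1]" using linR(2) by (metis surjD)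
    have "((\<lambda>t. z + t *\<^sub>R u) \<longlongrightarrow> z + 0 *\<^sub>R u) (at_right (0::real))" by (intro tendsto_intros)
    then have "((\<lambda>t. z + t *\<^sub>R u) \<longlongrightarrow> z) (at_right (0::real))" by simp
    then have "eventually (\<lambda>t. z + t *\<^sub>R u \<in> W \<inter> W') (at_right (0::real))"
      by (rule topological_tendstoD) (use W W' z in \<open>auto simp: open_Int\<close>)
    then have "eventually (\<lambda>t. z + t *\<^sub>R u \<in> W \<inter> W' \<and> 0 < t) (at_right (0::real))"
      using eventually_at_right_less by (rule eventually_conj)
    then obtain t :: real where t: "z + t *\<^sub>R u \<in> W \<inter> W'" "0 < t"
      using eventually_happens'[OF trivial_limit_at_right_real] by blast
    have "f (R z $ 1) \<le> R z $ 2" using eq W z W' by blast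
    then have "f (R (z + t *\<^sub>R u) $ 1) < R (z + t *\<^sub>R u) $ 2"
      using t(2) linR(1) by (simp add: linear_add linear_scale u)
    then show ?thesis using t by (auto simp: B_def)
  qed
  ultimately show thesis using that by blast
qed

section \<open>Null sets, measurability and integrals in charts\<close>

context riemannian_surface begin

lemma transition_image:
  assumes "c \<in> atlas M" "d \<in> atlas M" "B \<subseteq> chart_dom c" "B \<subseteq> chart_dom d"
  shows "chart_map d ` B = chart_rep c d (\<lambda>x. x) ` chart_map c ` B"
    "chart_rep c d (\<lambda>x. x) differentiable_on (chart_map c ` B)"
proof -
  have "chart_inv c (chart_map c x) = x" if "x \<in> B" for x
    using inv_map that assms by blast
  then show "chart_map d ` B = chart_rep c d (\<lambda>x. x) ` chart_map c ` B"
    by (force simp: chart_rep_def image_iff)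
  show "chart_rep c d (\<lambda>x. x) differentiable_on (chart_map c ` B)"
    unfolding differentiable_on_def
  proof
    fix z assume "z \<in> chart_map c ` B"
    then obtain x where "x \<in> B" "z = chart_map c x" by blast
    then have "chart_rep c d (\<lambda>x. x) differentiable (at z within chart_image c)"
      using transition_derivative assms by (metis differentiable_def subsetD)
    then show "chart_rep c d (\<lambda>x. x) differentiable (at z within chart_map c ` B)"
      using assms(3) by (meson differentiable_within_subset image_mono)
  qed
qed

text \<open>One chart suffices because transition maps are differentiable, and differentiable images
  of Lebesgue measurable plane sets are Lebesgue measurable.\<close>

lemma surface_setsI:
  assumes c: "c \<in> atlas M" and B: "B \<subseteq> chart_dom c" "chart_map c ` B \<in> sets lebesgue"
  shows "B \<in> surface_sets"
proof -
  have "chart_map d ` (B \<inter> chart_dom d) \<in> sets lebesgue" if d: "d \<in> atlas M" for d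
  proof -
    have B': "B \<inter> chart_dom d \<subseteq> chart_dom c" "B \<inter> chart_dom d \<subseteq> chart_dom d" using B by auto
    have "chart_map c ` (B \<inter> chart_dom d) = chart_map c ` B \<inter> chart_map c ` (chart_dom d \<inter> chart_dom c)"
      using chart_inj[OF c] B by (auto simp: inj_on_def)
    moreover have "chart_map c ` (chart_dom d \<inter> chart_dom c) \<in> sets lebesgue"
      using chart_image_openin_borel[OF chart[OF c] chart_openin[OF d]] by simp
    ultimately have "chart_map c ` (B \<inter> chart_dom d) \<in> sets lebesgue" using B by auto
    then show ?thesis
      using transition_image[OF c d B']
      by (metis differentiable_image_in_sets_lebesgue order_refl)
  qed
  then show ?thesis using B chart_dom_subset[OF c] by (auto simp: surface_sets_def)
qed

text \<open>The area density is strictly positive on the chart image, so it creates no null sets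
  beyond the negligible ones.\<close>

lemma chart_null:
  assumes c: "c \<in> atlas M" and B: "B \<in> surface_sets" "B \<subseteq> chart_dom c"
  shows "emeasure (area_measure M) B = 0 \<longleftrightarrow> negligible (chart_map c ` B)"
proof -
  have S: "chart_map c ` B \<in> sets lebesgue" by (rule surface_sets_image[OF B c])
  have "emeasure (area_measure M) B = 0 \<longleftrightarrow>
      (AE z in lebesgue. z \<in> chart_map c ` B \<longrightarrow> ennreal (if z \<in> chart_image c then sqrt (det (chart_metric c z)) else 0) = 0)"
    unfolding emeasure_area[OF c B] chart_area_def
    using chart_area_density_measurable[OF c] S
    by (subst emeasure_density) (auto simp: nn_integral_0_iff_AE indicator_def intro!: AE_cong)
  also have "\<dots> \<longleftrightarrow> (AE z in lebesgue. z \<notin> chart_map c ` B)"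
  proof (intro AE_cong)
    fix z
    show "(z \<in> chart_map c ` B \<longrightarrow> ennreal (if z \<in> chart_image c then sqrt (det (chart_metric c z)) else 0) = 0)
      \<longleftrightarrow> z \<notin> chart_map c ` B"
    proof (cases "z \<in> chart_map c ` B")
      case True
      then have z: "z \<in> chart_image c" using B by blast
      then have "0 < det (chart_metric c z)"
        using spd_components(4)[OF chart_spd[OF c]] by blast
      then show ?thesis using True z by (simp add: ennreal_eq_0_iff not_le)
    qed simp
  qed
  also have "\<dots> \<longleftrightarrow> negligible (chart_map c ` B)"
    using S by (simp add: negligible_iff_null_sets AE_iff_null_sets)
  finally show ?thesis .
qed

lemma surface_sets_Int: "A \<in> surface_sets \<Longrightarrow> B \<in> surface_sets \<Longrightarrow> A \<inter> B \<in> surface_sets"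
  using sets.Int[of A "area_measure M" B] by (simp add: sets_area)

lemma null_sets_area_iff:
  "B \<in> null_sets (area_measure M) \<longleftrightarrow>
    B \<subseteq> pts M \<and> (\<forall>c\<in>atlas M. negligible (chart_map c ` (B \<inter> chart_dom c)))"
proof (intro iffI conjI ballI; (elim conjE)?)
  assume B: "B \<in> null_sets (area_measure M)"
  then have Bs: "B \<in> surface_sets" by (auto simp: sets_area)
  then show "B \<subseteq> pts M" by (simp add: surface_sets_def)
  fix c assume c: "c \<in> atlas M"
  have BI: "B \<inter> chart_dom c \<in> surface_sets" using Bs chart_dom_surface_sets[OF c] by (rule surface_sets_Int)
  have "emeasure (area_measure M) (B \<inter> chart_dom c) = 0"
    using B BI by (metis emeasure_mono inf_le1 le_zero_eq null_setsD1 null_setsD2)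
  then show "negligible (chart_map c ` (B \<inter> chart_dom c))"
    using chart_null[OF c BI] by simp
next
  assume B: "B \<subseteq> pts M" "\<forall>c\<in>atlas M. negligible (chart_map c ` (B \<inter> chart_dom c))"
  then have "B \<in> surface_sets" by (auto simp: surface_sets_def negligible_imp_sets)
  obtain n and c :: "nat \<Rightarrow> 'a chart" where c: "\<And>i. i < n \<Longrightarrow> c i \<in> atlas M" "pts M = (\<Union>i<n. chart_dom (c i))"
    using finite_charts by metis
  have "B \<inter> chart_dom (c i) \<in> null_sets (area_measure M)" if i: "i < n" for i
  proof -
    have BI: "B \<inter> chart_dom (c i) \<in> surface_sets"
      using \<open>B \<in> surface_sets\<close> chart_dom_surface_sets[OF c(1)[OF i]] by (rule surface_sets_Int)
    then show ?thesis
      using chart_null[OF c(1)[OF i] BI] B(2) c(1)[OF i] by (auto simp: null_sets_def sets_area)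
  qed
  then have "(\<Union>i\<in>{..<n}. B \<inter> chart_dom (c i)) \<in> null_sets (area_measure M)"
    by (intro null_sets_UN') auto
  moreover have "(\<Union>i\<in>{..<n}. B \<inter> chart_dom (c i)) = B" using B(1) c(2) by auto
  ultimately show "B \<in> null_sets (area_measure M)" by simp
qed

text \<open>Completeness of the area measure, inherited from negligible sets in the plane.
  Exceptional sets of almost-everywhere statements become null sets without a separate measurability
  argument.\<close>

lemma null_sets_area_subset:
  "B \<in> null_sets (area_measure M) \<Longrightarrow> A \<subseteq> B \<Longrightarrow> A \<in> null_sets (area_measure M)"
  unfolding null_sets_area_iff by (meson Int_mono image_mono negligible_subset order_refl order_trans)

lemma AE_area_null:
  assumes "AE x in area_measure M. P x"
  shows "{x \<in> pts M. \<not> P x} \<in> null_sets (area_measure M)"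
  using assms null_sets_area_subset by (auto simp: eventually_ae_filter space_area)

text \<open>The area measure has full support. This later turns a compact image of full area into
  the whole surface, since its complement is relatively open and null.\<close>

lemma open_null_empty:
  assumes "openin (top_of_set (pts M)) U" "U \<in> null_sets (area_measure M)"
  shows "U = {}"
proof (rule ccontr)
  assume "U \<noteq> {}"
  then obtain x where x: "x \<in> U" by blast
  then have xM: "x \<in> pts M" using assms(1) openin_imp_subset by blast
  define c where "c = chart_at M x"
  have c: "c \<in> atlas M" "x \<in> chart_dom c" using chart_at[OF xM] by (auto simp: c_def)
  have "openin (top_of_set (chart_image c)) (chart_map c ` (U \<inter> chart_dom c))"
    by (rule chart_image_openin[OF chart[OF c(1)] assms(1)])
  moreover have "chart_map c ` (U \<inter> chart_dom c) \<noteq> {}" using x c by blast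
  ultimately obtain B where "open B" "B \<noteq> {}" "B \<subseteq> chart_map c ` (U \<inter> chart_dom c)"
    using lipschitz_epigraph_open_subset[OF chart_epigraph[OF c(1)]] by metis
  moreover have "negligible (chart_map c ` (U \<inter> chart_dom c))"
    using assms(2) c(1) by (simp add: null_sets_area_iff)
  ultimately show False using negligible_subset open_not_negligible by blast
qed

lemma borel_measurable_piece:
  assumes c: "c \<in> atlas M" and D: "D \<in> surface_sets" "D \<subseteq> chart_dom c"
    and f: "(\<lambda>z. f (chart_inv c z)) \<in> borel_measurable (lebesgue_on (chart_map c ` D))"
  shows "f \<in> borel_measurable (restrict_space (area_measure M) D)"
proof -
  have inv: "chart_inv c (chart_map c x) = x" if "x \<in> D" for x
    using inv_map[OF c] that D by blast
  have sp: "space (restrict_space (area_measure M) D) = D"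
    using D(1) by (auto simp: space_restrict_space space_area surface_sets_def)
  have S: "chart_map c ` D \<in> sets lebesgue" by (rule surface_sets_image[OF D c])
  have "chart_map c \<in> restrict_space (area_measure M) D \<rightarrow>\<^sub>M lebesgue_on (chart_map c ` D)"
  proof (rule measurableI)
    fix A assume "A \<in> sets (lebesgue_on (chart_map c ` D))"
    then have A: "A \<in> sets lebesgue" "A \<subseteq> chart_map c ` D"
      using S by (auto simp: sets_restrict_space_iff)
    define B where "B = chart_map c -` A \<inter> D"
    have "chart_map c ` B = A" using A by (auto simp: B_def)
    then have "B \<in> surface_sets" using A D by (intro surface_setsI[OF c]) (auto simp: B_def)
    moreover have "B \<subseteq> D" by (auto simp: B_def)
    moreover have "D \<inter> pts M = D" using D(1) by (auto simp: surface_sets_def)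
    ultimately show "chart_map c -` A \<inter> space (restrict_space (area_measure M) D) \<in> sets (restrict_space (area_measure M) D)"
      using D(1) unfolding sp B_def[symmetric]
      by (simp add: sets_restrict_space_iff sets_area space_area)
  qed (use sp in auto)
  from measurable_compose[OF this f]
  have "(\<lambda>x. f (chart_inv c (chart_map c x))) \<in> borel_measurable (restrict_space (area_measure M) D)" .
  then show ?thesis by (rule measurable_cong[THEN iffD1, rotated]) (simp add: sp inv)
qed

text \<open>On a chart domain the area measure is the image of \<open>chart_area\<close> under the
  inverse chart; the rest is the transformation rule for image measures and for densities.\<close>

lemma nn_integral_chart:
  assumes c: "c \<in> atlas M" and D: "D \<in> surface_sets" "D \<subseteq> chart_dom c"
    and f: "f \<in> borel_measurable (area_measure M)"
  shows "(\<integral>\<^sup>+x\<in>D. f x \<partial>area_measure M) =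
    (\<integral>\<^sup>+z\<in>chart_map c ` D. f (chart_inv c z) * ennreal (sqrt (det (chart_metric c z))) \<partial>lebesgue)"
proof -
  let ?\<mu> = "restrict_space (area_measure M) (chart_dom c)"
  let ?\<nu> = "restrict_space (chart_area c) (chart_image c)"
  have inv: "chart_inv c (chart_map c x) = x" if "x \<in> chart_dom c" for x
    using inv_map[OF c] that by blast
  have im: "chart_image c \<in> sets lebesgue" using chart_image_borel[OF chart[OF c]] by simp
  have sets\<mu>: "B \<in> sets ?\<mu> \<longleftrightarrow> B \<in> surface_sets \<and> B \<subseteq> chart_dom c" for B
    using chart_dom_surface_sets[OF c] Int_absorb2[OF chart_dom_subset[OF c]]
    by (subst sets_restrict_space_iff) (auto simp: sets_area space_area)
  have sp: "space ?\<mu> = chart_dom c" "space ?\<nu> = chart_image c"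
    using chart_dom_subset[OF c] by (auto simp: space_restrict_space space_area chart_area_def)
  have pre: "chart_inv c -` B \<inter> chart_image c = chart_map c ` B" if "B \<subseteq> chart_dom c" for B
    using that inv by (force simp: image_iff)
  have minv: "chart_inv c \<in> ?\<nu> \<rightarrow>\<^sub>M ?\<mu>"
  proof (rule measurableI)
    fix B assume "B \<in> sets ?\<mu>"
    then have B: "B \<in> surface_sets" "B \<subseteq> chart_dom c" by (auto simp: sets\<mu>)
    show "chart_inv c -` B \<inter> space ?\<nu> \<in> sets ?\<nu>"
      unfolding sp pre[OF B(2)] using surface_sets_image[OF B c] im B(2)
      by (subst sets_restrict_space_iff) (auto simp: chart_area_def)
  qed (auto simp: sp)
  have eq: "?\<mu> = distr ?\<nu> ?\<mu> (chart_inv c)"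
  proof (rule measure_eqI)
    fix B assume "B \<in> sets ?\<mu>"
    then have B: "B \<in> surface_sets" "B \<subseteq> chart_dom c" by (auto simp: sets\<mu>)
    have "emeasure ?\<mu> B = emeasure (area_measure M) B"
      using B(2) chart_dom_surface_sets[OF c] chart_dom_subset[OF c]
      by (intro emeasure_restrict_space) (auto simp: sets_area space_area Int_absorb2)
    also have "\<dots> = emeasure (chart_area c) (chart_map c ` B)" by (rule emeasure_area[OF c B])
    also have "\<dots> = emeasure ?\<nu> (chart_map c ` B)"
      using B(2) im by (intro emeasure_restrict_space[symmetric]) (auto simp: chart_area_def)
    also have "\<dots> = emeasure (distr ?\<nu> ?\<mu> (chart_inv c)) B"
      using minv B by (subst emeasure_distr) (auto simp: sets\<mu> sp pre)
    finally show "emeasure ?\<mu> B = emeasure (distr ?\<nu> ?\<mu> (chart_inv c)) B" .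
  qed simp
  have DM: "D \<in> sets (area_measure M)" using D by (simp add: sets_area)
  have fD: "(\<lambda>x. f x * indicator D x) \<in> borel_measurable (area_measure M)"
    using f DM by measurable
  have dom: "chart_dom c \<inter> space (area_measure M) \<in> sets (area_measure M)"
    using chart_dom_surface_sets[OF c] chart_dom_subset[OF c] by (simp add: sets_area space_area Int_absorb2)
  have "(\<integral>\<^sup>+x\<in>D. f x \<partial>area_measure M) = (\<integral>\<^sup>+x. f x * indicator D x \<partial>?\<mu>)"
    using D(2) by (subst nn_integral_restrict_space[OF dom]) (auto intro!: nn_integral_cong simp: indicator_def)
  also have "\<dots> = (\<integral>\<^sup>+z. f (chart_inv c z) * indicator D (chart_inv c z) \<partial>?\<nu>)"
    using measurable_restrict_space1[OF fD] minv by (subst eq) (simp add: nn_integral_distr)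
  also have "\<dots> = (\<integral>\<^sup>+z. f (chart_inv c z) * indicator D (chart_inv c z) * indicator (chart_image c) z \<partial>chart_area c)"
    using im by (subst nn_integral_restrict_space) (auto simp: chart_area_def)
  also have "\<dots> = (\<integral>\<^sup>+z. ennreal (if z \<in> chart_image c then sqrt (det (chart_metric c z)) else 0) *
      (f (chart_inv c z) * indicator D (chart_inv c z) * indicator (chart_image c) z) \<partial>lebesgue)"
    unfolding chart_area_def
  proof (rule nn_integral_density)
    show "(\<lambda>z. ennreal (if z \<in> chart_image c then sqrt (det (chart_metric c z)) else 0)) \<in> borel_measurable lebesgue"
      using chart_area_density_measurable[OF c] by simp
    have "(\<lambda>z. f (chart_inv c z) * indicator D (chart_inv c z)) \<in> borel_measurable ?\<nu>"
      using measurable_compose[OF minv measurable_restrict_space1[OF fD]] .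
    then have "(\<lambda>z. f (chart_inv c z) * indicator D (chart_inv c z) * indicator (chart_image c) z) \<in> borel_measurable (chart_area c)"
      using im by (subst (asm) borel_measurable_restrict_space_iff_ennreal) (auto simp: chart_area_def)
    then show "(\<lambda>z. f (chart_inv c z) * indicator D (chart_inv c z) * indicator (chart_image c) z) \<in> borel_measurable lebesgue"
      by (simp add: chart_area_def)
  qed
  also have "\<dots> = (\<integral>\<^sup>+z\<in>chart_map c ` D. f (chart_inv c z) * ennreal (sqrt (det (chart_metric c z))) \<partial>lebesgue)"
    using D(2) pre[OF D(2)] inv by (intro nn_integral_cong) (auto simp: indicator_def mult.commute)
  finally show ?thesis .
qed

end

section \<open>Change of charts and speeds of paths\<close>

text \<open>Eigenvalue bounds without eigenvalues. The lower one rests on Cayley-Hamilton, by which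
  \<open>trace G * (v \<bullet> (G *v v)) - det G * (norm v)^2\<close> is the squared norm of
  \<open>G *v v\<close>. In the upper one the difference is the form itself at \<open>v\<close>
  turned by a right angle.\<close>

lemma spd_form_bounds:
  assumes "spd G"
  shows "det G / trace G * (norm v)\<^sup>2 \<le> v \<bullet> (G *v v)" "v \<bullet> (G *v v) \<le> trace G * (norm v)\<^sup>2"
    "0 < trace G"
proof -
  note c = spd_components[OF assms]
  have "0 < G$2$2" using c(1,3) by (smt (verit) mult_nonneg_nonpos zero_le_square)
  then show tr: "0 < trace G" using c(1) by (simp add: trace_def sum_2)
  have n: "(norm v)\<^sup>2 = v$1 * v$1 + v$2 * v$2"
    by (simp add: norm_vec_def L2_set_def sum_2 power2_eq_square)
  have q: "v \<bullet> (G *v v) = G$1$1 * v$1 * v$1 + 2 * G$1$2 * v$1 * v$2 + G$2$2 * v$2 * v$2"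
    by (simp add: mat2_simps c(2) algebra_simps)
  have "trace G * (v \<bullet> (G *v v)) - det G * (norm v)\<^sup>2 =
      (G$1$1 * v$1 + G$1$2 * v$2)\<^sup>2 + (G$1$2 * v$1 + G$2$2 * v$2)\<^sup>2"
    unfolding n q by (simp add: trace_def sum_2 det_2 c(2) power2_eq_square algebra_simps)
  then have "det G * (norm v)\<^sup>2 \<le> trace G * (v \<bullet> (G *v v))" by (smt (verit) zero_le_power2)
  then show "det G / trace G * (norm v)\<^sup>2 \<le> v \<bullet> (G *v v)" using tr by (simp add: field_simps)
  define w :: "real^2" where "w = vector [- v$2, v$1]"
  have "trace G * (norm v)\<^sup>2 - v \<bullet> (G *v v) = w \<bullet> (G *v w)"
    unfolding n q by (simp add: w_def trace_def mat2_simps c(2) algebra_simps)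
  moreover have "0 \<le> w \<bullet> (G *v w)"
    using assms by (cases "w = 0") (auto simp: spd_def less_imp_le)
  ultimately show "v \<bullet> (G *v v) \<le> trace G * (norm v)\<^sup>2" by simp
qed

lemma congruence_form:
  fixes A H :: "real^2^2"
  shows "v \<bullet> ((transpose A ** H ** A) *v v) = (A *v v) \<bullet> (H *v (A *v v))"
  by (metis dot_lmul_matrix matrix_vector_mul_assoc transpose_matrix_vector transpose_transpose vector_transpose_matrix)

text \<open>Smoothness on a set with boundary only provides local extensions \<open>F\<close>. The
  parameter interval is shrunk until the curve stays in the domain of one extension, and the chain
  rule is applied to that.\<close>

lemma piecewise_C1_smooth_compose:
  fixes \<eta> :: "real \<Rightarrow> 'b::euclidean_space" and f :: "'b \<Rightarrow> 'c::real_normed_vector"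
  assumes f: "smooth_on S f" and t: "t \<in> {0..1}" "\<eta> t \<in> S"
    and \<eta>: "e0 > 0" "\<eta> piecewise_C1_differentiable_on ({t - e0..t + e0} \<inter> {0..1})"
    and g: "d > 0" "\<And>s. s \<in> {0..1} \<Longrightarrow> \<bar>s - t\<bar> < d \<Longrightarrow> \<eta> s \<in> S \<and> g s = f (\<eta> s)"
  shows "\<exists>e>0. g piecewise_C1_differentiable_on ({t - e..t + e} \<inter> {0..1})"
proof -
  obtain W F where W: "open W" "\<eta> t \<in> W" "\<And>w. w \<in> S \<inter> W \<Longrightarrow> F w = f w"
    "F differentiable_on W" "\<And>v. continuous_on W (\<lambda>z. frechet_derivative F (at z) v)"
    using smooth_on_differentiable[OF f t(2)] by metis
  obtain K D where K: "finite K" and c\<eta>: "continuous_on ({t - e0..t + e0} \<inter> {0..1}) \<eta>"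
    and D: "\<And>s. s \<in> {t - e0..t + e0} \<inter> {0..1} - K \<Longrightarrow> (\<eta> has_vector_derivative D s) (at s)"
      "continuous_on ({t - e0..t + e0} \<inter> {0..1} - K) D"
    using \<eta>(2) unfolding piecewise_C1_differentiable_on_def C1_differentiable_on_def by blast
  have "t \<in> {t - e0..t + e0} \<inter> {0..1}" using t \<eta>(1) by simp
  then have "continuous (at t within {t - e0..t + e0} \<inter> {0..1}) \<eta>"
    using c\<eta> continuous_on_eq_continuous_within by blast
  then have "eventually (\<lambda>s. \<eta> s \<in> W) (at t within {t - e0..t + e0} \<inter> {0..1})"
    unfolding continuous_within by (rule topological_tendstoD[OF _ W(1,2)])
  then obtain d' where d': "d' > 0"
    "\<And>s. s \<in> {t - e0..t + e0} \<inter> {0..1} \<Longrightarrow> s \<noteq> t \<Longrightarrow> \<bar>s - t\<bar> < d' \<Longrightarrow> \<eta> s \<in> W"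
    unfolding eventually_at dist_real_def by blast
  define e where "e = min e0 (min d d' / 2)"
  have e: "e > 0" "e \<le> e0" "e < d" "e < d'" using \<eta>(1) g(1) d'(1) by (auto simp: e_def min_def)
  define I where "I = {t - e..t + e} \<inter> {0..1::real}"
  have I: "I \<subseteq> {t - e0..t + e0} \<inter> {0..1}" using e by (auto simp: I_def)
  have IW: "\<eta> s \<in> W" if "s \<in> I" for s
  proof (cases "s = t")
    case False
    then show ?thesis using d'(2)[of s] that e by (auto simp: I_def)
  qed (use W in simp)
  have gF: "g s = F (\<eta> s)" if "s \<in> I" for s
    using g(2)[of s] IW[OF that] W(3) that e by (auto simp: I_def)
  have Fd: "(F has_derivative frechet_derivative F (at z)) (at z)" if "z \<in> W" for z
    using W(1,4) that by (metis at_within_open differentiable_on_def frechet_derivative_works)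
  have "continuous_on W F" using W(4) by (rule differentiable_imp_continuous_on)
  then have "continuous_on I (\<lambda>s. F (\<eta> s))"
    using IW by (intro continuous_on_compose2[OF _ continuous_on_subset[OF c\<eta> I]]) auto
  then have gc: "continuous_on I g" using gF by (simp cong: continuous_on_cong)
  \<comment> \<open>The endpoints of \<open>I\<close> join the exceptional set: the derivative is
    two-sided, whereas \<open>g\<close> agrees with \<open>F \<circ> \<eta>\<close> only on
    \<open>I\<close>.\<close>
  define K' where "K' = K \<union> {max 0 (t - e), min 1 (t + e)}"
  have "g C1_differentiable_on (I - K')"
    unfolding C1_differentiable_on_def
  proof (intro exI conjI ballI)
    fix s assume s: "s \<in> I - K'"
    let ?J = "{max 0 (t - e)<..<min 1 (t + e)}"
    have sJ: "s \<in> ?J" using s by (auto simp: I_def K'_def)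
    have JI: "?J \<subseteq> I" by (auto simp: I_def)
    have "(\<eta> has_derivative (\<lambda>x. x *\<^sub>R D s)) (at s)"
      using D(1)[of s] s I by (auto simp: K'_def has_vector_derivative_def)
    from diff_chain_at[OF this Fd[OF IW]] s
    have "(F \<circ> \<eta> has_derivative (\<lambda>x. frechet_derivative F (at (\<eta> s)) (x *\<^sub>R D s))) (at s)"
      by (simp add: o_def)
    then have "(F \<circ> \<eta> has_vector_derivative frechet_derivative F (at (\<eta> s)) (D s)) (at s)"
      using linear_scale[OF has_derivative_linear[OF Fd[OF IW]]] s by (simp add: has_vector_derivative_def)
    then show "(g has_vector_derivative frechet_derivative F (at (\<eta> s)) (D s)) (at s)"
      by (rule has_vector_derivative_transform_within_open[OF _ open_greaterThanLessThan sJ]) (use gF JI in auto)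
  next
    have "frechet_derivative F (at (\<eta> s)) (D s) =
        (\<Sum>b\<in>Basis. (D s \<bullet> b) *\<^sub>R frechet_derivative F (at (\<eta> s)) b)" if "s \<in> I" for s
    proof -
      have lin: "linear (frechet_derivative F (at (\<eta> s)))" using Fd[OF IW[OF that]] by (rule has_derivative_linear)
      show ?thesis
        by (subst euclidean_representation[of "D s", symmetric]) (simp add: linear_sum[OF lin] linear_scale[OF lin])
    qed
    moreover have "continuous_on (I - K') (\<lambda>s. \<Sum>b\<in>Basis. (D s \<bullet> b) *\<^sub>R frechet_derivative F (at (\<eta> s)) b)"
      using I IW
      by (intro continuous_intros continuous_on_compose2[OF W(5)] continuous_on_subset[OF c\<eta>] continuous_on_subset[OF D(2)])
        (auto simp: K'_def)
    ultimately show "continuous_on (I - K') (\<lambda>s. frechet_derivative F (at (\<eta> s)) (D s))"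
      by (subst continuous_on_cong[OF refl]) auto
  qed
  moreover have "finite K'" using K by (simp add: K'_def)
  ultimately have "g piecewise_C1_differentiable_on I"
    unfolding piecewise_C1_differentiable_on_def using gc by blast
  then show ?thesis using e(1) unfolding I_def by blast
qed

text \<open>The representative of the map is differentiable only within the chart image. That is
  enough for a two-sided derivative along the curve, because the curve stays in the chart domain on
  an open set of parameters.\<close>

lemma curve_chart_derivative:
  assumes c: "riemannian_chart X c" and T: "open T" "t \<in> T" "\<And>s. s \<in> T \<Longrightarrow> \<gamma> s \<in> chart_dom c"
    and v: "((chart_map c \<circ> \<gamma>) has_vector_derivative v) (at t)"
    and A: "(chart_rep c d \<phi> has_derivative (\<lambda>v. A *v v)) (at (chart_map c (\<gamma> t)) within chart_image c)"
  shows "(chart_map d \<circ> (\<phi> \<circ> \<gamma>) has_vector_derivative A *v v) (at t)"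
proof -
  have "(chart_map c \<circ> \<gamma> has_derivative (\<lambda>s. s *\<^sub>R v)) (at t within T)"
    using v by (simp add: has_vector_derivative_def has_derivative_at_withinI)
  moreover have "(chart_rep c d \<phi> has_derivative (\<lambda>v. A *v v))
      (at ((chart_map c \<circ> \<gamma>) t) within (chart_map c \<circ> \<gamma>) ` T)"
    unfolding o_def by (rule has_derivative_subset[OF A]) (use T(3) in auto)
  ultimately have "(chart_rep c d \<phi> \<circ> (chart_map c \<circ> \<gamma>) has_derivative (\<lambda>v. A *v v) \<circ> (\<lambda>s. s *\<^sub>R v)) (at t within T)"
    by (rule diff_chain_within)
  moreover have "(\<lambda>v. A *v v) \<circ> (\<lambda>s. s *\<^sub>R v) = (\<lambda>s. s *\<^sub>R (A *v v))"
    by (simp add: fun_eq_iff matrix_vector_mult_scaleR)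
  ultimately have "(chart_rep c d \<phi> \<circ> (chart_map c \<circ> \<gamma>) has_vector_derivative A *v v) (at t)"
    using at_within_open[OF T(2,1)] by (simp add: has_vector_derivative_def)
  then show ?thesis
    by (rule has_vector_derivative_transform_within_open[OF _ T(1,2)])
      (simp add: chart_rep_def chart_inv_map[OF c] T(3))
qed

context riemannian_surface begin

text \<open>Local comparability with the Euclidean metric, from continuity of the two bounds
  \<open>trace\<close> and \<open>det / trace\<close>. The upper constant serves to estimate
  distances from above, the lower one from below.\<close>

lemma metric_bounds:
  assumes c: "c \<in> atlas M" and z0: "z0 \<in> chart_image c"
  obtains e a b where "0 < e" "0 < a" "0 < b"
    "\<And>z v. z \<in> chart_image c \<Longrightarrow> dist z z0 < e \<Longrightarrow>
      a\<^sup>2 * (norm v)\<^sup>2 \<le> v \<bullet> (chart_metric c z *v v) \<and> v \<bullet> (chart_metric c z *v v) \<le> b\<^sup>2 * (norm v)\<^sup>2"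
proof -
  have cont: "continuous_on (chart_image c) (chart_metric c)"
    by (rule chart_metric_continuous[OF c])
  have spd: "spd (chart_metric c z)" if "z \<in> chart_image c" for z
    using chart_spd[OF c that] .
  have tr: "trace (chart_metric c z) \<noteq> 0" if "z \<in> chart_image c" for z
    using spd_form_bounds(3)[OF spd[OF that]] by simp
  have c1: "continuous_on (chart_image c) (\<lambda>z. trace (chart_metric c z))"
    unfolding trace_def sum_2 by (intro continuous_intros cont)
  have c2: "continuous_on (chart_image c) (\<lambda>z. det (chart_metric c z) / trace (chart_metric c z))"
    unfolding det_2 by (intro continuous_intros cont c1) (use tr in auto)
  define q where "q = det (chart_metric c z0) / trace (chart_metric c z0)"
  define \<tau> where "\<tau> = trace (chart_metric c z0)"
  have pos: "0 < \<tau>" "0 < q"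
    using spd_form_bounds(3)[OF spd[OF z0]] spd_components(4)[OF spd[OF z0]] by (auto simp: q_def \<tau>_def)
  have "eventually (\<lambda>z. q / 2 < det (chart_metric c z) / trace (chart_metric c z)) (at z0 within chart_image c)"
    using pos by (intro order_tendstoD(1)[OF bspec[OF continuous_on_def[THEN iffD1, OF c2] z0]]) (simp add: q_def)
  moreover have "eventually (\<lambda>z. trace (chart_metric c z) < 2 * \<tau>) (at z0 within chart_image c)"
    using pos by (intro order_tendstoD(2)[OF bspec[OF continuous_on_def[THEN iffD1, OF c1] z0]]) (simp add: \<tau>_def)
  ultimately have "eventually (\<lambda>z. q / 2 < det (chart_metric c z) / trace (chart_metric c z)
      \<and> trace (chart_metric c z) < 2 * \<tau>) (at z0 within chart_image c)"
    by (rule eventually_conj)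
  then obtain e where e: "e > 0" and "\<And>z. z \<in> chart_image c \<Longrightarrow> z \<noteq> z0 \<Longrightarrow> dist z z0 < e \<Longrightarrow>
      q / 2 < det (chart_metric c z) / trace (chart_metric c z) \<and> trace (chart_metric c z) < 2 * \<tau>"
    unfolding eventually_at by auto
  then have E: "q / 2 \<le> det (chart_metric c z) / trace (chart_metric c z)" "trace (chart_metric c z) \<le> 2 * \<tau>"
    if "z \<in> chart_image c" "dist z z0 < e" for z
    using that pos by (cases "z = z0"; force simp: q_def \<tau>_def)+
  show thesis
  proof (rule that[of e "sqrt (q / 2)" "sqrt (2 * \<tau>)"])
    fix z v assume z: "z \<in> chart_image c" "dist z z0 < e"
    note B = spd_form_bounds(1,2)[OF spd[OF z(1)], of v]
    have "q / 2 * (norm v)\<^sup>2 \<le> v \<bullet> (chart_metric c z *v v)"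
      by (rule order_trans[OF mult_right_mono[OF E(1)[OF z]] B(1)]) simp
    moreover have "v \<bullet> (chart_metric c z *v v) \<le> 2 * \<tau> * (norm v)\<^sup>2"
      by (rule order_trans[OF B(2) mult_right_mono[OF E(2)[OF z]]]) simp
    ultimately show "(sqrt (q / 2))\<^sup>2 * (norm v)\<^sup>2 \<le> v \<bullet> (chart_metric c z *v v) \<and>
        v \<bullet> (chart_metric c z *v v) \<le> (sqrt (2 * \<tau>))\<^sup>2 * (norm v)\<^sup>2"
      using pos by simp
  qed (use e pos in auto)
qed

text \<open>\<open>path_speed\<close> uses a chart chosen at each point of the path; congruence of
  the metric fields lets any chart compute it.\<close>

lemma path_speed_eq:
  assumes c: "c \<in> atlas M" and T: "open T" "t \<in> T" "\<And>s. s \<in> T \<Longrightarrow> \<gamma> s \<in> chart_dom c"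
    and v: "((chart_map c \<circ> \<gamma>) has_vector_derivative v) (at t)"
  shows "path_speed M \<gamma> t = sqrt (v \<bullet> (metric_at c (\<gamma> t) *v v))"
proof -
  define d where "d = chart_at M (\<gamma> t)"
  have x: "\<gamma> t \<in> chart_dom c" using T by blast
  have d: "d \<in> atlas M" "\<gamma> t \<in> chart_dom d"
    using chart_at chart_dom_subset[OF c] x by (auto simp: d_def)
  define A where "A = chart_diff c d (\<lambda>x. x) (\<gamma> t)"
  have "(chart_map d \<circ> ((\<lambda>x. x) \<circ> \<gamma>) has_vector_derivative A *v v) (at t)"
    unfolding A_def by (rule curve_chart_derivative[OF chart[OF c] T v transition_derivative[OF c d(1) x d(2)]])
  then have "(chart_map d \<circ> \<gamma> has_vector_derivative A *v v) (at t)" by (simp add: o_def)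
  then have "vector_derivative (chart_map d \<circ> \<gamma>) (at t) = A *v v" by (rule vector_derivative_at)
  then show ?thesis
    unfolding path_speed_def Let_def d_def[symmetric]
    using chart_diff_metric[OF c d(1) x d(2)] congruence_form[of v A "metric_at d (\<gamma> t)"]
    by (simp add: A_def)
qed

end

locale surface_pair = M: riemannian_surface M + N: riemannian_surface N
  for M :: "'a::t2_space surface" and N :: "'b::t2_space surface"
begin

text \<open>The chain rule for target transition, map and source transition. Continuity of
  \<open>\<phi>\<close> provides a relatively open set \<open>V\<close> around the point on which
  the three factors compose to the new representative.\<close>

lemma chart_rep_change:
  assumes c: "c \<in> atlas M" "c' \<in> atlas M" and d: "d \<in> atlas N" "d' \<in> atlas N"
    and x: "x \<in> chart_dom c" "x \<in> chart_dom c'" "\<phi> x \<in> chart_dom d" "\<phi> x \<in> chart_dom d'"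
    and \<phi>: "continuous_on (pts M) \<phi>" "\<phi> \<in> pts M \<rightarrow> pts N"
    and D: "(chart_rep c d \<phi> has_derivative D) (at (chart_map c x) within chart_image c)"
  shows "(chart_rep c' d' \<phi> has_derivative
      (\<lambda>v. chart_diff d d' (\<lambda>y. y) (\<phi> x) *v D (chart_diff c' c (\<lambda>y. y) x *v v)))
      (at (chart_map c' x) within chart_image c')"
proof -
  define U where "U = {y \<in> pts M. \<phi> y \<in> chart_dom d \<inter> chart_dom d'} \<inter> chart_dom c"
  define V where "V = chart_map c' ` (U \<inter> chart_dom c')"
  have "openin (top_of_set (pts N)) (chart_dom d \<inter> chart_dom d')"
    using N.chart_openin d by blast
  then have "openin (top_of_set (pts M)) (pts M \<inter> \<phi> -` (chart_dom d \<inter> chart_dom d'))"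
    using \<phi> by (intro continuous_openin_preimage)
  moreover have "pts M \<inter> \<phi> -` (chart_dom d \<inter> chart_dom d') \<inter> chart_dom c = U" by (auto simp: U_def)
  ultimately have "openin (top_of_set (pts M)) U"
    using M.chart_openin[OF c(1)] by (metis openin_Int)
  then have V: "openin (top_of_set (chart_image c')) V"
    unfolding V_def by (rule chart_image_openin[OF M.chart[OF c(2)]])
  have xV: "chart_map c' x \<in> V"
    using x M.chart_dom_subset[OF c(1)] by (auto simp: V_def U_def)
  have Vc: "V \<subseteq> chart_image c'" using V openin_imp_subset by blast
  let ?f = "chart_rep c' c (\<lambda>y. y)" and ?g = "chart_rep c d \<phi>" and ?h = "chart_rep d d' (\<lambda>y. y)"
  have rep: "?f (chart_map c' y) = chart_map c y" "?g (chart_map c y) = chart_map d (\<phi> y)"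
    "?h (chart_map d (\<phi> y)) = chart_map d' (\<phi> y)" "chart_rep c' d' \<phi> (chart_map c' y) = chart_map d' (\<phi> y)"
    if "y \<in> U \<inter> chart_dom c'" for y
    using that by (auto simp: chart_rep_def U_def M.inv_map[OF c(1)]
        M.inv_map[OF c(2)] N.inv_map[OF d(1)])
  have xU: "x \<in> U \<inter> chart_dom c'" using x M.chart_dom_subset[OF c(1)] by (auto simp: U_def)
  have 1: "(?f has_derivative (\<lambda>v. chart_diff c' c (\<lambda>y. y) x *v v)) (at (chart_map c' x) within V)"
    using M.transition_derivative[OF c(2,1) x(2,1)] Vc by (rule has_derivative_subset)
  have "?f ` V \<subseteq> chart_image c" using rep(1) by (auto simp: V_def) (auto simp: U_def)
  then have 2: "(?g has_derivative D) (at (?f (chart_map c' x)) within ?f ` V)"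
    unfolding rep(1)[OF xU] by (rule has_derivative_subset[OF D])
  have 3: "(?h has_derivative (\<lambda>v. chart_diff d d' (\<lambda>y. y) (\<phi> x) *v v)) (at ((?g \<circ> ?f) (chart_map c' x)) within (?g \<circ> ?f) ` V)"
  proof -
    have "(?g \<circ> ?f) ` V \<subseteq> chart_image d" using rep(1,2) by (auto simp: V_def) (auto simp: U_def)
    then show ?thesis
      using N.transition_derivative[OF d x(3,4)] rep[OF xU] by (auto intro: has_derivative_subset)
  qed
  have "(?h \<circ> (?g \<circ> ?f) has_derivative (\<lambda>v. chart_diff d d' (\<lambda>y. y) (\<phi> x) *v v) \<circ> (D \<circ> (\<lambda>v. chart_diff c' c (\<lambda>y. y) x *v v)))
      (at (chart_map c' x) within V)"
    by (rule diff_chain_within[OF diff_chain_within[OF 1 2] 3])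
  then show ?thesis
    using rep by (intro has_derivative_openin_cong[OF V xV]) (auto simp: o_def V_def)
qed

lemma densities_chart_change:
  assumes c: "c \<in> atlas M" "c' \<in> atlas M" and d: "d \<in> atlas N" "d' \<in> atlas N"
    and x: "x \<in> chart_dom c" "x \<in> chart_dom c'" "\<phi> x \<in> chart_dom d" "\<phi> x \<in> chart_dom d'"
    and \<phi>: "continuous_on (pts M) \<phi>" "\<phi> \<in> pts M \<rightarrow> pts N"
    and D: "chart_rep c d \<phi> differentiable (at (chart_map c x) within chart_image c)"
  shows "chart_rep c' d' \<phi> differentiable (at (chart_map c' x) within chart_image c')" (is ?d)
    and "energy_density (metric_at c' x) (metric_at d' (\<phi> x)) (chart_diff c' d' \<phi> x) =
      energy_density (metric_at c x) (metric_at d (\<phi> x)) (chart_diff c d \<phi> x)" (is ?e)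
    and "area_density (metric_at c' x) (metric_at d' (\<phi> x)) (chart_diff c' d' \<phi> x) =
      area_density (metric_at c x) (metric_at d (\<phi> x)) (chart_diff c d \<phi> x)" (is ?a)
proof -
  define E F where "E = chart_diff d d' (\<lambda>y. y) (\<phi> x)" and "F = chart_diff c' c (\<lambda>y. y) x"
  have D': "(chart_rep c' d' \<phi> has_derivative (\<lambda>v. (E ** chart_diff c d \<phi> x ** F) *v v)) (at (chart_map c' x) within chart_image c')"
    using chart_rep_change[OF c d x \<phi> chart_diff_has_derivative[OF D]]
    by (simp add: E_def F_def matrix_vector_mul_assoc matrix_mul_assoc)
  then show ?d by (auto simp: differentiable_def)
  have A: "chart_diff c' d' \<phi> x = E ** chart_diff c d \<phi> x ** F"
    using chart_diff_eqI[OF M.chart_epigraph[OF c(2)] x(2) D'] by simp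
  have "0 < det E" "0 < det F"
    using M.chart_diff_det N.chart_diff_det c d x by (auto simp: E_def F_def)
  note ch = densities_change[OF M.metric_spd[OF c(1) x(1)] N.metric_spd[OF d(2) x(4)] this, of "chart_diff c d \<phi> x"]
  have "transpose F ** metric_at c x ** F = metric_at c' x"
    "transpose E ** metric_at d' (\<phi> x) ** E = metric_at d (\<phi> x)"
    using M.chart_diff_metric[OF c(2,1) x(2,1)] N.chart_diff_metric[OF d x(3,4)] by (auto simp: E_def F_def)
  then show ?e ?a using ch A by simp_all
qed

end

section \<open>Riemannian distance in charts\<close>

text \<open>The integral in the hypothesis may converge only conditionally, as for the unbounded
  derivatives that piecewise C1 paths admit. An infinite right-hand side is trivial, and a finite
  one makes \<open>f\<close> absolutely integrable.\<close>

lemma norm_integral_le_nn_integral: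
  fixes f :: "real \<Rightarrow> 'a::euclidean_space"
  assumes f: "(f has_integral I) S"
  shows "ennreal (norm I) \<le> (\<integral>\<^sup>+x\<in>S. ennreal (norm (f x)) \<partial>lborel)"
proof (cases "(\<integral>\<^sup>+x\<in>S. ennreal (norm (f x)) \<partial>lborel) = \<infinity>")
  case False
  let ?f = "\<lambda>x. indicator S x *\<^sub>R f x"
  have m: "?f \<in> borel_measurable lebesgue"
    using f by (rule has_integral_implies_lebesgue_measurable)
  have eq: "(\<integral>\<^sup>+x\<in>S. ennreal (norm (f x)) \<partial>lborel) = (\<integral>\<^sup>+x. ennreal (norm (?f x)) \<partial>lebesgue)"
    by (subst nn_integral_completion) (auto intro!: nn_integral_cong simp: indicator_def)
  have int: "integrable lebesgue ?f"
    using m False unfolding eq by (intro integrableI_bounded) (auto simp: top.not_eq_extremum)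
  then have "set_integrable lebesgue S f" by (simp add: set_integrable_def)
  then have "(f has_integral (LINT x:S|lebesgue. f x)) S" by (rule has_integral_set_lebesgue)
  then have "I = integral\<^sup>L lebesgue ?f"
    using f has_integral_unique unfolding set_lebesgue_integral_def by blast
  then show ?thesis using integral_norm_bound_ennreal[OF int] eq by simp
qed simp

context riemannian_surface begin

lemma path_preimage_open:
  assumes \<gamma>: "path \<gamma>" "path_image \<gamma> \<subseteq> pts M" and U: "openin (top_of_set (pts M)) U"
  shows "open {s\<in>{0<..<1}. \<gamma> s \<in> U}"
proof -
  have "openin (top_of_set {0<..<1}) ({0<..<1} \<inter> \<gamma> -` U)"
    using \<gamma> U by (intro continuous_openin_preimage[of _ _ "pts M"])
      (auto simp: path_def path_image_def intro: continuous_on_subset)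
  moreover have "{0<..<1} \<inter> \<gamma> -` U = {s\<in>{0<..<1}. \<gamma> s \<in> U}" by auto
  ultimately show ?thesis by (simp add: openin_open_eq)
qed

lemma path_near:
  assumes \<gamma>: "path \<gamma>" "path_image \<gamma> \<subseteq> pts M" and U: "openin (top_of_set (pts M)) U"
    and t: "t \<in> {0..1}" "\<gamma> t \<in> U"
  obtains d where "d > 0" "\<And>s. s \<in> {0..1} \<Longrightarrow> \<bar>s - t\<bar> < d \<Longrightarrow> \<gamma> s \<in> U"
proof -
  have "openin (top_of_set {0..1}) ({0..1} \<inter> \<gamma> -` U)"
    using \<gamma> U by (intro continuous_openin_preimage[of _ _ "pts M"])
      (auto simp: path_def path_image_def)
  then obtain W where W: "open W" "{0..1} \<inter> \<gamma> -` U = {0..1} \<inter> W" by (auto simp: openin_open)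
  then have "t \<in> W" using t by blast
  then obtain d where "d > 0" "ball t d \<subseteq> W" using W(1) open_contains_ball by blast
  moreover have "\<gamma> s \<in> U" if "s \<in> {0..1}" "s \<in> W" for s using that W(2) by blast
  moreover have "s \<in> ball t d" if "\<bar>s - t\<bar> < d" for s
    using that by (simp add: dist_real_def abs_minus_commute)
  ultimately show thesis by (intro that[of d]) blast+
qed

text \<open>The straight segment between two points of an epigraph need not stay in the epigraph,
  but it does so after adding a parabola of height proportional to the slope bound.\<close>

lemma riemannian_dist_le:
  assumes c: "c \<in> atlas M" and z0: "z0 \<in> chart_image c"
  obtains e C where "e > 0" "C \<ge> 0"
    "\<And>z w. \<lbrakk>z \<in> chart_image c; w \<in> chart_image c; dist z z0 < e; dist w z0 < e\<rbrakk> \<Longrightarrow>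
      riemannian_dist M (chart_inv c z) (chart_inv c w) \<le> ennreal (C * dist z w)"
proof -
  obtain W R L f where W: "open W" "z0 \<in> W" and R: "orthogonal_transformation R" and L: "0 \<le> L"
    and f: "\<And>x y. \<bar>f x - f y\<bar> \<le> L * \<bar>x - y\<bar>"
    and eq: "\<And>w. w \<in> W \<Longrightarrow> w \<in> chart_image c \<longleftrightarrow> f (R w $ 1) \<le> (R w :: real^2) $ 2"
    using lipschitz_epigraph_frame[OF chart_epigraph[OF c] z0] by metis
  have linR: "linear R" "surj R"
    using R by (auto simp: orthogonal_transformation_linear orthogonal_transformation_surj)
  obtain u where u: "R u = vector [0, 1]" using linR(2) by (metis surjD)
  have "norm u = norm (vector [0, 1] :: real^2)" using R u by (metis orthogonal_transformation_norm)
  then have nu: "norm u = 1" by (simp add: norm_vec_def L2_set_def sum_2)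
  obtain r0 where r0: "r0 > 0" "ball z0 r0 \<subseteq> W" using W open_contains_ball by blast
  obtain r1 a b where r1: "0 < r1" "0 < a" "0 < b"
    "\<And>z v. z \<in> chart_image c \<Longrightarrow> dist z z0 < r1 \<Longrightarrow>
      a\<^sup>2 * (norm v)\<^sup>2 \<le> v \<bullet> (chart_metric c z *v v) \<and> v \<bullet> (chart_metric c z *v v) \<le> b\<^sup>2 * (norm v)\<^sup>2"
    using metric_bounds[OF c z0] by metis
  define r where "r = min r0 r1"
  have r: "r > 0" "r \<le> r0" "r \<le> r1" using r0 r1 by (auto simp: r_def)
  \<comment> \<open>The curve built below leaves the convex hull of its endpoints by at most
    \<open>h / 4\<close>, hence stays within \<open>1 + L\<close> times the larger of their
    distances to \<open>z0\<close>.\<close>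
  define e where "e = r / (1 + L)"
  have e: "e > 0" using r L by (simp add: e_def)
  show thesis
  proof (rule that[of e "b * (1 + 2 * L)"])
    fix z w assume z: "z \<in> chart_image c" "dist z z0 < e" and w: "w \<in> chart_image c" "dist w z0 < e"
    \<comment> \<open>Weighting the Lipschitz estimates from the two endpoints by
      \<open>1 - t\<close> and \<open>t\<close> shows that the chord can dip below the graph by at
      most \<open>2 * L * D * t * (1 - t)\<close>, with \<open>D\<close> the horizontal distance of
      the endpoints; the parabola \<open>h * t * (1 - t)\<close> makes up for it.\<close>
    define h where "h = 2 * L * dist z w"
    have h: "0 \<le> h" using L by (simp add: h_def)
    define \<eta> where "\<eta> t = (1 - t) *\<^sub>R z + t *\<^sub>R w + (h * t * (1 - t)) *\<^sub>R u" for t :: real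
    define \<eta>' where "\<eta>' t = w - z + (h * (1 - 2 * t)) *\<^sub>R u" for t :: real
    have D: "(\<eta> has_vector_derivative \<eta>' t) (at t)" for t
      unfolding \<eta>_def \<eta>'_def
      by (auto intro!: derivative_eq_intros simp: algebra_simps)
    have Dn: "norm (\<eta>' t) \<le> (1 + 2 * L) * dist z w" if "t \<in> {0..1}" for t
    proof -
      have "norm (\<eta>' t) \<le> norm (w - z) + norm ((h * (1 - 2 * t)) *\<^sub>R u)"
        unfolding \<eta>'_def by (rule norm_triangle_ineq)
      also have "norm ((h * (1 - 2 * t)) *\<^sub>R u) = h * \<bar>1 - 2 * t\<bar>" using h nu by (simp add: abs_mult)
      also have "h * \<bar>1 - 2 * t\<bar> \<le> h * 1" using h that by (intro mult_left_mono) auto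
      finally show ?thesis by (simp add: h_def dist_norm norm_minus_commute algebra_simps)
    qed
    have near: "dist (\<eta> t) z0 < r" if t: "t \<in> {0..1}" for t
    proof -
      have "\<eta> t - z0 = (1 - t) *\<^sub>R (z - z0) + t *\<^sub>R (w - z0) + (h * t * (1 - t)) *\<^sub>R u"
        by (simp add: \<eta>_def algebra_simps)
      then have "norm (\<eta> t - z0) \<le> norm ((1 - t) *\<^sub>R (z - z0)) + norm (t *\<^sub>R (w - z0)) + norm ((h * t * (1 - t)) *\<^sub>R u)"
        by (metis norm_triangle_le norm_triangle_ineq add_mono order_refl)
      also have "\<dots> = (1 - t) * norm (z - z0) + t * norm (w - z0) + h * (t * (1 - t))"
        using t h nu by (simp add: abs_mult)
      also have "\<dots> \<le> (1 - t) * norm (z - z0) + t * norm (w - z0) + h / 4"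
      proof -
        have "t * (1 - t) \<le> 1/4" using zero_le_power2[of "t - 1/2"] by (simp add: power2_eq_square algebra_simps)
        then have "h * (t * (1 - t)) \<le> h * (1/4)" using h by (intro mult_left_mono)
        then show ?thesis by simp
      qed
      also have "\<dots> \<le> max (norm (z - z0)) (norm (w - z0)) + h / 4"
        using t convex_bound_le[of "norm (z - z0)" "max (norm (z - z0)) (norm (w - z0))" "norm (w - z0)" "1 - t" t]
        by simp
      also have "h / 4 \<le> L * max (norm (z - z0)) (norm (w - z0))"
      proof -
        have "dist z w \<le> 2 * max (norm (z - z0)) (norm (w - z0))"
          using dist_triangle2[of z w z0] by (simp add: dist_norm max_def)
        then have "L * dist z w \<le> L * (2 * max (norm (z - z0)) (norm (w - z0)))"
          using L by (intro mult_left_mono)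
        then show ?thesis by (simp add: h_def)
      qed
      finally have "norm (\<eta> t - z0) \<le> (1 + L) * max (norm (z - z0)) (norm (w - z0))"
        by (simp add: algebra_simps)
      also have "\<dots> < (1 + L) * e" using z w L by (intro mult_strict_left_mono) (auto simp: dist_norm)
      also have "\<dots> = r" using L by (simp add: e_def)
      finally show ?thesis by (simp add: dist_norm)
    qed
    have zW: "z \<in> W" "w \<in> W"
      using near[of 0] near[of 1] r r0 by (auto simp: \<eta>_def dist_commute subset_eq)
    have im: "\<eta> t \<in> chart_image c" if t: "t \<in> {0..1}" for t
    proof -
      have "\<eta> t \<in> W" using near[OF t] r r0 by (auto simp: dist_commute subset_eq)
      moreover have "f (R (\<eta> t) $ 1) \<le> R (\<eta> t) $ 2"
      proof -
        define x where "x = R (\<eta> t) $ 1"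
        define D where "D = \<bar>R z $ 1 - R w $ 1\<bar>"
        have lin: "R (\<eta> t) = (1 - t) *\<^sub>R R z + t *\<^sub>R R w + (h * t * (1 - t)) *\<^sub>R vector [0, 1]"
          using linR(1) by (simp add: \<eta>_def linear_add linear_scale u)
        have x: "x = (1 - t) * R z $ 1 + t * R w $ 1" by (simp add: x_def lin)
        have "x - R z $ 1 = t * (R w $ 1 - R z $ 1)" "x - R w $ 1 = (1 - t) * (R z $ 1 - R w $ 1)"
          by (simp_all add: x algebra_simps)
        then have "\<bar>x - R z $ 1\<bar> = t * D" "\<bar>x - R w $ 1\<bar> = (1 - t) * D"
          using t by (simp_all add: abs_mult D_def abs_minus_commute)
        then have "f x \<le> f (R z $ 1) + L * (t * D)" "f x \<le> f (R w $ 1) + L * ((1 - t) * D)"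
          using f[of x "R z $ 1"] f[of x "R w $ 1"] by auto
        moreover have "f (R z $ 1) \<le> R z $ 2" "f (R w $ 1) \<le> R w $ 2"
          using eq zW z w by auto
        ultimately have "(1 - t) * f x \<le> (1 - t) * (R z $ 2 + L * (t * D))"
          "t * f x \<le> t * (R w $ 2 + L * ((1 - t) * D))"
          using t by (auto intro!: mult_left_mono)
        then have "f x \<le> (1 - t) * R z $ 2 + t * R w $ 2 + 2 * L * D * t * (1 - t)"
          by (simp add: algebra_simps)
        also have "2 * L * D * t * (1 - t) \<le> h * t * (1 - t)"
        proof -
          have "D \<le> norm (R z - R w)" using component_le_norm_cart[of "R z - R w" 1] by (simp add: D_def)
          also have "\<dots> = dist z w"
            using R linR(1) by (metis dist_norm linear_diff orthogonal_transformation_norm)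
          finally have "2 * L * D \<le> h" using L by (simp add: h_def mult_left_mono)
          then show ?thesis using t by (intro mult_right_mono) auto
        qed
        finally show ?thesis by (simp add: x_def[symmetric]) (simp add: lin)
      qed
      ultimately show ?thesis using eq by blast
    qed
    define \<gamma> where "\<gamma> = chart_inv c \<circ> \<eta>"
    have \<gamma>c: "\<gamma> t \<in> chart_dom c" "chart_map c (\<gamma> t) = \<eta> t" if "t \<in> {0..1}" for t
      using im[OF that] by (auto simp: \<gamma>_def)
    have \<eta>c: "continuous_on X \<eta>" for X unfolding \<eta>_def by (intro continuous_intros)
    have p: "path \<gamma>" unfolding path_def \<gamma>_def
      using im by (intro continuous_on_compose \<eta>c continuous_on_subset[OF chart_inv_continuous[OF c]]) auto
    have pi: "path_image \<gamma> \<subseteq> pts M" using \<gamma>c chart_dom_subset[OF c] by (auto simp: path_image_def)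
    have C1: "\<eta> piecewise_C1_differentiable_on X" for X
    proof (rule C1_differentiable_imp_piecewise)
      have "continuous_on X \<eta>'" unfolding \<eta>'_def by (intro continuous_intros)
      then show "\<eta> C1_differentiable_on X" unfolding C1_differentiable_on_def using D by blast
    qed
    have "piecewise_C1_path M \<gamma>"
      unfolding piecewise_C1_path_def
    proof (intro conjI p pi ballI impI)
      fix t d assume t: "t \<in> {0..1}" and d: "d \<in> atlas M" "\<gamma> t \<in> chart_dom d"
      obtain \<delta> where \<delta>: "\<delta> > 0" "\<And>s. s \<in> {0..1} \<Longrightarrow> \<bar>s - t\<bar> < \<delta> \<Longrightarrow> \<gamma> s \<in> chart_dom d"
        using path_near[OF p pi chart_openin[OF d(1)] t d(2)] by metis
      have sm: "smooth_on (chart_map c ` (chart_dom c \<inter> chart_dom d)) (chart_rep c d (\<lambda>x. x))"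
        using compatible[OF c d(1)] by (simp add: compatible_charts_def)
      have in_im: "\<eta> s \<in> chart_map c ` (chart_dom c \<inter> chart_dom d)" if "s \<in> {0..1}" "\<gamma> s \<in> chart_dom d" for s
        using \<gamma>c[OF that(1)] that(2) by (metis IntI imageI)
      have "\<eta> s \<in> chart_map c ` (chart_dom c \<inter> chart_dom d) \<and> (chart_map d \<circ> \<gamma>) s = chart_rep c d (\<lambda>x. x) (\<eta> s)"
        if "s \<in> {0..1}" "\<bar>s - t\<bar> < \<delta>" for s
        using in_im[OF that(1) \<delta>(2)[OF that]] by (simp add: chart_rep_def \<gamma>_def)
      from piecewise_C1_smooth_compose[OF sm t in_im[OF t d(2)] zero_less_one C1 \<delta>(1) this]
      show "\<exists>e>0. (chart_map d \<circ> \<gamma>) piecewise_C1_differentiable_on {t - e..t + e} \<inter> {0..1}" .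
    qed
    moreover have "pathstart \<gamma> = chart_inv c z" "pathfinish \<gamma> = chart_inv c w"
      by (simp_all add: pathstart_def pathfinish_def \<gamma>_def \<eta>_def)
    ultimately have "riemannian_dist M (chart_inv c z) (chart_inv c w) \<le> path_length M \<gamma>"
      unfolding riemannian_dist_def by (intro Inf_lower) auto
    also have "path_length M \<gamma> \<le> (\<integral>\<^sup>+t\<in>{0..1::real}. ennreal (b * (1 + 2 * L) * dist z w) \<partial>lborel)"
      unfolding path_length_def
    proof (rule nn_integral_mono_AE)
      have "AE t in lborel. t \<noteq> (0::real)" "AE t in lborel. t \<noteq> (1::real)" by (rule AE_lborel_singleton)+
      then show "AE t in lborel. ennreal (path_speed M \<gamma> t) * indicator {0..1} t \<le> ennreal (b * (1 + 2 * L) * dist z w) * indicator {0..1} t"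
      proof eventually_elim
        case (elim t)
        show ?case
        proof (cases "t \<in> {0..1}")
          case True
          then have t: "t \<in> {0<..<1}" using elim by auto
          have "(chart_map c \<circ> \<gamma> has_vector_derivative \<eta>' t) (at t)"
            by (rule has_vector_derivative_transform_within_open[OF D open_greaterThanLessThan t]) (simp add: \<gamma>c)
          then have "path_speed M \<gamma> t = sqrt (\<eta>' t \<bullet> (metric_at c (\<gamma> t) *v \<eta>' t))"
            by (intro path_speed_eq[OF c open_greaterThanLessThan t]) (auto simp: \<gamma>c)
          also have "\<dots> \<le> sqrt (b\<^sup>2 * (norm (\<eta>' t))\<^sup>2)"
            using r1(4)[of "\<eta> t" "\<eta>' t"] im[OF True] near[OF True] r by (simp add: \<gamma>c[OF True])
          also have "\<dots> = b * norm (\<eta>' t)" using r1 by (simp add: real_sqrt_mult)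
          also have "\<dots> \<le> b * ((1 + 2 * L) * dist z w)" using r1 Dn[OF True] by (intro mult_left_mono) auto
          finally show ?thesis using True by (simp add: ennreal_leI mult.assoc)
        qed simp
      qed
    qed
    also have "\<dots> = ennreal (b * (1 + 2 * L) * dist z w)"
      by (simp add: nn_integral_cmult_indicator)
    finally show "riemannian_dist M (chart_inv c z) (chart_inv c w) \<le> ennreal (b * (1 + 2 * L) * dist z w)" .
  qed (use e L r1 in auto)
qed

text \<open>The definition of the paths gives an exceptional set for every chart and parameter.
  Compactness of the parameter interval leaves finitely many of these, and smooth transitions make
  their union valid for all charts at once.\<close>

lemma path_differentiable:
  assumes \<gamma>: "piecewise_C1_path M \<gamma>"
  obtains K where "finite K"
    "\<And>s c. \<lbrakk>s \<in> {0<..<1} - K; c \<in> atlas M; \<gamma> s \<in> chart_dom c\<rbrakk> \<Longrightarrow> (chart_map c \<circ> \<gamma>) differentiable (at s)"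
proof -
  have p: "path \<gamma>" "path_image \<gamma> \<subseteq> pts M" using \<gamma> by (auto simp: piecewise_C1_path_def)
  define c where "c t = chart_at M (\<gamma> t)" for t
  have c: "c t \<in> atlas M" "\<gamma> t \<in> chart_dom (c t)" if "t \<in> {0..1}" for t
    using chart_at[of "\<gamma> t"] p(2) that by (auto simp: c_def path_image_def image_subset_iff)
  have "\<exists>e K. e > 0 \<and> finite K \<and> (\<forall>s\<in>{0<..<1} \<inter> {t - e<..<t + e} - K.
      \<gamma> s \<in> chart_dom (c t) \<and> (chart_map (c t) \<circ> \<gamma>) differentiable (at s))"
    if t: "t \<in> {0..1}" for t
  proof -
    obtain e K where e: "e > 0" "finite K"
      "\<forall>s\<in>{t - e..t + e} \<inter> {0..1} - K. (chart_map (c t) \<circ> \<gamma>) differentiable (at s)"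
      using \<gamma> c[OF t] t unfolding piecewise_C1_path_def piecewise_C1_differentiable_on_def C1_differentiable_on_eq
      by blast
    obtain d where d: "d > 0" "\<And>s. s \<in> {0..1} \<Longrightarrow> \<bar>s - t\<bar> < d \<Longrightarrow> \<gamma> s \<in> chart_dom (c t)"
      using path_near[OF p chart_openin[OF c(1)[OF t]] t c(2)[OF t]] by metis
    show ?thesis
    proof (intro exI conjI ballI)
      fix s assume s: "s \<in> {0<..<1} \<inter> {t - min e d<..<t + min e d} - K"
      then have "s \<in> {0..1}" "\<bar>s - t\<bar> < d" "s \<in> {t - e..t + e} \<inter> {0..1} - K" by auto
      then show "\<gamma> s \<in> chart_dom (c t)" "(chart_map (c t) \<circ> \<gamma>) differentiable (at s)"
        using e(3) d(2) by blast+
    qed (use e d in auto)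
  qed
  then obtain e K where eK: "\<And>t. t \<in> {0..1} \<Longrightarrow> e t > 0 \<and> finite (K t) \<and>
      (\<forall>s\<in>{0<..<1} \<inter> {t - e t<..<t + e t} - K t.
        \<gamma> s \<in> chart_dom (c t) \<and> (chart_map (c t) \<circ> \<gamma>) differentiable (at s))" by metis
  obtain F where F: "F \<subseteq> {0..1}" "finite F" "{0..1} \<subseteq> (\<Union>t\<in>F. {t - e t<..<t + e t})"
  proof (rule compactE_image[of "{0..1}" "{0..1}" "\<lambda>t. {t - e t<..<t + e t}"])
    show "{0..1} \<subseteq> (\<Union>t\<in>{0..1}. {t - e t<..<t + e t})" using eK by fastforce
  qed auto
  show thesis
  proof (rule that[of "\<Union>t\<in>F. K t"])
    show "finite (\<Union>t\<in>F. K t)" using F eK by auto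
    fix s d assume s: "s \<in> {0<..<1} - (\<Union>t\<in>F. K t)" and d: "d \<in> atlas M" "\<gamma> s \<in> chart_dom d"
    have "s \<in> {0..1}" using s by auto
    then obtain t where t: "t \<in> F" "s \<in> {t - e t<..<t + e t}" using F(3) by blast
    then have t01: "t \<in> {0..1}" using F(1) by blast
    have "s \<in> {0<..<1} \<inter> {t - e t<..<t + e t} - K t" using s t by blast
    then have x: "\<gamma> s \<in> chart_dom (c t)" and diff: "(chart_map (c t) \<circ> \<gamma>) differentiable (at s)"
      using eK[OF t01] by blast+
    obtain v where v: "(chart_map (c t) \<circ> \<gamma> has_vector_derivative v) (at s)"
      using diff vector_derivative_works by blast
    have T: "open {u\<in>{0<..<1}. \<gamma> u \<in> chart_dom (c t)}"
      by (rule path_preimage_open[OF p chart_openin[OF c(1)[OF t01]]])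
    have "(chart_map d \<circ> ((\<lambda>x. x) \<circ> \<gamma>) has_vector_derivative
        chart_diff (c t) d (\<lambda>x. x) (\<gamma> s) *v v) (at s)"
    proof (rule curve_chart_derivative[OF chart[OF c(1)[OF t01]] T])
      show "(chart_rep (c t) d (\<lambda>x. x) has_derivative (\<lambda>v. chart_diff (c t) d (\<lambda>x. x) (\<gamma> s) *v v))
          (at (chart_map (c t) (\<gamma> s)) within chart_image (c t))"
        by (rule transition_derivative[OF c(1)[OF t01] d(1) x d(2)])
    qed (use s x v in auto)
    then have "(chart_map d \<circ> \<gamma> has_vector_derivative chart_diff (c t) d (\<lambda>x. x) (\<gamma> s) *v v) (at s)"
      by (simp add: o_def)
    then show "(chart_map d \<circ> \<gamma>) differentiable (at s)" by (rule differentiableI_vector)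
  qed
qed

text \<open>The speed dominates \<open>a\<close> times the Euclidean speed, and the latter
  integrates to at least the Euclidean distance of the endpoints. The parameter \<open>T\<close>
  allows for stopping a path when it leaves a region.\<close>

lemma path_length_ge:
  assumes \<gamma>: "piecewise_C1_path M \<gamma>" and c: "c \<in> atlas M" and T: "0 \<le> T" "T \<le> 1"
    and dom: "\<And>t. t \<in> {0..T} \<Longrightarrow> \<gamma> t \<in> chart_dom c"
    and a: "0 < a" "\<And>t v. t \<in> {0..T} \<Longrightarrow> a\<^sup>2 * (norm v)\<^sup>2 \<le> v \<bullet> (metric_at c (\<gamma> t) *v v)"
  shows "ennreal (a * dist (chart_map c (\<gamma> 0)) (chart_map c (\<gamma> T))) \<le> path_length M \<gamma>"
proof -
  have p: "path \<gamma>" "path_image \<gamma> \<subseteq> pts M" using \<gamma> by (auto simp: piecewise_C1_path_def)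
  let ?\<eta> = "chart_map c \<circ> \<gamma>"
  let ?d = "\<lambda>t. vector_derivative ?\<eta> (at t)"
  obtain K where K: "finite K"
    "\<And>s c. \<lbrakk>s \<in> {0<..<1} - K; c \<in> atlas M; \<gamma> s \<in> chart_dom c\<rbrakk> \<Longrightarrow> (chart_map c \<circ> \<gamma>) differentiable (at s)"
    using path_differentiable[OF \<gamma>] by metis
  have vd: "(?\<eta> has_vector_derivative ?d s) (at s)" if "s \<in> {0<..<T} - K" for s
  proof -
    have s: "s \<in> {0<..<1} - K" "s \<in> {0..T}" using that T by auto
    show ?thesis by (rule vector_derivative_works[THEN iffD1, OF K(2)[OF s(1) c dom[OF s(2)]]])
  qed
  have cont: "continuous_on {0..T} ?\<eta>"
  proof (rule continuous_on_compose)
    show "continuous_on {0..T} \<gamma>"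
      by (rule continuous_on_subset[OF p(1)[unfolded path_def]]) (use T in auto)
    show "continuous_on (\<gamma> ` {0..T}) (chart_map c)"
      by (rule continuous_on_subset[OF chart_continuous[OF c]]) (use dom in blast)
  qed
  have "(?d has_integral ?\<eta> T - ?\<eta> 0) {0..T}"
    by (rule fundamental_theorem_of_calculus_interior_strong[OF K(1) T(1) _ cont]) (use vd in auto)
  then have "((\<lambda>t. a *\<^sub>R ?d t) has_integral a *\<^sub>R (?\<eta> T - ?\<eta> 0)) {0..T}"
    by (rule has_integral_cmul)
  then have "ennreal (norm (a *\<^sub>R (?\<eta> T - ?\<eta> 0))) \<le> (\<integral>\<^sup>+t\<in>{0..T}. ennreal (norm (a *\<^sub>R ?d t)) \<partial>lborel)"
    by (rule norm_integral_le_nn_integral)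
  also have "\<dots> \<le> path_length M \<gamma>"
    unfolding path_length_def
  proof (rule nn_integral_mono_AE)
    have "AE t in lborel. t \<notin> insert 0 (insert T K)"
      using K(1) by (intro AE_not_in finite_imp_null_set_lborel) auto
    then show "AE t in lborel. ennreal (norm (a *\<^sub>R ?d t)) * indicator {0..T} t \<le> ennreal (path_speed M \<gamma> t) * indicator {0..1} t"
    proof eventually_elim
      case (elim t)
      show ?case
      proof (cases "t \<in> {0..T}")
        case True
        then have t: "t \<in> {0<..<T} - K" "t \<in> {0<..<1}" using elim T by auto
        have "path_speed M \<gamma> t = sqrt (?d t \<bullet> (metric_at c (\<gamma> t) *v ?d t))"
          by (rule path_speed_eq[OF c path_preimage_open[OF p chart_openin[OF c]] _ _ vd[OF t(1)]])
            (use t(2) dom[OF True] in auto)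
        moreover have "norm (a *\<^sub>R ?d t) \<le> sqrt (?d t \<bullet> (metric_at c (\<gamma> t) *v ?d t))"
          using a(2)[OF True] a(1) by (intro real_le_rsqrt) (simp add: power_mult_distrib)
        ultimately show ?thesis using True t by (simp add: ennreal_leI)
      qed simp
    qed
  qed
  finally show ?thesis using a(1) by (simp add: dist_norm norm_minus_commute)
qed

text \<open>A path from the coordinate ball of radius \<open>\<delta>\<close> that leaves the ball
  of radius \<open>2 * \<delta>\<close> has to cross the annulus between them, at a cost of at least
  \<open>a * \<delta>\<close>. Paths shorter than this stay inside the chart, where their length
  controls the Euclidean distance; in particular their endpoint cannot lie elsewhere on the
  surface.\<close>

lemma riemannian_dist_ge:
  assumes c: "c \<in> atlas M" and x0: "x0 \<in> chart_dom c"
  obtains \<delta> \<epsilon> a where "\<delta> > 0" "\<epsilon> > 0" "a > 0"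
    "\<And>x y. \<lbrakk>x \<in> chart_dom c; dist (chart_map c x) (chart_map c x0) < \<delta>; riemannian_dist M x y < ennreal \<epsilon>\<rbrakk> \<Longrightarrow>
      y \<in> chart_dom c \<and> ennreal (a * dist (chart_map c x) (chart_map c y)) \<le> riemannian_dist M x y"
proof -
  define z0 where "z0 = chart_map c x0"
  have z0: "z0 \<in> chart_image c" using x0 by (simp add: z0_def)
  obtain U where U: "open U" "open (U - chart_image c)" "chart_image c \<subseteq> U"
    using lipschitz_epigraph_locally_closed[OF chart_epigraph[OF c]] by metis
  obtain r0 where r0: "r0 > 0" "cball z0 r0 \<subseteq> U" using U z0 open_contains_cball by blast
  obtain r1 a b where r1: "0 < r1" "0 < a" "0 < b"
    "\<And>z v. z \<in> chart_image c \<Longrightarrow> dist z z0 < r1 \<Longrightarrow>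
      a\<^sup>2 * (norm v)\<^sup>2 \<le> v \<bullet> (chart_metric c z *v v) \<and> v \<bullet> (chart_metric c z *v v) \<le> b\<^sup>2 * (norm v)\<^sup>2"
    using metric_bounds[OF c z0] by metis
  define \<delta> where "\<delta> = min r0 r1 / 3"
  have \<delta>: "\<delta> > 0" "2 * \<delta> \<le> r0" "2 * \<delta> < r1" using r0 r1 by (auto simp: \<delta>_def min_def)
  define V where "V = {x \<in> chart_dom c. dist (chart_map c x) z0 < 2 * \<delta>}"
  have "openin (top_of_set (chart_dom c)) (chart_dom c \<inter> chart_map c -` ball z0 (2 * \<delta>))"
    using chart_continuous[OF c] by (rule continuous_openin_preimage_gen) simp
  moreover have "chart_dom c \<inter> chart_map c -` ball z0 (2 * \<delta>) = V" by (auto simp: V_def dist_commute)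
  ultimately have V: "openin (top_of_set (pts M)) V"
    using chart_openin[OF c] openin_trans by metis
  \<comment> \<open>Local closedness makes this piece of the chart compact, hence closed in the
    ambient Hausdorff space. A path that runs in \<open>V\<close> up to some time therefore still
    has its limit point in the chart domain.\<close>
  define Q where "Q = chart_inv c ` (chart_image c \<inter> cball z0 (2 * \<delta>))"
  have "compact (cball z0 (2 * \<delta>) - (U - chart_image c))"
    using U(2) by (intro compact_diff) auto
  moreover have "cball z0 (2 * \<delta>) - (U - chart_image c) = chart_image c \<inter> cball z0 (2 * \<delta>)"
    using order_trans[OF subset_cball[OF \<delta>(2)] r0(2)] by blast
  ultimately have "compact Q"
    unfolding Q_def by (intro compact_continuous_image continuous_on_subset[OF chart_inv_continuous[OF c]]) auto
  then have Q: "closed Q" by (rule compact_imp_closed)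
  have VQ: "V \<subseteq> Q"
  proof
    fix x assume "x \<in> V"
    then have "x \<in> chart_dom c" "chart_map c x \<in> chart_image c \<inter> cball z0 (2 * \<delta>)" by (auto simp: V_def dist_commute)
    then show "x \<in> Q" unfolding Q_def using inv_map[OF c] by (metis imageI)
  qed
  have Qc: "x \<in> chart_dom c \<and> dist (chart_map c x) z0 \<le> 2 * \<delta>" if "x \<in> Q" for x
    using that by (auto simp: Q_def dist_commute)
  define \<epsilon> where "\<epsilon> = a * \<delta>"
  have len: "y \<in> chart_dom c \<and> ennreal (a * dist (chart_map c x) (chart_map c y)) \<le> path_length M \<gamma>"
    if x: "x \<in> chart_dom c" "dist (chart_map c x) z0 < \<delta>" and \<gamma>: "piecewise_C1_path M \<gamma>"
      "pathstart \<gamma> = x" "pathfinish \<gamma> = y" "path_length M \<gamma> < ennreal \<epsilon>" for x y \<gamma>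
  proof -
    have p: "path \<gamma>" "path_image \<gamma> \<subseteq> pts M" using \<gamma> by (auto simp: piecewise_C1_path_def)
    have \<gamma>0: "\<gamma> 0 = x" "\<gamma> 1 = y" using \<gamma> by (auto simp: pathstart_def pathfinish_def)
    have bound: "ennreal (a * dist (chart_map c x) (chart_map c (\<gamma> T))) \<le> path_length M \<gamma>"
      if "0 \<le> T" "T \<le> 1" "\<And>t. t \<in> {0..T} \<Longrightarrow> \<gamma> t \<in> Q" for T
      unfolding \<gamma>0(1)[symmetric]
    proof (rule path_length_ge[OF \<gamma>(1) c that(1,2)])
      fix t v assume "t \<in> {0..T}"
      then have "\<gamma> t \<in> chart_dom c" "dist (chart_map c (\<gamma> t)) z0 < r1" using Qc[OF that(3)] \<delta> by fastforce+
      then show "a\<^sup>2 * (norm v)\<^sup>2 \<le> v \<bullet> (metric_at c (\<gamma> t) *v v)" using r1(4) by blast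
    qed (use Qc that(3) r1 in auto)
    have all: "\<gamma> t \<in> V" if t: "t \<in> {0..1}" for t
    proof (rule ccontr)
      assume nt: "\<gamma> t \<notin> V"
      \<comment> \<open>The infimum of \<open>E\<close> is the first exit time. There the path lies
        in \<open>Q\<close> but not in \<open>V\<close>, so its coordinate distance to
        \<open>z0\<close> is exactly \<open>2 * \<delta>\<close>.\<close>
      define E where "E = {s \<in> {0..1}. \<gamma> s \<notin> V}"
      have "openin (top_of_set {0..1}) ({0..1} \<inter> \<gamma> -` V)"
        using p V by (intro continuous_openin_preimage[of _ _ "pts M"]) (auto simp: path_def path_image_def)
      moreover have "E = {0..1} - ({0..1} \<inter> \<gamma> -` V)" by (auto simp: E_def)
      ultimately have "closedin (top_of_set {0..1}) E" by (simp add: closedin_diff)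
      then have "closed E" by (rule closedin_closed_trans) simp
      moreover have ne: "E \<noteq> {}" "bdd_below E" using t nt by (auto simp: E_def intro: bdd_belowI[of _ 0])
      ultimately have TE: "Inf E \<in> E" using closed_contains_Inf by blast
      define T where "T = Inf E"
      have T: "T \<in> {0..1}" "\<gamma> T \<notin> V" using TE by (auto simp: T_def E_def)
      have "\<gamma> 0 \<in> V" using x \<delta> by (simp add: \<gamma>0 V_def)
      then have T0: "0 < T" using T by (cases "T = 0") auto
      have lt: "\<gamma> s \<in> V" if "0 \<le> s" "s < T" for s
        using that T cInf_lower[OF _ ne(2), of s] by (auto simp: E_def T_def)
      have "closedin (top_of_set {0..T}) ({0..T} \<inter> \<gamma> -` Q)"
        using p(1) T Q by (intro continuous_closedin_preimage) (auto simp: path_def intro: continuous_on_subset)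
      then have cl: "closed ({0..T} \<inter> \<gamma> -` Q)" by (rule closedin_closed_trans) simp
      have "{0..<T} \<subseteq> {0..T} \<inter> \<gamma> -` Q" using lt VQ by fastforce
      then have "closure {0..<T} \<subseteq> {0..T} \<inter> \<gamma> -` Q" using cl by (rule closure_minimal)
      then have QT: "\<gamma> s \<in> Q" if "s \<in> {0..T}" for s using T0 that by auto
      have "\<gamma> T \<in> Q" using QT T0 by simp
      then have "dist (chart_map c (\<gamma> T)) z0 = 2 * \<delta>" using Qc[of "\<gamma> T"] T(2) by (auto simp: V_def)
      then have "\<delta> \<le> dist (chart_map c x) (chart_map c (\<gamma> T))"
        using x(2) dist_triangle[of "chart_map c (\<gamma> T)" z0 "chart_map c x"] by (simp add: dist_commute)
      then have "ennreal \<epsilon> \<le> ennreal (a * dist (chart_map c x) (chart_map c (\<gamma> T)))"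
        using r1 by (auto simp: \<epsilon>_def intro!: ennreal_leI mult_left_mono)
      also have "\<dots> \<le> path_length M \<gamma>" using T QT by (intro bound) auto
      finally show False using \<gamma>(4) by simp
    qed
    then have "y \<in> chart_dom c" using all[of 1] by (simp add: \<gamma>0 V_def)
    moreover have "ennreal (a * dist (chart_map c x) (chart_map c (\<gamma> 1))) \<le> path_length M \<gamma>"
      using all VQ by (intro bound) auto
    ultimately show ?thesis by (simp add: \<gamma>0)
  qed
  show thesis
  proof (rule that[of \<delta> \<epsilon> a])
    fix x y assume x: "x \<in> chart_dom c" "dist (chart_map c x) (chart_map c x0) < \<delta>"
      and lt: "riemannian_dist M x y < ennreal \<epsilon>"
    let ?P = "{path_length M \<gamma> |\<gamma>. piecewise_C1_path M \<gamma> \<and> pathstart \<gamma> = x \<and> pathfinish \<gamma> = y}"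
    note len' = len[OF x(1) x(2)[folded z0_def]]
    have "y \<in> chart_dom c" using lt len' unfolding riemannian_dist_def Inf_less_iff by blast
    moreover have "ennreal (a * dist (chart_map c x) (chart_map c y)) \<le> riemannian_dist M x y"
    proof (rule ccontr)
      assume "\<not> ?thesis"
      then have "Inf ?P < min (ennreal \<epsilon>) (ennreal (a * dist (chart_map c x) (chart_map c y)))"
        using lt by (simp add: riemannian_dist_def not_le)
      then obtain \<gamma> where "piecewise_C1_path M \<gamma>" "pathstart \<gamma> = x" "pathfinish \<gamma> = y"
        "path_length M \<gamma> < min (ennreal \<epsilon>) (ennreal (a * dist (chart_map c x) (chart_map c y)))"
        unfolding Inf_less_iff by blast
      then show False using len'[of \<gamma> y] by auto
    qed
    ultimately show "y \<in> chart_dom c \<and> ennreal (a * dist (chart_map c x) (chart_map c y)) \<le> riemannian_dist M x y"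
      by blast
  qed (use \<delta> r1 in \<open>auto simp: \<epsilon>_def\<close>)
qed

end

section \<open>Lipschitz maps in charts\<close>

lemma matrix_inv_2:
  fixes G :: "real^2^2"
  assumes "det G \<noteq> 0"
  shows "matrix_inv G = vector [vector [G$2$2 / det G, - G$1$2 / det G], vector [- G$2$1 / det G, G$1$1 / det G]]"
proof (rule matrix_inv_eqI)
  have "det G = G$1$1 * G$2$2 - G$1$2 * G$2$1" by (rule det_2)
  then show "G ** vector [vector [G$2$2 / det G, - G$1$2 / det G], vector [- G$2$1 / det G, G$1$1 / det G]] = mat 1"
    using assms by (simp add: mat2_simps mat_def field_simps)
qed

text \<open>\<open>matrix_inv\<close> is defined by choice; Cramer's formula \<open>K\<close> makes
  its entries visibly measurable.\<close>

lemma energy_density_measurable: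
  fixes G H A :: "'x \<Rightarrow> real^2^2"
  assumes G: "\<And>i j. (\<lambda>z. G z $ i $ j) \<in> borel_measurable X" "\<And>z. z \<in> space X \<Longrightarrow> det (G z) \<noteq> 0"
    and H: "\<And>i j. (\<lambda>z. H z $ i $ j) \<in> borel_measurable X"
    and A: "\<And>i j. (\<lambda>z. A z $ i $ j) \<in> borel_measurable X"
  shows "(\<lambda>z. energy_density (G z) (H z) (A z)) \<in> borel_measurable X"
proof -
  note [measurable] = G(1) H A
  have d [measurable]: "(\<lambda>z. det (G z)) \<in> borel_measurable X" unfolding det_2 by measurable
  define K where "K z = (vector [vector [G z$2$2 / det (G z), - G z$1$2 / det (G z)],
      vector [- G z$2$1 / det (G z), G z$1$1 / det (G z)]] :: real^2^2)" for z
  have K: "(\<lambda>z. K z $ i $ j) \<in> borel_measurable X" for i j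
  proof -
    have "\<forall>i j. (\<lambda>z. K z $ i $ j) \<in> borel_measurable X"
      unfolding forall_2 K_def by simp
    then show ?thesis by blast
  qed
  note [measurable] = K
  have "(\<lambda>z. trace (K z ** transpose (A z) ** H z ** A z)) \<in> borel_measurable X"
    by (simp add: trace_def sum_2 matrix_matrix_mult_def transpose_def)
  moreover have "energy_density (G z) (H z) (A z) = trace (K z ** transpose (A z) ** H z ** A z)"
    if "z \<in> space X" for z
    using matrix_inv_2[OF G(2)[OF that]] by (simp add: energy_density_def K_def)
  ultimately show ?thesis by (subst measurable_cong) auto
qed

lemma area_density_measurable:
  fixes G H A :: "'x \<Rightarrow> real^2^2"
  assumes [measurable]: "\<And>i j. (\<lambda>z. G z $ i $ j) \<in> borel_measurable X"
    "\<And>i j. (\<lambda>z. H z $ i $ j) \<in> borel_measurable X"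
    "\<And>i j. (\<lambda>z. A z $ i $ j) \<in> borel_measurable X"
  shows "(\<lambda>z. area_density (G z) (H z) (A z)) \<in> borel_measurable X"
  unfolding area_density_def det_2 by measurable

lemma (in riemannian_surface) null_setsI_chart:
  assumes c: "c \<in> atlas M" and B: "B \<subseteq> chart_dom c" "negligible (chart_map c ` B)"
  shows "B \<in> null_sets (area_measure M)"
proof -
  have "B \<in> surface_sets" using negligible_imp_sets[OF B(2)] by (rule surface_setsI[OF c B(1)])
  then show ?thesis using chart_null[OF c _ B(1)] B(2) by (auto simp: null_sets_def sets_area)
qed

lemma (in riemannian_surface) chart_metric_entry_measurable:
  assumes c: "c \<in> atlas M" and X: "X \<subseteq> chart_image c" "X \<in> sets lebesgue"
  shows "(\<lambda>z. chart_metric c z $ i $ j) \<in> borel_measurable (lebesgue_on X)"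
proof -
  have "continuous_on (chart_image c) (chart_metric c)"
    by (rule chart_metric_continuous[OF c])
  then have "continuous_on X (\<lambda>z. chart_metric c z $ i $ j)"
    using X(1) by (intro continuous_intros) (rule continuous_on_subset)
  then show ?thesis using X(2) by (rule continuous_imp_measurable_on_sets_lebesgue)
qed

context surface_pair begin

text \<open>Three comparisons are chained: Riemannian distance by Euclidean distance in the source,
  the Lipschitz bound of the map, and Euclidean distance by Riemannian distance in the target. The
  last is valid only for small distances, so the neighbourhood has to be chosen first.\<close>

lemma lipschitz_map_local:
  assumes \<phi>: "lipschitz_map M N \<phi>" and c: "c \<in> atlas M" "x0 \<in> chart_dom c"
    and d: "d \<in> atlas N" "\<phi> x0 \<in> chart_dom d"
  obtains e B where "e > 0"
    "\<And>x. x \<in> chart_dom c \<Longrightarrow> dist (chart_map c x) (chart_map c x0) < e \<Longrightarrow> \<phi> x \<in> chart_dom d"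
    "B-lipschitz_on (chart_image c \<inter> ball (chart_map c x0) e) (chart_rep c d \<phi>)"
proof -
  obtain L where L: "L \<ge> 0" "\<And>x y. x \<in> pts M \<Longrightarrow> y \<in> pts M \<Longrightarrow>
      riemannian_dist N (\<phi> x) (\<phi> y) \<le> ennreal L * riemannian_dist M x y"
    using \<phi> by (auto simp: lipschitz_map_def)
  have z0: "chart_map c x0 \<in> chart_image c" using c by blast
  obtain e1 C where C: "e1 > 0" "C \<ge> 0"
    "\<And>z w. \<lbrakk>z \<in> chart_image c; w \<in> chart_image c; dist z (chart_map c x0) < e1; dist w (chart_map c x0) < e1\<rbrakk> \<Longrightarrow>
      riemannian_dist M (chart_inv c z) (chart_inv c w) \<le> ennreal (C * dist z w)"
    using M.riemannian_dist_le[OF c(1) z0] by metis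
  obtain \<delta> \<epsilon> a where a: "\<delta> > 0" "\<epsilon> > 0" "a > 0"
    "\<And>p q. \<lbrakk>p \<in> chart_dom d; dist (chart_map d p) (chart_map d (\<phi> x0)) < \<delta>; riemannian_dist N p q < ennreal \<epsilon>\<rbrakk> \<Longrightarrow>
      q \<in> chart_dom d \<and> ennreal (a * dist (chart_map d p) (chart_map d q)) \<le> riemannian_dist N p q"
    using N.riemannian_dist_ge[OF d] by metis
  \<comment> \<open>The summand 1 keeps the constant positive even if \<open>L\<close> or
    \<open>C\<close> is zero.\<close>
  define K where "K = L * C + 1"
  have K: "K > 0" using L C by (simp add: K_def add_nonneg_pos)
  \<comment> \<open>Two points within \<open>e\<close> of the centre are less than
    \<open>2 * e\<close> apart. The bound by \<open>\<epsilon>\<close> makes the lower distance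
    estimate in the target applicable, and the bound by \<open>a * \<delta>\<close> keeps image
    points in the ball from which it starts.\<close>
  define e where "e = min e1 (min \<epsilon> (a * \<delta>) / (2 * K))"
  have e: "e > 0" "e \<le> e1" using C a K by (auto simp: e_def)
  have "e \<le> min \<epsilon> (a * \<delta>) / (2 * K)" by (simp add: e_def)
  then have "K * (2 * e) \<le> min \<epsilon> (a * \<delta>)" using K by (simp add: field_simps)
  then have Ke: "K * (2 * e) \<le> \<epsilon>" "K * (2 * e) \<le> a * \<delta>" by auto
  have up: "riemannian_dist N (\<phi> x) (\<phi> y) \<le> ennreal (K * dist (chart_map c x) (chart_map c y))"
    if "x \<in> chart_dom c" "y \<in> chart_dom c" "dist (chart_map c x) (chart_map c x0) < e"
        "dist (chart_map c y) (chart_map c x0) < e" for x y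
  proof -
    have "x \<in> pts M" "y \<in> pts M" using that M.chart_dom_subset[OF c(1)] by auto
    then have "riemannian_dist N (\<phi> x) (\<phi> y) \<le> ennreal L * riemannian_dist M x y" by (rule L)
    also have "riemannian_dist M x y \<le> ennreal (C * dist (chart_map c x) (chart_map c y))"
      using C(3)[of "chart_map c x" "chart_map c y"] that e M.inv_map[OF c(1)] by simp
    then have "ennreal L * riemannian_dist M x y \<le> ennreal L * ennreal (C * dist (chart_map c x) (chart_map c y))"
      by (rule mult_left_mono) simp
    also have "\<dots> = ennreal (L * C * dist (chart_map c x) (chart_map c y))"
      using L C by (simp add: ennreal_mult'[symmetric] mult.assoc)
    also have "\<dots> \<le> ennreal (K * dist (chart_map c x) (chart_map c y))"
      by (rule ennreal_leI) (simp add: K_def mult_right_mono)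
    finally show ?thesis .
  qed
  have lt: "K * dist (chart_map c x) (chart_map c y) < K * (2 * e)"
    if "dist (chart_map c x) (chart_map c x0) < e" "dist (chart_map c y) (chart_map c x0) < e" for x y
    using that K dist_triangle2[of "chart_map c x" "chart_map c y" "chart_map c x0"]
    by (intro mult_strict_left_mono) auto
  have eps: "ennreal (K * dist (chart_map c x) (chart_map c y)) < ennreal \<epsilon>"
    if "dist (chart_map c x) (chart_map c x0) < e" "dist (chart_map c y) (chart_map c x0) < e" for x y
    using lt[OF that] Ke a(2) by (intro ennreal_lessI) auto
  have near: "\<phi> x \<in> chart_dom d \<and> dist (chart_map d (\<phi> x)) (chart_map d (\<phi> x0)) < \<delta>"
    if x: "x \<in> chart_dom c" "dist (chart_map c x) (chart_map c x0) < e" for x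
  proof -
    have x0: "dist (chart_map c x0) (chart_map c x0) < e" using e by simp
    note u = up[OF c(2) x(1) x0 x(2)]
    have "riemannian_dist N (\<phi> x0) (\<phi> x) < ennreal \<epsilon>"
      using u eps[OF x0 x(2)] by (rule le_less_trans)
    from a(4)[OF d(2) _ this] have 1: "\<phi> x \<in> chart_dom d"
      and "ennreal (a * dist (chart_map d (\<phi> x0)) (chart_map d (\<phi> x))) \<le> riemannian_dist N (\<phi> x0) (\<phi> x)"
      using a(1) by auto
    then have "ennreal (a * dist (chart_map d (\<phi> x0)) (chart_map d (\<phi> x))) \<le> ennreal (K * dist (chart_map c x0) (chart_map c x))"
      using u by (meson order_trans)
    then have "a * dist (chart_map d (\<phi> x0)) (chart_map d (\<phi> x)) \<le> K * dist (chart_map c x0) (chart_map c x)"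
      using K by (simp add: ennreal_le_iff)
    also have "\<dots> < a * \<delta>" using lt[OF x0 x(2)] Ke(2) by linarith
    finally show ?thesis using 1 a(3) by (simp add: dist_commute)
  qed
  show thesis
  proof (rule that[OF e(1)])
    show "\<phi> x \<in> chart_dom d" if "x \<in> chart_dom c" "dist (chart_map c x) (chart_map c x0) < e" for x
      using near[OF that] by blast
    show "(K / a)-lipschitz_on (chart_image c \<inter> ball (chart_map c x0) e) (chart_rep c d \<phi>)"
    proof (rule lipschitz_onI)
      fix z w assume "z \<in> chart_image c \<inter> ball (chart_map c x0) e" "w \<in> chart_image c \<inter> ball (chart_map c x0) e"
      then obtain x y where zw: "z = chart_map c x" "w = chart_map c y"
        and xy: "x \<in> chart_dom c" "y \<in> chart_dom c" "dist (chart_map c x) (chart_map c x0) < e"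
        "dist (chart_map c y) (chart_map c x0) < e"
        by (auto simp: dist_commute)
      note u = up[OF xy]
      have "riemannian_dist N (\<phi> x) (\<phi> y) < ennreal \<epsilon>"
        using u eps[OF xy(3,4)] by (rule le_less_trans)
      then have "ennreal (a * dist (chart_map d (\<phi> x)) (chart_map d (\<phi> y))) \<le> riemannian_dist N (\<phi> x) (\<phi> y)"
        using a(4) near[OF xy(1,3)] by blast
      then have "ennreal (a * dist (chart_map d (\<phi> x)) (chart_map d (\<phi> y))) \<le> ennreal (K * dist (chart_map c x) (chart_map c y))"
        using u by (meson order_trans)
      then have "a * dist (chart_map d (\<phi> x)) (chart_map d (\<phi> y)) \<le> K * dist (chart_map c x) (chart_map c y)"
        using K by (simp add: ennreal_le_iff)
      then show "dist (chart_rep c d \<phi> z) (chart_rep c d \<phi> w) \<le> K / a * dist z w"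
        using a(3) M.inv_map[OF c(1)] xy(1,2) by (simp add: zw chart_rep_def field_simps)
    qed (use K a in simp)
  qed
qed

text \<open>The topology is the ambient subspace topology, not one defined by the Riemannian
  distance, so continuity is drawn from Euclidean Lipschitz continuity in charts.\<close>

lemma lipschitz_map_continuous:
  assumes \<phi>: "lipschitz_map M N \<phi>"
  shows "continuous_on (pts M) \<phi>"
  unfolding continuous_on_eq_continuous_within
proof
  fix x0 assume x0: "x0 \<in> pts M"
  then have \<phi>x0: "\<phi> x0 \<in> pts N" using \<phi> by (auto simp: lipschitz_map_def)
  define c d where "c = chart_at M x0" and "d = chart_at N (\<phi> x0)"
  have c: "c \<in> atlas M" "x0 \<in> chart_dom c" using M.chart_at[OF x0] by (auto simp: c_def)
  have d: "d \<in> atlas N" "\<phi> x0 \<in> chart_dom d" using N.chart_at[OF \<phi>x0] by (auto simp: d_def)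
  obtain e B where e: "e > 0"
    and im: "\<And>x. x \<in> chart_dom c \<Longrightarrow> dist (chart_map c x) (chart_map c x0) < e \<Longrightarrow> \<phi> x \<in> chart_dom d"
    and B: "B-lipschitz_on (chart_image c \<inter> ball (chart_map c x0) e) (chart_rep c d \<phi>)"
    using lipschitz_map_local[OF \<phi> c d] by metis
  define V where "V = chart_dom c \<inter> chart_map c -` ball (chart_map c x0) e"
  have "openin (top_of_set (chart_dom c)) V"
    unfolding V_def using M.chart_continuous[OF c(1)] by (rule continuous_openin_preimage_gen) simp
  then have V: "openin (top_of_set (pts M)) V"
    using M.chart_openin[OF c(1)] openin_trans by blast
  have xV: "x0 \<in> V" using c e by (simp add: V_def)
  have VD: "x \<in> chart_dom c" "dist (chart_map c x) (chart_map c x0) < e" if "x \<in> V" for x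
    using that by (auto simp: V_def dist_commute)
  have inv: "chart_inv c (chart_map c x) = x" if "x \<in> V" for x
    using M.inv_map[OF c(1)] VD[OF that] by blast
  have "continuous_on (chart_map c ` V) (chart_rep c d \<phi>)"
    using lipschitz_on_continuous_on[OF B] by (rule continuous_on_subset) (auto simp: V_def)
  moreover have "continuous_on V (chart_map c)"
    by (rule continuous_on_subset[OF M.chart_continuous[OF c(1)]]) (auto simp: V_def)
  ultimately have "continuous_on V (\<lambda>x. chart_rep c d \<phi> (chart_map c x))"
    by (rule continuous_on_compose2) simp
  moreover have im': "\<phi> x \<in> chart_dom d" if "x \<in> V" for x using im VD[OF that] by blast
  ultimately have "continuous_on V (\<lambda>x. chart_inv d (chart_rep c d \<phi> (chart_map c x)))"
    by (intro continuous_on_compose2[OF N.chart_inv_continuous[OF d(1)]]) (auto simp: inv chart_rep_def)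
  then have "continuous_on V \<phi>"
    by (subst continuous_on_cong[OF refl]) (auto simp: inv im' chart_rep_def N.inv_map[OF d(1)])
  then have "continuous (at x0 within V) \<phi>" using xV by (simp add: continuous_on_eq_continuous_within)
  then show "continuous (at x0 within pts M) \<phi>" using at_within_openin[OF V xV] by simp
qed

text \<open>Lusin's property (N): locally Lipschitz plane maps preserve negligible sets, and
  finitely many source charts suffice by compactness.\<close>

lemma lipschitz_map_null_image:
  assumes \<phi>: "lipschitz_map M N \<phi>" and E: "E \<in> null_sets (area_measure M)"
  shows "\<phi> ` E \<in> null_sets (area_measure N)"
  unfolding N.null_sets_area_iff
proof (intro conjI ballI)
  have EM: "E \<subseteq> pts M" using E by (simp add: M.null_sets_area_iff)
  then show "\<phi> ` E \<subseteq> pts N" using \<phi> by (auto simp: lipschitz_map_def)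
  fix d assume d: "d \<in> atlas N"
  obtain n and c :: "nat \<Rightarrow> 'a chart" where c: "\<And>i. i < n \<Longrightarrow> c i \<in> atlas M" "pts M = (\<Union>i<n. chart_dom (c i))"
    using M.finite_charts by metis
  define X where "X i = {x \<in> E \<inter> chart_dom (c i). \<phi> x \<in> chart_dom d}" for i
  have "negligible (chart_map d ` \<phi> ` X i)" if i: "i < n" for i
  proof -
    have inv: "chart_inv (c i) (chart_map (c i) x) = x" if "x \<in> chart_dom (c i)" for x
      using M.inv_map[OF c(1)[OF i]] that by blast
    have "negligible (chart_map (c i) ` X i)"
    proof (rule negligible_subset)
      show "negligible (chart_map (c i) ` (E \<inter> chart_dom (c i)))"
        using E c(1)[OF i] by (simp add: M.null_sets_area_iff)
    qed (auto simp: X_def)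
    then have "negligible (chart_rep (c i) d \<phi> ` chart_map (c i) ` X i)"
    proof (rule negligible_locally_Lipschitz_image[OF order_refl])
      fix z assume "z \<in> chart_map (c i) ` X i"
      then obtain x0 where x0: "x0 \<in> chart_dom (c i)" "\<phi> x0 \<in> chart_dom d" "z = chart_map (c i) x0"
        by (auto simp: X_def)
      obtain e B where e: "e > 0"
        and B: "B-lipschitz_on (chart_image (c i) \<inter> ball (chart_map (c i) x0) e) (chart_rep (c i) d \<phi>)"
        using lipschitz_map_local[OF \<phi> c(1)[OF i] x0(1) d x0(2)] by metis
      show "\<exists>T B. open T \<and> z \<in> T \<and> (\<forall>y\<in>chart_map (c i) ` X i \<inter> T.
          norm (chart_rep (c i) d \<phi> y - chart_rep (c i) d \<phi> z) \<le> B * norm (y - z))"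
        using e x0 lipschitz_onD[OF B]
        by (intro exI[of _ "ball z e"] exI[of _ B]) (auto simp: X_def dist_norm[symmetric])
    qed
    moreover have "chart_rep (c i) d \<phi> ` chart_map (c i) ` X i = chart_map d ` \<phi> ` X i"
      by (force simp: X_def inv chart_rep_def image_iff)
    ultimately show ?thesis by simp
  qed
  then have "negligible (\<Union>i\<in>{..<n}. chart_map d ` \<phi> ` X i)" by (intro negligible_Union) auto
  moreover have "chart_map d ` (\<phi> ` E \<inter> chart_dom d) \<subseteq> (\<Union>i\<in>{..<n}. chart_map d ` \<phi> ` X i)"
  proof
    fix w assume "w \<in> chart_map d ` (\<phi> ` E \<inter> chart_dom d)"
    then obtain x where x: "x \<in> E" "\<phi> x \<in> chart_dom d" "w = chart_map d (\<phi> x)" by blast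
    then obtain i where "i < n" "x \<in> chart_dom (c i)" using EM c(2) by blast
    then show "w \<in> (\<Union>i\<in>{..<n}. chart_map d ` \<phi> ` X i)" using x by (auto simp: X_def)
  qed
  ultimately show "negligible (chart_map d ` (\<phi> ` E \<inter> chart_dom d))" by (rule negligible_subset)
qed

end

section \<open>The area formula\<close>

context surface_pair begin

definition differentiable_set :: "('a \<Rightarrow> 'b) \<Rightarrow> 'a set" where
  "differentiable_set \<phi> = {x \<in> pts M. differentiable_at_pt M N \<phi> x}"

definition energy_density_at :: "('a \<Rightarrow> 'b) \<Rightarrow> 'a \<Rightarrow> real" where
  "energy_density_at \<phi> x = (let c = chart_at M x; d = chart_at N (\<phi> x)
     in energy_density (metric_at c x) (metric_at d (\<phi> x)) (chart_diff c d \<phi> x))"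

lemma jacobian_area_density:
  "jacobian M N \<phi> x = (let c = chart_at M x; d = chart_at N (\<phi> x)
     in area_density (metric_at c x) (metric_at d (\<phi> x)) (chart_diff c d \<phi> x))"
  by (simp add: jacobian_def area_density_def)

lemma densities_in_charts:
  assumes \<phi>: "lipschitz_map M N \<phi>" and x: "x \<in> differentiable_set \<phi>"
    and c: "c \<in> atlas M" "x \<in> chart_dom c" and d: "d \<in> atlas N" "\<phi> x \<in> chart_dom d"
  shows "(chart_rep c d \<phi> has_derivative (\<lambda>v. chart_diff c d \<phi> x *v v)) (at (chart_map c x) within chart_image c)"
    and "energy_density_at \<phi> x = energy_density (metric_at c x) (metric_at d (\<phi> x)) (chart_diff c d \<phi> x)"
    and "jacobian M N \<phi> x = area_density (metric_at c x) (metric_at d (\<phi> x)) (chart_diff c d \<phi> x)"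
proof -
  have xM: "x \<in> pts M" and diff: "differentiable_at_pt M N \<phi> x" using x by (auto simp: differentiable_set_def)
  have f: "\<phi> \<in> pts M \<rightarrow> pts N" using \<phi> by (simp add: lipschitz_map_def)
  then have "\<phi> x \<in> pts N" using xM by blast
  note ca = M.chart_at[OF xM] and da = N.chart_at[OF this]
  note ch = densities_chart_change[OF ca(1) c(1) da(1) d(1) ca(2) c(2) da(2) d(2)
      lipschitz_map_continuous[OF \<phi>] f diff[unfolded differentiable_at_pt_def Let_def]]
  show "(chart_rep c d \<phi> has_derivative (\<lambda>v. chart_diff c d \<phi> x *v v)) (at (chart_map c x) within chart_image c)"
    by (rule chart_diff_has_derivative[OF ch(1)])
  show "energy_density_at \<phi> x = energy_density (metric_at c x) (metric_at d (\<phi> x)) (chart_diff c d \<phi> x)"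
    "jacobian M N \<phi> x = area_density (metric_at c x) (metric_at d (\<phi> x)) (chart_diff c d \<phi> x)"
    using ch(2,3) by (simp_all add: energy_density_at_def jacobian_area_density Let_def)
qed

text \<open>Continuity and compactness yield finitely many disjoint measurable pieces, each carried
  from one chart domain into one chart domain, so that planar results apply to a single
  representative.\<close>

lemma pieces:
  assumes \<phi>: "lipschitz_map M N \<phi>"
  obtains n c d and D :: "nat \<Rightarrow> 'a set" where
    "\<And>i. i < n \<Longrightarrow> c i \<in> atlas M" "\<And>i. i < n \<Longrightarrow> d i \<in> atlas N" "\<And>i. D i \<in> M.surface_sets"
    "\<And>i. i < n \<Longrightarrow> D i \<subseteq> chart_dom (c i)" "\<And>i. i < n \<Longrightarrow> \<phi> ` D i \<subseteq> chart_dom (d i)"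
    "disjoint_family D" "(\<Union>i<n. D i) = pts M"
proof -
  interpret S: sigma_algebra "pts M" M.surface_sets by (rule M.sigma_algebra_surface_sets)
  define U where "U x = chart_dom (chart_at M x) \<inter> (pts M \<inter> \<phi> -` chart_dom (chart_at N (\<phi> x)))" for x
  have f: "\<phi> \<in> pts M \<rightarrow> pts N" using \<phi> by (simp add: lipschitz_map_def)
  have U: "openin (top_of_set (pts M)) (U x) \<and> x \<in> U x" if x: "x \<in> pts M" for x
  proof -
    have "\<phi> x \<in> pts N" using x f by blast
    note ca = M.chart_at[OF x] and da = N.chart_at[OF this]
    have "openin (top_of_set (pts M)) (pts M \<inter> \<phi> -` chart_dom (chart_at N (\<phi> x)))"
      using lipschitz_map_continuous[OF \<phi>] f N.chart_openin[OF da(1)]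
      by (rule continuous_openin_preimage)
    then show ?thesis
      unfolding U_def using M.chart_openin[OF ca(1)] ca(2) da(2) x by auto
  qed
  obtain n and x :: "nat \<Rightarrow> 'a" where x: "\<And>i. i < n \<Longrightarrow> x i \<in> pts M" "pts M = (\<Union>i<n. U (x i))"
    using M.finite_subcover[OF U] by metis
  define D where "D = disjointed (\<lambda>i. if i < n then U (x i) else {})"
  have sub: "D i \<subseteq> (if i < n then U (x i) else {})" for i
    unfolding D_def using disjointed_subset[of "\<lambda>i. if i < n then U (x i) else {}" i] .
  show thesis
  proof (rule that[of n "\<lambda>i. chart_at M (x i)" "\<lambda>i. chart_at N (\<phi> (x i))" D])
    show "D i \<in> M.surface_sets" for i
      unfolding D_def using S.range_disjointed_sets[of "\<lambda>i. if i < n then U (x i) else {}"] x(1) U M.openin_surface_sets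
      by auto
    show "disjoint_family D" unfolding D_def by (rule disjoint_family_disjointed)
    have "(\<Union>i. D i) = pts M" unfolding D_def UN_disjointed_eq x(2) by (auto split: if_splits)
    moreover have "(\<Union>i. D i) = (\<Union>i<n. D i)" using sub by (force split: if_splits)
    ultimately show "(\<Union>i<n. D i) = pts M" by simp
    fix i assume i: "i < n"
    have "\<phi> (x i) \<in> pts N" using x(1)[OF i] f by blast
    then show "chart_at M (x i) \<in> atlas M" "chart_at N (\<phi> (x i)) \<in> atlas N"
      using M.chart_at x(1)[OF i] N.chart_at by auto
    show "D i \<subseteq> chart_dom (chart_at M (x i))" "\<phi> ` D i \<subseteq> chart_dom (chart_at N (\<phi> (x i)))"
      using sub[of i] i by (auto simp: U_def)
  qed
qed

lemma piece_derivative: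
  assumes \<phi>: "lipschitz_map M N \<phi>" and c: "c \<in> atlas M" and d: "d \<in> atlas N"
    and D: "D \<subseteq> chart_dom c" "\<phi> ` D \<subseteq> chart_dom d" "D \<subseteq> differentiable_set \<phi>"
  shows "z \<in> chart_map c ` D \<Longrightarrow> (chart_rep c d \<phi> has_derivative (\<lambda>v. chart_diff c d \<phi> (chart_inv c z) *v v))
      (at z within chart_map c ` D)" (is "_ \<Longrightarrow> ?d")
    and "chart_rep c d \<phi> ` chart_map c ` D = chart_map d ` \<phi> ` D"
    and "continuous_on (chart_map c ` D) (chart_rep c d \<phi>)"
proof -
  let ?S = "chart_map c ` D" and ?g = "chart_rep c d \<phi>"
  let ?A = "\<lambda>z. chart_diff c d \<phi> (chart_inv c z)"
  have inv: "chart_inv c (chart_map c x) = x" if "x \<in> D" for x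
    using M.inv_map[OF c] that D by blast
  have der: "(?g has_derivative (\<lambda>v. ?A z *v v)) (at z within ?S)" if z: "z \<in> ?S" for z
  proof -
    obtain x where x: "x \<in> D" "z = chart_map c x" using z by blast
    then have "(?g has_derivative (\<lambda>v. chart_diff c d \<phi> x *v v)) (at z within chart_image c)"
      using densities_in_charts(1)[OF \<phi> _ c _ d] D by blast
    then show ?thesis using x inv D(1) by (auto intro: has_derivative_subset)
  qed
  then show "z \<in> ?S \<Longrightarrow> ?d" .
  show "?g ` ?S = chart_map d ` \<phi> ` D" by (force simp: chart_rep_def inv image_iff)
  show "continuous_on ?S ?g"
    using der by (meson continuous_on_eq_continuous_within has_derivative_continuous)
qed

text \<open>The densities are defined with charts chosen point by point, which hides their
  measurability. On a piece the same values come from one fixed pair of charts, where partial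
  derivatives are measurable.\<close>

lemma piece_measurable:
  assumes \<phi>: "lipschitz_map M N \<phi>" and c: "c \<in> atlas M" and d: "d \<in> atlas N"
    and D: "D \<in> M.surface_sets" "D \<subseteq> chart_dom c" "\<phi> ` D \<subseteq> chart_dom d" "D \<subseteq> differentiable_set \<phi>"
  shows "energy_density_at \<phi> \<in> borel_measurable (restrict_space (area_measure M) D)"
    and "jacobian M N \<phi> \<in> borel_measurable (restrict_space (area_measure M) D)"
proof -
  let ?S = "chart_map c ` D" and ?g = "chart_rep c d \<phi>"
  let ?A = "\<lambda>z. chart_diff c d \<phi> (chart_inv c z)"
  have inv: "chart_inv c (chart_map c x) = x" if "x \<in> D" for x
    using M.inv_map[OF c] that D by blast
  have S: "?S \<in> sets lebesgue" by (rule M.surface_sets_image[OF D(1,2) c])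
  note der = piece_derivative(1)[OF \<phi> c d D(2-4)]
  have A: "(\<lambda>z. ?A z $ i $ j) \<in> borel_measurable (lebesgue_on ?S)" for i j
  proof -
    have "(\<lambda>z. matrix (\<lambda>v. ?A z *v v) $ i $ j) \<in> borel_measurable (lebesgue_on ?S)"
      by (rule borel_measurable_partial_derivatives[OF S der])
    then show ?thesis by simp
  qed
  have G: "(\<lambda>z. chart_metric c z $ i $ j) \<in> borel_measurable (lebesgue_on ?S)" for i j
    using D(2) by (intro M.chart_metric_entry_measurable[OF c _ S]) auto
  note piece_derivative(3)[OF \<phi> c d D(2-4)]
  moreover have gS: "?g ` ?S \<subseteq> chart_image d" using D(3) by (auto simp: chart_rep_def inv)
  moreover have "continuous_on (chart_image d) (chart_metric d)"
    by (rule N.chart_metric_continuous[OF d])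
  ultimately have "continuous_on ?S (\<lambda>z. chart_metric d (?g z))"
    by (metis continuous_on_compose2)
  then have H: "(\<lambda>z. chart_metric d (?g z) $ i $ j) \<in> borel_measurable (lebesgue_on ?S)" for i j
    by (intro continuous_imp_measurable_on_sets_lebesgue[OF _ S] continuous_intros)
  have det: "det (chart_metric c z) \<noteq> 0" if "z \<in> space (lebesgue_on ?S)" for z
    using that D(2) spd_components(4)[OF M.chart_spd[OF c]] by force
  have eq: "energy_density_at \<phi> (chart_inv c z) = energy_density (chart_metric c z) (chart_metric d (?g z)) (?A z)"
    "jacobian M N \<phi> (chart_inv c z) = area_density (chart_metric c z) (chart_metric d (?g z)) (?A z)"
    if z: "z \<in> space (lebesgue_on ?S)" for z
  proof -
    obtain x where x: "x \<in> D" "z = chart_map c x" using z by auto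
    have "x \<in> differentiable_set \<phi>" "x \<in> chart_dom c" "\<phi> x \<in> chart_dom d" using x D by auto
    from densities_in_charts(2,3)[OF \<phi> this(1) c this(2) d this(3)]
    show "energy_density_at \<phi> (chart_inv c z) = energy_density (chart_metric c z) (chart_metric d (?g z)) (?A z)"
      "jacobian M N \<phi> (chart_inv c z) = area_density (chart_metric c z) (chart_metric d (?g z)) (?A z)"
      using x by (simp_all add: inv chart_rep_def)
  qed
  show "energy_density_at \<phi> \<in> borel_measurable (restrict_space (area_measure M) D)"
    by (rule M.borel_measurable_piece[OF c D(1,2)])
      (subst measurable_cong[OF eq(1)], assumption, rule energy_density_measurable[OF G det H A])
  show "jacobian M N \<phi> \<in> borel_measurable (restrict_space (area_measure M) D)"
    by (rule M.borel_measurable_piece[OF c D(1,2)])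
      (subst measurable_cong[OF eq(2)], assumption, rule area_density_measurable[OF G H A])
qed

text \<open>Substitution in one pair of charts; the non-negative sign removes the absolute value of
  the determinant. \<open>J\<close> stands for a globally measurable function that agrees with the
  Jacobian on the piece.\<close>

lemma piece_area:
  assumes \<phi>: "lipschitz_map M N \<phi>" and c: "c \<in> atlas M" and d: "d \<in> atlas N"
    and D: "D \<in> M.surface_sets" "D \<subseteq> chart_dom c" "\<phi> ` D \<subseteq> chart_dom d" "D \<subseteq> differentiable_set \<phi>"
    and inj: "inj_on \<phi> D" and J: "J \<in> borel_measurable (area_measure M)"
      "\<And>x. x \<in> D \<Longrightarrow> J x = jacobian M N \<phi> x \<and> 0 \<le> J x"
  shows "\<phi> ` D \<in> N.surface_sets"
    and "(\<integral>\<^sup>+x\<in>D. ennreal (J x) \<partial>area_measure M) = emeasure (area_measure N) (\<phi> ` D)"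
proof -
  let ?S = "chart_map c ` D" and ?g = "chart_rep c d \<phi>"
  let ?A = "\<lambda>z. chart_diff c d \<phi> (chart_inv c z)"
  have inv: "chart_inv c (chart_map c x) = x" if "x \<in> D" for x
    using M.inv_map[OF c] that D by blast
  have S: "?S \<in> sets lebesgue" by (rule M.surface_sets_image[OF D(1,2) c])
  note der = piece_derivative(1)[OF \<phi> c d D(2-4)]
  note gS = piece_derivative(2)[OF \<phi> c d D(2-4)]
  have "?g differentiable_on ?S" using der by (auto simp: differentiable_on_def differentiable_def)
  then have gSm: "chart_map d ` \<phi> ` D \<in> sets lebesgue"
    using S unfolding gS[symmetric] by (intro differentiable_image_in_sets_lebesgue) auto
  then show im: "\<phi> ` D \<in> N.surface_sets" by (rule N.surface_setsI[OF d D(3)])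
  have injg: "inj_on ?g ?S"
  proof (rule inj_onI)
    fix z w assume "z \<in> ?S" "w \<in> ?S" and eq: "?g z = ?g w"
    then obtain x y where xy: "x \<in> D" "y \<in> D" "z = chart_map c x" "w = chart_map c y" by blast
    then have "chart_map d (\<phi> x) = chart_map d (\<phi> y)" using eq by (simp add: chart_rep_def inv)
    then have "\<phi> x = \<phi> y" using inj_onD[OF N.chart_inj[OF d]] xy D(3) by blast
    then show "z = w" using inj_onD[OF inj] xy by blast
  qed
  have sub: "chart_map d ` \<phi> ` D \<subseteq> chart_image d" using D(3) by blast
  have m: "(\<lambda>z. sqrt (det (chart_metric d z))) \<in> borel_measurable (lebesgue_on (?g ` ?S))"
    unfolding gS using sub gSm d
    by (intro continuous_imp_measurable_on_sets_lebesgue continuous_on_subset[OF N.chart_density_continuous]) auto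
  note piece_derivative(3)[OF \<phi> c d D(2-4)]
  then have m': "(\<lambda>z. sqrt (det (chart_metric d (?g z)))) \<in> borel_measurable (lebesgue_on ?S)"
    using S gS sub d
    by (intro continuous_imp_measurable_on_sets_lebesgue continuous_on_compose2[OF N.chart_density_continuous]) auto
  have eq: "J x * sqrt (det (metric_at c x)) = \<bar>det (chart_diff c d \<phi> x)\<bar> * sqrt (det (metric_at d (\<phi> x)))"
    if x: "x \<in> D" for x
  proof -
    have xx: "x \<in> differentiable_set \<phi>" "x \<in> chart_dom c" "\<phi> x \<in> chart_dom d" using x D by auto
    have G: "0 < sqrt (det (metric_at c x))" and H: "0 < sqrt (det (metric_at d (\<phi> x)))"
      using spd_components(4)[OF M.metric_spd[OF c xx(2)]] spd_components(4)[OF N.metric_spd[OF d xx(3)]] by auto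
    have "J x * sqrt (det (metric_at c x)) = det (chart_diff c d \<phi> x) * sqrt (det (metric_at d (\<phi> x)))"
      using densities_in_charts(3)[OF \<phi> xx(1) c xx(2) d xx(3)] J(2)[OF x] G by (simp add: area_density_def)
    moreover have "0 \<le> J x * sqrt (det (metric_at c x))" using J(2)[OF x] G by simp
    ultimately show ?thesis using H by (simp add: zero_le_mult_iff)
  qed
  have eq': "ennreal (J x) * ennreal (sqrt (det (metric_at c x))) =
      ennreal (\<bar>det (chart_diff c d \<phi> x)\<bar> * sqrt (det (metric_at d (\<phi> x))))" if x: "x \<in> D" for x
    unfolding eq[OF x, symmetric] using J(2)[OF x] by (simp add: ennreal_mult')
  have "(\<integral>\<^sup>+x\<in>D. ennreal (J x) \<partial>area_measure M) =
      (\<integral>\<^sup>+z\<in>?S. ennreal (J (chart_inv c z)) * ennreal (sqrt (det (chart_metric c z))) \<partial>lebesgue)"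
    using J(1) by (intro M.nn_integral_chart[OF c D(1,2)]) auto
  also have "\<dots> = (\<integral>\<^sup>+z\<in>?S. ennreal (\<bar>det (matrix (\<lambda>v. ?A z *v v))\<bar> * sqrt (det (chart_metric d (?g z)))) \<partial>lebesgue)"
    using eq' by (intro nn_integral_cong) (auto simp: indicator_def inv chart_rep_def)
  also have "\<dots> = (\<integral>\<^sup>+z\<in>?g ` ?S. ennreal (sqrt (det (chart_metric d z))) \<partial>lebesgue)"
    using spd_components(4) N.metric_spd[OF d] D(3) unfolding gS
    by (intro nn_integral_change_of_variables[OF S der injg _ m m', unfolded gS]) (auto intro!: less_imp_le)
  also have "\<dots> = emeasure (area_measure N) (\<phi> ` D)"
    unfolding gS using N.emeasure_area[OF d im D(3)] N.emeasure_chart_area[OF d im D(3)] by simp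
  finally show "(\<integral>\<^sup>+x\<in>D. ennreal (J x) \<partial>area_measure M) = emeasure (area_measure N) (\<phi> ` D)" .
qed

text \<open>Where the differential is invertible, preimages of negligible sets are negligible. This
  discards the non-critical points that are sent to values taken more than once.\<close>

lemma piece_null_preimage:
  assumes \<phi>: "lipschitz_map M N \<phi>" and c: "c \<in> atlas M" and d: "d \<in> atlas N"
    and D: "D \<subseteq> chart_dom c" "\<phi> ` D \<subseteq> chart_dom d" "D \<subseteq> differentiable_set \<phi>"
    and J: "\<And>x. x \<in> D \<Longrightarrow> jacobian M N \<phi> x \<noteq> 0" and Z: "\<phi> ` D \<subseteq> Z" "Z \<in> null_sets (area_measure N)"
  shows "D \<in> null_sets (area_measure M)"
proof (rule M.null_setsI_chart[OF c D(1)])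
  let ?S = "chart_map c ` D" and ?g = "chart_rep c d \<phi>"
  let ?A = "\<lambda>z. chart_diff c d \<phi> (chart_inv c z)"
  have inv: "chart_inv c (chart_map c x) = x" if "x \<in> D" for x
    using M.inv_map[OF c] that D by blast
  have "negligible (chart_map d ` (Z \<inter> chart_dom d))"
    using Z(2) d by (simp add: N.null_sets_area_iff)
  then have "negligible {z \<in> ?S. ?g z \<in> chart_map d ` (Z \<inter> chart_dom d)}"
  proof (rule negligible_differentiable_vimage[OF _ _ piece_derivative(1)[OF \<phi> c d D]])
    fix z assume "z \<in> ?S"
    then obtain x where x: "x \<in> D" "z = chart_map c x" by blast
    have xx: "x \<in> differentiable_set \<phi>" "x \<in> chart_dom c" "\<phi> x \<in> chart_dom d" using x D by auto
    note den = densities_in_charts[OF \<phi> xx(1) c xx(2) d xx(3)]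
    have "det (chart_diff c d \<phi> x) \<noteq> 0" using J[OF x(1)] den(3) by (auto simp: area_density_def)
    then show "inj (\<lambda>v. ?A z *v v)"
      using x inv by (simp add: inj_matrix_vector_mult invertible_det_nz)
  qed
  moreover have "{z \<in> ?S. ?g z \<in> chart_map d ` (Z \<inter> chart_dom d)} = ?S"
    using D(2) Z(1) by (auto simp: chart_rep_def inv intro!: imageI)
  ultimately show "negligible ?S" by simp
qed

text \<open>Sard's theorem in equal dimensions, which asks only for differentiability.\<close>

lemma piece_critical_null:
  assumes \<phi>: "lipschitz_map M N \<phi>" and c: "c \<in> atlas M" and d: "d \<in> atlas N"
    and D: "D \<subseteq> chart_dom c" "\<phi> ` D \<subseteq> chart_dom d" "D \<subseteq> differentiable_set \<phi>"
    and J: "\<And>x. x \<in> D \<Longrightarrow> jacobian M N \<phi> x = 0"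
  shows "\<phi> ` D \<in> null_sets (area_measure N)"
proof (rule N.null_setsI_chart[OF d D(2)])
  let ?S = "chart_map c ` D" and ?g = "chart_rep c d \<phi>"
  let ?A = "\<lambda>z. chart_diff c d \<phi> (chart_inv c z)"
  have inv: "chart_inv c (chart_map c x) = x" if "x \<in> D" for x
    using M.inv_map[OF c] that D by blast
  have "negligible (?g ` ?S)"
  proof (rule baby_Sard[OF order_refl piece_derivative(1)[OF \<phi> c d D]])
    fix z assume "z \<in> ?S"
    then obtain x where x: "x \<in> D" "z = chart_map c x" by blast
    have xx: "x \<in> differentiable_set \<phi>" "x \<in> chart_dom c" "\<phi> x \<in> chart_dom d" using x D by auto
    note den = densities_in_charts[OF \<phi> xx(1) c xx(2) d xx(3)]
    have "det (chart_diff c d \<phi> x) = 0"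
      using J[OF x(1)] den(3) spd_components(4)[OF M.metric_spd[OF c xx(2)]]
        spd_components(4)[OF N.metric_spd[OF d xx(3)]] by (simp add: area_density_def)
    then show "rank (matrix (\<lambda>v. ?A z *v v)) < CARD(2)"
      using x inv by (simp add: det_eq_0_rank)
  qed
  then show "negligible (chart_map d ` \<phi> ` D)" by (simp add: piece_derivative(2)[OF \<phi> c d D])
qed

text \<open>Off this set the derivative in the definition of the densities may be a meaningless
  choice. Integrands are therefore cut off to zero outside it, which changes them only on a null
  set.\<close>

definition good_set :: "('a \<Rightarrow> 'b) \<Rightarrow> 'a set" where
  "good_set \<phi> = {x \<in> differentiable_set \<phi>. 0 \<le> jacobian M N \<phi> x}"

lemma good_set_null:
  assumes "\<phi> \<in> lip_inj_plus M N"
  shows "pts M - good_set \<phi> \<in> null_sets (area_measure M)" "good_set \<phi> \<in> M.surface_sets"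
proof -
  have "AE x in area_measure M. differentiable_at_pt M N \<phi> x \<and> 0 \<le> jacobian M N \<phi> x"
    using assms by (simp add: lip_inj_plus_def)
  from M.AE_area_null[OF this] show 1: "pts M - good_set \<phi> \<in> null_sets (area_measure M)"
    by (rule M.null_sets_area_subset) (auto simp: good_set_def differentiable_set_def)
  then have "pts M - (pts M - good_set \<phi>) \<in> sets (area_measure M)"
    by (metis M.space_area null_setsD2 sets.compl_sets)
  moreover have "pts M - (pts M - good_set \<phi>) = good_set \<phi>"
    by (auto simp: good_set_def differentiable_set_def)
  ultimately show "good_set \<phi> \<in> M.surface_sets" by (simp add: M.sets_area)
qed

lemma densities_measurable:
  assumes \<phi>: "\<phi> \<in> lip_inj_plus M N"
  shows "(\<lambda>x. if x \<in> good_set \<phi> then energy_density_at \<phi> x else 0) \<in> borel_measurable (area_measure M)" (is "?e \<in> _")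
    and "(\<lambda>x. if x \<in> good_set \<phi> then jacobian M N \<phi> x else 0) \<in> borel_measurable (area_measure M)" (is "?j \<in> _")
proof -
  have lip: "lipschitz_map M N \<phi>" using \<phi> by (simp add: lip_inj_plus_def)
  obtain n c d and D :: "nat \<Rightarrow> 'a set" where p:
    "\<And>i. i < n \<Longrightarrow> c i \<in> atlas M" "\<And>i. i < n \<Longrightarrow> d i \<in> atlas N" "\<And>i. D i \<in> M.surface_sets"
    "\<And>i. i < n \<Longrightarrow> D i \<subseteq> chart_dom (c i)" "\<And>i. i < n \<Longrightarrow> \<phi> ` D i \<subseteq> chart_dom (d i)"
    "disjoint_family D" "(\<Union>i<n. D i) = pts M"
    using pieces[OF lip] by metis
  note G = good_set_null(2)[OF \<phi>]
  define \<C> where "\<C> = insert (pts M - good_set \<phi>) ((\<lambda>i. D i \<inter> good_set \<phi>) ` {..<n})"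
  have C: "countable \<C>" by (simp add: \<C>_def)
  have DG: "D i \<inter> good_set \<phi> \<in> M.surface_sets" for i using p(3) G by (rule M.surface_sets_Int)
  have GM: "good_set \<phi> \<subseteq> pts M" by (auto simp: good_set_def differentiable_set_def)
  have sets: "\<Omega> \<inter> space (area_measure M) \<in> sets (area_measure M)" if "\<Omega> \<in> \<C>" for \<Omega>
  proof -
    have "\<Omega> \<in> sets (area_measure M)"
      using that DG null_setsD2[OF good_set_null(1)[OF \<phi>]] by (auto simp: \<C>_def M.sets_area)
    then show ?thesis by (simp add: sets.Int_space_eq2)
  qed
  have cov: "space (area_measure M) \<subseteq> \<Union>\<C>" using p(7) by (auto simp: \<C>_def M.space_area)
  have on: "f \<in> borel_measurable (restrict_space (area_measure M) \<Omega>)"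
    if \<Omega>: "\<Omega> \<in> \<C>" and f: "\<And>x. x \<in> good_set \<phi> \<Longrightarrow> f x = h x" "\<And>x. x \<notin> good_set \<phi> \<Longrightarrow> f x = 0"
      and h: "\<And>i. i < n \<Longrightarrow> h \<in> borel_measurable (restrict_space (area_measure M) (D i \<inter> good_set \<phi>))"
    for \<Omega> and f h :: "'a \<Rightarrow> real"
  proof (cases "\<Omega> = pts M - good_set \<phi>")
    case True
    have "(\<lambda>x. 0::real) \<in> borel_measurable (restrict_space (area_measure M) \<Omega>)" by simp
    then show ?thesis using f(2) True by (subst measurable_cong) (auto simp: space_restrict_space)
  next
    case False
    then obtain i where "i < n" "\<Omega> = D i \<inter> good_set \<phi>" using \<Omega> by (auto simp: \<C>_def)
    then show ?thesis using h[of i] f(1) by (subst measurable_cong) (auto simp: space_restrict_space)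
  qed
  have pm: "energy_density_at \<phi> \<in> borel_measurable (restrict_space (area_measure M) (D i \<inter> good_set \<phi>))"
    "jacobian M N \<phi> \<in> borel_measurable (restrict_space (area_measure M) (D i \<inter> good_set \<phi>))"
    if i: "i < n" for i
  proof -
    have "D i \<inter> good_set \<phi> \<subseteq> chart_dom (c i)" "\<phi> ` (D i \<inter> good_set \<phi>) \<subseteq> chart_dom (d i)"
      "D i \<inter> good_set \<phi> \<subseteq> differentiable_set \<phi>"
      using p(4,5)[OF i] by (auto simp: good_set_def)
    from piece_measurable[OF lip p(1)[OF i] p(2)[OF i] DG this]
    show "energy_density_at \<phi> \<in> borel_measurable (restrict_space (area_measure M) (D i \<inter> good_set \<phi>))"
      "jacobian M N \<phi> \<in> borel_measurable (restrict_space (area_measure M) (D i \<inter> good_set \<phi>))" .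
  qed
  show "?e \<in> borel_measurable (area_measure M)"
    by (rule measurable_piecewise_restrict[OF C sets cov]) (auto intro!: on[where h = "energy_density_at \<phi>"] pm(1))
  show "?j \<in> borel_measurable (area_measure M)"
    by (rule measurable_piecewise_restrict[OF C sets cov]) (auto intro!: on[where h = "jacobian M N \<phi>"] pm(2))
qed

text \<open>The points of positive Jacobian that are mapped into the null set of multiple values form a
  null set, while the critical points have null image; off these sets the map is injective.\<close>

theorem area_formula:
  assumes \<phi>: "\<phi> \<in> lip_inj_plus M N"
  shows "(\<integral>\<^sup>+x. ennreal (if x \<in> good_set \<phi> then jacobian M N \<phi> x else 0) \<partial>area_measure M) =
      emeasure (area_measure N) (\<phi> ` pts M)"
proof -
  have lip: "lipschitz_map M N \<phi>" using \<phi> by (simp add: lip_inj_plus_def)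
  have f: "\<phi> ` pts M \<subseteq> pts N" using lip by (auto simp: lipschitz_map_def)
  obtain n c d and D :: "nat \<Rightarrow> 'a set" where p:
    "\<And>i. i < n \<Longrightarrow> c i \<in> atlas M" "\<And>i. i < n \<Longrightarrow> d i \<in> atlas N" "\<And>i. D i \<in> M.surface_sets"
    "\<And>i. i < n \<Longrightarrow> D i \<subseteq> chart_dom (c i)" "\<And>i. i < n \<Longrightarrow> \<phi> ` D i \<subseteq> chart_dom (d i)"
    "disjoint_family D" "(\<Union>i<n. D i) = pts M"
    using pieces[OF lip] by metis
  note G = good_set_null[OF \<phi>] and J = densities_measurable(2)[OF \<phi>]
  have GM: "good_set \<phi> \<subseteq> pts M" by (auto simp: good_set_def differentiable_set_def)
  let ?J = "\<lambda>x. if x \<in> good_set \<phi> then jacobian M N \<phi> x else 0"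
  define Z where "Z = {q \<in> pts N. \<not> (\<exists>\<^sub>\<le>\<^sub>1x. x \<in> pts M \<and> \<phi> x = q)}"
  have Z: "Z \<in> null_sets (area_measure N)"
    unfolding Z_def using \<phi> by (intro N.AE_area_null) (simp add: lip_inj_plus_def)
  define P where "P = {x \<in> good_set \<phi>. 0 < jacobian M N \<phi> x}"
  have "P = {x \<in> space (area_measure M). 0 < ?J x}" using GM by (auto simp: P_def M.space_area)
  then have P: "P \<in> sets (area_measure M)" using J by simp
  define Q where "Q = {x \<in> P. \<phi> x \<in> Z}"
  have Qi: "D i \<inter> Q \<in> null_sets (area_measure M)" if i: "i < n" for i
    using p(4,5)[OF i]
    by (intro piece_null_preimage[OF lip p(1)[OF i] p(2)[OF i] _ _ _ _ _ Z]) (auto simp: Q_def P_def good_set_def)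
  have "Q = (\<Union>i\<in>{..<n}. D i \<inter> Q)" using p(7) GM by (auto simp: Q_def P_def)
  also have "\<dots> \<in> null_sets (area_measure M)" using Qi by (intro null_sets_UN') auto
  finally have Q: "Q \<in> null_sets (area_measure M)" .
  define M0 where "M0 = P - Q"
  have M0: "M0 \<in> sets (area_measure M)" unfolding M0_def using P Q by auto
  define K where "K = {x \<in> good_set \<phi>. jacobian M N \<phi> x = 0}"
  have Ki: "\<phi> ` (D i \<inter> K) \<in> null_sets (area_measure N)" if i: "i < n" for i
    using p(4,5)[OF i]
    by (intro piece_critical_null[OF lip p(1)[OF i] p(2)[OF i]]) (auto simp: K_def good_set_def)
  have "K = (\<Union>i\<in>{..<n}. D i \<inter> K)" using p(7) GM by (auto simp: K_def)
  then have "\<phi> ` K = (\<Union>i\<in>{..<n}. \<phi> ` (D i \<inter> K))" by (metis image_UN)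
  also have "\<dots> \<in> null_sets (area_measure N)" using Ki by (intro null_sets_UN') auto
  finally have K: "\<phi> ` K \<in> null_sets (area_measure N)" .
  have inj: "inj_on \<phi> M0"
  proof (rule inj_onI)
    fix x y assume xy: "x \<in> M0" "y \<in> M0" "\<phi> x = \<phi> y"
    then have pts: "x \<in> pts M" "y \<in> pts M" using GM by (auto simp: M0_def P_def)
    then have "\<phi> x \<in> pts N" using f by blast
    moreover have "\<phi> x \<notin> Z" using xy by (auto simp: M0_def Q_def)
    ultimately have "\<exists>\<^sub>\<le>\<^sub>1u. u \<in> pts M \<and> \<phi> u = \<phi> x" by (simp add: Z_def)
    then show "x = y" by (rule Uniq_D) (use pts xy in auto)
  qed
  define E where "E i = D i \<inter> M0" for i
  have E: "E i \<in> M.surface_sets" for i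
    unfolding E_def using p(3) M0 by (intro M.surface_sets_Int) (auto simp: M.sets_area)
  have Ed: "disjoint_family_on E {..<n}" using p(6) by (auto simp: E_def disjoint_family_on_def)
  have M0E: "M0 = (\<Union>i<n. E i)" using p(7) GM by (auto simp: E_def M0_def P_def)
  have Esub: "E i \<subseteq> chart_dom (c i)" "\<phi> ` E i \<subseteq> chart_dom (d i)" "E i \<subseteq> differentiable_set \<phi>" "inj_on \<phi> (E i)"
    if "i < n" for i
    using p(4,5)[OF that] inj by (auto simp: E_def M0_def P_def good_set_def intro: inj_on_subset)
  have EJ: "?J x = jacobian M N \<phi> x \<and> 0 \<le> ?J x" if "x \<in> E i" for i x
    using that by (auto simp: E_def M0_def P_def)
  have pa: "\<phi> ` E i \<in> N.surface_sets"
    "(\<integral>\<^sup>+x\<in>E i. ennreal (?J x) \<partial>area_measure M) = emeasure (area_measure N) (\<phi> ` E i)" if i: "i < n" for i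
    using piece_area[OF lip p(1)[OF i] p(2)[OF i] E Esub[OF i] J EJ] by auto
  \<comment> \<open>Outside \<open>P\<close> the integrand is zero, and \<open>Q\<close> is a null
    set, so only \<open>M0\<close> contributes.\<close>
  have "(\<integral>\<^sup>+x. ennreal (?J x) \<partial>area_measure M) = (\<integral>\<^sup>+x\<in>M0. ennreal (?J x) \<partial>area_measure M)"
  proof (rule nn_integral_cong_AE)
    show "AE x in area_measure M. ennreal (?J x) = ennreal (?J x) * indicator M0 x"
      by (rule AE_I'[OF Q]) (auto simp: M0_def P_def good_set_def indicator_def ennreal_eq_0_iff split: if_splits)
  qed
  also have "\<dots> = (\<integral>\<^sup>+x. (\<Sum>i<n. ennreal (?J x) * indicator (E i) x) \<partial>area_measure M)"
    unfolding M0E using Ed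
    by (intro nn_integral_cong) (simp add: indicator_UN_disjoint sum_distrib_left)
  also have "\<dots> = (\<Sum>i<n. \<integral>\<^sup>+x\<in>E i. ennreal (?J x) \<partial>area_measure M)"
    using J E by (intro nn_integral_sum borel_measurable_times_ennreal borel_measurable_indicator) (auto simp: M.sets_area)
  also have "\<dots> = (\<Sum>i<n. emeasure (area_measure N) (\<phi> ` E i))" using pa(2) by simp
  also have "\<dots> = emeasure (area_measure N) (\<Union>i<n. \<phi> ` E i)"
  proof (rule sum_emeasure)
    have "\<phi> ` E i \<inter> \<phi> ` E j = {}" if "i < n" "j < n" "i \<noteq> j" for i j
    proof -
      have "\<phi> ` E i \<inter> \<phi> ` E j = \<phi> ` (E i \<inter> E j)"
        by (rule inj_on_image_Int[OF inj, symmetric]) (auto simp: E_def)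
      then show ?thesis using Ed that by (simp add: disjoint_family_on_def)
    qed
    then show "disjoint_family_on (\<lambda>i. \<phi> ` E i) {..<n}" by (auto simp: disjoint_family_on_def)
  qed (use pa(1) in \<open>auto simp: N.sets_area\<close>)
  also have "(\<Union>i<n. \<phi> ` E i) = \<phi> ` M0" by (simp add: M0E image_UN)
  also have "emeasure (area_measure N) (\<phi> ` M0) = emeasure (area_measure N) (\<phi> ` pts M)"
  proof -
    \<comment> \<open>Image points missed by \<open>M0\<close> are multiple values, critical values,
      or images of points outside the good set; the last kind is null by property (N).\<close>
    define X where "X = Z \<union> \<phi> ` K \<union> \<phi> ` (pts M - good_set \<phi>)"
    have X: "X \<in> null_sets (area_measure N)"
      unfolding X_def using Z K lipschitz_map_null_image[OF lip G(1)] by (intro null_sets.Un)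
    have m: "\<phi> ` M0 \<in> sets (area_measure N)"
      unfolding M0E image_UN using pa(1) by (auto simp: N.sets_area[symmetric])
    have "\<phi> ` pts M - \<phi> ` M0 \<in> null_sets (area_measure N)"
      by (rule N.null_sets_area_subset[OF X]) (force simp: X_def K_def M0_def P_def Q_def good_set_def)
    from emeasure_Un_null_set[OF m this]
    have "emeasure (area_measure N) (\<phi> ` M0) = emeasure (area_measure N) (\<phi> ` M0 \<union> (\<phi> ` pts M - \<phi> ` M0))" by simp
    also have "\<phi> ` M0 \<union> (\<phi> ` pts M - \<phi> ` M0) = \<phi> ` pts M" using GM by (auto simp: M0_def P_def)
    finally show ?thesis .
  qed
  finally show ?thesis .
qed

end

section \<open>Homotheties are Lipschitz maps\<close>

text \<open>\<open>f\<close> will be the speed of a path, whose measurability is not established. A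
  simple function below \<open>r * f\<close> becomes one below \<open>f\<close> after division by
  \<open>r\<close>, and for simple functions the constant can be pulled out.\<close>

lemma nn_integral_cmult_le:
  assumes "0 < r"
  shows "(\<integral>\<^sup>+x. ennreal r * f x \<partial>M) \<le> ennreal r * (\<integral>\<^sup>+x. f x \<partial>M)"
  unfolding nn_integral_def[of M "\<lambda>x. ennreal r * f x"]
proof (rule SUP_least)
  fix g assume "g \<in> {g. simple_function M g \<and> g \<le> (\<lambda>x. ennreal r * f x)}"
  then have g: "simple_function M g" "\<And>x. g x \<le> ennreal r * f x" by (auto simp: le_fun_def)
  have r: "ennreal r * ennreal (1 / r) = 1" using assms by (simp add: ennreal_mult'[symmetric])
  have "integral\<^sup>S M g = (\<integral>\<^sup>+x. g x \<partial>M)" using g(1) by (rule nn_integral_eq_simple_integral[symmetric])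
  also have "\<dots> = (\<integral>\<^sup>+x. ennreal r * (ennreal (1 / r) * g x) \<partial>M)"
    by (simp add: mult.assoc[symmetric] r)
  also have "\<dots> = ennreal r * (\<integral>\<^sup>+x. ennreal (1 / r) * g x \<partial>M)"
    using borel_measurable_simple_function[OF g(1)] by (intro nn_integral_cmult) measurable
  also have "\<dots> \<le> ennreal r * (\<integral>\<^sup>+x. f x \<partial>M)"
  proof (intro mult_left_mono nn_integral_mono)
    fix x
    have "ennreal (1 / r) * g x \<le> ennreal (1 / r) * (ennreal r * f x)"
      using g(2) by (rule mult_left_mono) simp
    also have "\<dots> = f x" using r by (simp add: mult.assoc[symmetric] mult.commute)
    finally show "ennreal (1 / r) * g x \<le> f x" .
  qed simp
  finally show "integral\<^sup>S M g \<le> ennreal r * (\<integral>\<^sup>+x. f x \<partial>M)" .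
qed

context surface_pair begin

lemma conformal_densities:
  assumes x: "x \<in> pts M" "\<phi> x \<in> pts N"
    and eq: "chart_pullback (chart_at M x) (chart_at N (\<phi> x)) \<phi> x = r\<^sup>2 *\<^sub>R metric_at (chart_at M x) x"
    and J: "0 \<le> jacobian M N \<phi> x"
  shows "energy_density_at \<phi> x = 2 * r\<^sup>2" "jacobian M N \<phi> x = r\<^sup>2"
  using densities_conformal[OF M.metric_spd[OF M.chart_at[OF x(1)]] N.metric_spd[OF N.chart_at[OF x(2)]]
      eq[unfolded chart_pullback_def]] J
  by (simp_all add: energy_density_at_def jacobian_area_density Let_def)

text \<open>A smooth conformal map multiplies the length of every path by the conformal factor.\<close>

lemma homothety_lipschitz:
  assumes \<psi>: "smooth_map M N \<psi>" and r: "0 < r"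
    and conf: "\<And>x. x \<in> pts M \<Longrightarrow>
      chart_pullback (chart_at M x) (chart_at N (\<psi> x)) \<psi> x = r\<^sup>2 *\<^sub>R metric_at (chart_at M x) x"
    and J: "\<And>x. x \<in> pts M \<Longrightarrow> 0 < jacobian M N \<psi> x"
  shows "\<And>x. x \<in> pts M \<Longrightarrow> differentiable_at_pt M N \<psi> x" "lipschitz_map M N \<psi>"
proof -
  have f: "\<psi> \<in> pts M \<rightarrow> pts N" and cont: "continuous_on (pts M) \<psi>"
    and sm: "\<And>c d. c \<in> atlas M \<Longrightarrow> d \<in> atlas N \<Longrightarrow>
      smooth_on (chart_map c ` (chart_dom c \<inter> \<psi> -` chart_dom d)) (chart_rep c d \<psi>)"
    using \<psi> by (auto simp: smooth_map_def)
  have pre: "openin (top_of_set (pts M)) (pts M \<inter> \<psi> -` chart_dom d)" if "d \<in> atlas N" for d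
    using cont f N.chart_openin[OF that] by (rule continuous_openin_preimage)
  have diff: "chart_rep c d \<psi> differentiable (at (chart_map c x) within chart_image c)"
    if c: "c \<in> atlas M" "x \<in> chart_dom c" and d: "d \<in> atlas N" "\<psi> x \<in> chart_dom d" for c d x
  proof -
    let ?V = "chart_map c ` (chart_dom c \<inter> \<psi> -` chart_dom d)"
    have "openin (top_of_set (chart_image c)) (chart_map c ` ((pts M \<inter> \<psi> -` chart_dom d) \<inter> chart_dom c))"
      by (rule chart_image_openin[OF M.chart[OF c(1)] pre[OF d(1)]])
    moreover have "(pts M \<inter> \<psi> -` chart_dom d) \<inter> chart_dom c = chart_dom c \<inter> \<psi> -` chart_dom d"
      using M.chart_dom_subset[OF c(1)] by blast
    ultimately have V: "openin (top_of_set (chart_image c)) ?V" by simp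
    have xV: "chart_map c x \<in> ?V" using c d by blast
    obtain D where "(chart_rep c d \<psi> has_derivative D) (at (chart_map c x) within ?V)"
      using smooth_on_has_derivative[OF sm[OF c(1) d(1)] xV] by metis
    then show ?thesis unfolding at_within_openin[OF V xV] by (auto simp: differentiable_def)
  qed
  show "differentiable_at_pt M N \<psi> x" if x: "x \<in> pts M" for x
  proof -
    have "\<psi> x \<in> pts N" using f x by blast
    then show ?thesis
      unfolding differentiable_at_pt_def Let_def by (intro diff M.chart_at N.chart_at x)
  qed
  \<comment> \<open>Conformality is given in the chosen charts only. It passes to other charts
    through the two densities, which do not depend on charts and together characterize it.\<close>
  have form: "v \<bullet> (metric_at c x *v v) * r\<^sup>2 = (chart_diff c d \<psi> x *v v) \<bullet> (metric_at d (\<psi> x) *v (chart_diff c d \<psi> x *v v))"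
    if c: "c \<in> atlas M" "x \<in> chart_dom c" and d: "d \<in> atlas N" "\<psi> x \<in> chart_dom d" for c d x v
  proof -
    have xM: "x \<in> pts M" using M.chart_dom_subset c by blast
    then have \<psi>x: "\<psi> x \<in> pts N" using f by blast
    note ca = M.chart_at[OF xM] and da = N.chart_at[OF \<psi>x]
    note ch = densities_chart_change[OF ca(1) c(1) da(1) d(1) ca(2) c(2) da(2) d(2) cont f diff[OF ca da]]
    have "energy_density (metric_at c x) (metric_at d (\<psi> x)) (chart_diff c d \<psi> x) = 2 * r\<^sup>2"
      "area_density (metric_at c x) (metric_at d (\<psi> x)) (chart_diff c d \<psi> x) = r\<^sup>2"
      using ch(2,3) conformal_densities[OF xM \<psi>x conf[OF xM] less_imp_le[OF J[OF xM]]]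
      by (simp_all add: energy_density_at_def jacobian_area_density Let_def)
    from density_facts(2)[OF M.metric_spd[OF c] N.metric_spd[OF d] this]
    show ?thesis
      by (simp add: congruence_form[symmetric] scaleR_matrix_vector_assoc[symmetric] mult.commute)
  qed
  have path: "piecewise_C1_path N (\<psi> \<circ> \<gamma>) \<and> path_length N (\<psi> \<circ> \<gamma>) \<le> ennreal r * path_length M \<gamma>"
    if \<gamma>: "piecewise_C1_path M \<gamma>" for \<gamma>
  proof
    have p: "path \<gamma>" "path_image \<gamma> \<subseteq> pts M" using \<gamma> by (auto simp: piecewise_C1_path_def)
    have \<gamma>M: "\<gamma> t \<in> pts M" if "t \<in> {0..1}" for t using p(2) that by (auto simp: path_image_def)
    have p': "path (\<psi> \<circ> \<gamma>)" "path_image (\<psi> \<circ> \<gamma>) \<subseteq> pts N"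
      using p f continuous_on_compose[OF _ continuous_on_subset[OF cont], of "{0..1}" \<gamma>]
      by (auto simp: path_def path_image_def image_subset_iff o_def)
    show "piecewise_C1_path N (\<psi> \<circ> \<gamma>)"
      unfolding piecewise_C1_path_def
    proof (intro conjI p' ballI impI)
      fix t d assume t: "t \<in> {0..1}" and d: "d \<in> atlas N" "(\<psi> \<circ> \<gamma>) t \<in> chart_dom d"
      define c where "c = chart_at M (\<gamma> t)"
      have c: "c \<in> atlas M" "\<gamma> t \<in> chart_dom c" using M.chart_at[OF \<gamma>M[OF t]] by (auto simp: c_def)
      let ?S = "chart_map c ` (chart_dom c \<inter> \<psi> -` chart_dom d)"
      let ?U = "chart_dom c \<inter> (pts M \<inter> \<psi> -` chart_dom d)"
      have "openin (top_of_set (pts M)) ?U"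
        using M.chart_openin[OF c(1)] pre[OF d(1)] by (rule openin_Int)
      moreover have "\<gamma> t \<in> ?U" using c d \<gamma>M[OF t] by simp
      ultimately obtain \<delta> where \<delta>: "\<delta> > 0" "\<And>s. s \<in> {0..1} \<Longrightarrow> \<bar>s - t\<bar> < \<delta> \<Longrightarrow> \<gamma> s \<in> ?U"
        using M.path_near[OF p _ t, of ?U] by metis
      obtain e0 where e0: "e0 > 0" "(chart_map c \<circ> \<gamma>) piecewise_C1_differentiable_on ({t - e0..t + e0} \<inter> {0..1})"
        using \<gamma> t c unfolding piecewise_C1_path_def by blast
      have S: "(chart_map c \<circ> \<gamma>) s \<in> ?S \<and> (chart_map d \<circ> (\<psi> \<circ> \<gamma>)) s = chart_rep c d \<psi> ((chart_map c \<circ> \<gamma>) s)"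
        if "s \<in> {0..1}" "\<bar>s - t\<bar> < \<delta>" for s
        using \<delta>(2)[OF that] by (auto simp: chart_rep_def M.inv_map[OF c(1)])
      have "(chart_map c \<circ> \<gamma>) t \<in> ?S" using S[OF t] \<delta>(1) by simp
      from piecewise_C1_smooth_compose[OF sm[OF c(1) d(1)] t this e0 \<delta>(1) S]
      show "\<exists>e>0. (chart_map d \<circ> (\<psi> \<circ> \<gamma>)) piecewise_C1_differentiable_on {t - e..t + e} \<inter> {0..1}" .
    qed
    obtain K where K: "finite K"
      "\<And>s c. \<lbrakk>s \<in> {0<..<1} - K; c \<in> atlas M; \<gamma> s \<in> chart_dom c\<rbrakk> \<Longrightarrow> (chart_map c \<circ> \<gamma>) differentiable (at s)"
      using M.path_differentiable[OF \<gamma>] by metis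
    have "path_length N (\<psi> \<circ> \<gamma>) \<le> (\<integral>\<^sup>+t. ennreal r * (ennreal (path_speed M \<gamma> t) * indicator {0..1} t) \<partial>lborel)"
      unfolding path_length_def
    proof (rule nn_integral_mono_AE)
      have "AE t in lborel. t \<notin> insert 0 (insert 1 K)"
        using K(1) by (intro AE_not_in finite_imp_null_set_lborel) auto
      then show "AE t in lborel. ennreal (path_speed N (\<psi> \<circ> \<gamma>) t) * indicator {0..1} t
          \<le> ennreal r * (ennreal (path_speed M \<gamma> t) * indicator {0..1} t)"
      proof eventually_elim
        case (elim t)
        show ?case
        proof (cases "t \<in> {0..1}")
          case True
          then have t: "t \<in> {0<..<1} - K" using elim by auto
          have x: "\<gamma> t \<in> pts M" "\<psi> (\<gamma> t) \<in> pts N" using \<gamma>M[OF True] f by auto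
          define c d where "c = chart_at M (\<gamma> t)" and "d = chart_at N (\<psi> (\<gamma> t))"
          have c: "c \<in> atlas M" "\<gamma> t \<in> chart_dom c" and d: "d \<in> atlas N" "\<psi> (\<gamma> t) \<in> chart_dom d"
            using M.chart_at[OF x(1)] N.chart_at[OF x(2)] by (auto simp: c_def d_def)
          obtain v where v: "(chart_map c \<circ> \<gamma> has_vector_derivative v) (at t)"
            using K(2)[OF t c] vector_derivative_works by blast
          let ?T = "{s\<in>{0<..<1}. \<gamma> s \<in> chart_dom c}"
          have T: "open ?T" "t \<in> ?T"
            using M.path_preimage_open[OF p M.chart_openin[OF c(1)]] t c by auto
          have sM: "path_speed M \<gamma> t = sqrt (v \<bullet> (metric_at c (\<gamma> t) *v v))"
            by (rule M.path_speed_eq[OF c(1) T _ v]) auto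
          let ?T' = "{s\<in>{0<..<1}. (\<psi> \<circ> \<gamma>) s \<in> chart_dom d}"
          have T': "open ?T'" "t \<in> ?T'"
            using N.path_preimage_open[OF p' N.chart_openin[OF d(1)]] t d by auto
          have "(chart_map d \<circ> (\<psi> \<circ> \<gamma>) has_vector_derivative chart_diff c d \<psi> (\<gamma> t) *v v) (at t)"
            by (rule curve_chart_derivative[OF M.chart[OF c(1)] T _ v chart_diff_has_derivative[OF diff[OF c d]]]) auto
          then have "path_speed N (\<psi> \<circ> \<gamma>) t = sqrt ((chart_diff c d \<psi> (\<gamma> t) *v v) \<bullet>
              (metric_at d (\<psi> (\<gamma> t)) *v (chart_diff c d \<psi> (\<gamma> t) *v v)))"
            using N.path_speed_eq[OF d(1) T'] by auto
          also have "\<dots> = r * path_speed M \<gamma> t"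
            using r by (simp add: form[OF c d, symmetric] sM real_sqrt_mult)
          finally show ?thesis using r True by (simp add: ennreal_mult')
        qed simp
      qed
    qed
    also have "\<dots> \<le> ennreal r * path_length M \<gamma>"
      unfolding path_length_def by (rule nn_integral_cmult_le[OF r])
    finally show "path_length N (\<psi> \<circ> \<gamma>) \<le> ennreal r * path_length M \<gamma>" .
  qed
  have r1: "ennreal r * ennreal (1 / r) = 1" using r by (simp add: ennreal_mult'[symmetric])
  have "riemannian_dist N (\<psi> x) (\<psi> y) \<le> ennreal r * riemannian_dist M x y" for x y
  proof -
    \<comment> \<open>Dividing by \<open>r\<close> leaves the infimum over paths in \<open>M\<close>
      alone on the right, where it can be treated path by path.\<close>
    have "ennreal (1 / r) * riemannian_dist N (\<psi> x) (\<psi> y) \<le> riemannian_dist M x y"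
      unfolding riemannian_dist_def[of M]
    proof (rule Inf_greatest)
      fix l assume "l \<in> {path_length M \<gamma> |\<gamma>. piecewise_C1_path M \<gamma> \<and> pathstart \<gamma> = x \<and> pathfinish \<gamma> = y}"
      then obtain \<gamma> where \<gamma>: "l = path_length M \<gamma>" "piecewise_C1_path M \<gamma>" "pathstart \<gamma> = x" "pathfinish \<gamma> = y"
        by blast
      have "riemannian_dist N (\<psi> x) (\<psi> y) \<le> path_length N (\<psi> \<circ> \<gamma>)"
        unfolding riemannian_dist_def using path[OF \<gamma>(2)] \<gamma>(3,4)
        by (intro Inf_lower) (auto simp: pathstart_def pathfinish_def)
      also have "\<dots> \<le> ennreal r * l" using path[OF \<gamma>(2)] \<gamma>(1) by simp
      finally have "ennreal (1 / r) * riemannian_dist N (\<psi> x) (\<psi> y) \<le> ennreal (1 / r) * (ennreal r * l)"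
        by (rule mult_left_mono) simp
      also have "\<dots> = l" using r1 by (metis mult.assoc mult.commute mult_1)
      finally show "ennreal (1 / r) * riemannian_dist N (\<psi> x) (\<psi> y) \<le> l" .
    qed
    then have "ennreal r * (ennreal (1 / r) * riemannian_dist N (\<psi> x) (\<psi> y)) \<le> ennreal r * riemannian_dist M x y"
      by (rule mult_left_mono) simp
    then show ?thesis by (simp add: mult.assoc[symmetric] r1)
  qed
  then show "lipschitz_map M N \<psi>" unfolding lipschitz_map_def using f r by (intro conjI exI[of _ r]) auto
qed

text \<open>The competitor that shows the lower bound to be attained, against which a given
  minimizer is compared.\<close>

lemma homothetic_in_lip_inj_plus:
  assumes "homothetic M N"
  obtains \<psi> where "\<psi> \<in> lip_inj_plus M N" "homothety M N \<psi>" "\<psi> ` pts M = pts N"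
proof -
  obtain \<psi> r where \<psi>: "oriented_diffeomorphism M N \<psi>" and r: "0 < r"
    and conf: "\<And>x. x \<in> pts M \<Longrightarrow>
      chart_pullback (chart_at M x) (chart_at N (\<psi> x)) \<psi> x = r\<^sup>2 *\<^sub>R metric_at (chart_at M x) x"
    using assms unfolding homothetic_def by blast
  have bij: "bij_betw \<psi> (pts M) (pts N)" and sm: "smooth_map M N \<psi>"
    and J: "\<And>x. x \<in> pts M \<Longrightarrow> 0 < jacobian M N \<psi> x"
    using \<psi> by (auto simp: oriented_diffeomorphism_def)
  note h = homothety_lipschitz[OF sm r conf J]
  have "\<exists>\<^sub>\<le>\<^sub>1x. x \<in> pts M \<and> \<psi> x = q" for q
    using bij by (auto simp: Uniq_def bij_betw_def inj_on_def)
  then have "\<psi> \<in> lip_inj_plus M N"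
    unfolding lip_inj_plus_def using h J by (auto intro!: AE_I2 less_imp_le simp: M.space_area)
  moreover have "homothety M N \<psi>"
    unfolding homothety_def using r h(1) conf by (intro exI[of _ r]) (auto intro!: AE_I2 simp: M.space_area)
  ultimately show thesis using that bij by (simp add: bij_betw_def)
qed

end

section \<open>Minimizers of the energy\<close>

text \<open>Convexity and differentiability are used on the open half-line; at \<open>u = 0\<close>
  the claim reduces to \<open>(1 - q) * t powr q \<le> 0\<close>.\<close>

lemma powr_above_tangent:
  fixes q t u :: real
  assumes "1 \<le> q" "0 < t" "0 \<le> u"
  shows "t powr q + q * t powr (q - 1) * (u - t) \<le> u powr q"
proof (cases "u = 0")
  case True
  have "t powr (q - 1) * t = t powr q" using assms(2) by (simp add: powr_diff)
  then have "q * t powr (q - 1) * t = q * t powr q" by (simp add: mult.assoc)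
  moreover have "1 * t powr q \<le> q * t powr q" using assms(1) by (rule mult_right_mono) simp
  moreover have "q * t powr (q - 1) * (u - t) = - (q * t powr (q - 1) * t)" using True by simp
  ultimately have "t powr q + q * t powr (q - 1) * (u - t) \<le> 0" by linarith
  then show ?thesis using True by simp
next
  case False
  have "q * t powr (q - 1) * (u - t) \<le> u powr q - t powr q"
    using powr_convex[OF assms(1)] False assms
    by (intro convex_on_imp_above_tangent[where A = "{0<..}"])
      (auto intro!: derivative_eq_intros simp: interior_open)
  then show ?thesis by simp
qed

text \<open>The case \<open>r = 1\<close> of the quadratic identity, in which the affine part
  vanishes and a sum of non-negative terms remains.\<close>

lemma dist_sq_nonneg:
  fixes e J :: real
  assumes "0 \<le> J" "2 * J \<le> e"
  shows "0 \<le> e - 2 * sqrt (e + 2 * J) + 2"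
proof -
  define s where "s = sqrt (e + 2 * J)"
  have "e - 2 * s + 2 = (s - 2)\<^sup>2 / 2 + (s\<^sup>2 / 2 - 2 * J)"
    using dist_sq_bound(1)[of 1 J e] assms by (simp add: s_def)
  moreover have "0 \<le> s\<^sup>2 / 2 - 2 * J" using dist_sq_bound(2)[of 1 J e] assms by (simp add: s_def)
  moreover have "0 \<le> (s - 2)\<^sup>2 / 2" by simp
  ultimately show ?thesis unfolding s_def by linarith
qed

text \<open>\<open>m\<close> is minus the slope in \<open>J\<close> of the composed tangent: the
  derivative of the power at \<open>t\<close> times \<open>2 / r - 2\<close>. Equality kills the
  remainder \<open>X\<close> and thus fixes \<open>s\<close>; for \<open>r < 1\<close> it yields
  only \<open>J \<le> r^2\<close>, because the weight of the deficit may be zero, and integration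
  has to supply the rest.\<close>

lemma energy_tangent:
  fixes r q e J :: real
  assumes r: "1/2 \<le> r" "r \<le> 1" and q: "1 \<le> q" and J: "0 \<le> J" "2 * J \<le> e"
  defines "t \<equiv> 2 * (r - 1)\<^sup>2"
  defines "m \<equiv> q * t powr (q - 1) * (2 / r - 2)"
  shows "0 \<le> m" "r < 1 \<Longrightarrow> 0 < m"
    and "t powr q + m * r\<^sup>2 \<le> (e - 2 * sqrt (e + 2 * J) + 2) powr q + m * J" (is "?l \<le> ?r")
    and "t powr q + m * r\<^sup>2 = (e - 2 * sqrt (e + 2 * J) + 2) powr q + m * J \<Longrightarrow> e + 2 * J = 4 * r\<^sup>2 \<and> J \<le> r\<^sup>2 \<and> (r = 1 \<longrightarrow> J = 1)"
proof -
  define s where "s = sqrt (e + 2 * J)"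
  define u where "u = e - 2 * s + 2"
  define X where "X = (s - 2 * r)\<^sup>2 / (2 * r) + (2 - 1 / r) * (s\<^sup>2 / 2 - 2 * J)"
  have pos: "0 < r" "0 \<le> 2 - 1 / r" "0 \<le> 2 / r - 2" "r < 1 \<Longrightarrow> 0 < 2 / r - 2"
    using r by (auto simp: field_simps)
  have s: "0 \<le> s" "s\<^sup>2 = e + 2 * J" "0 \<le> s\<^sup>2 / 2 - 2 * J"
    using J by (auto simp: s_def)
  have u0: "0 \<le> u" using dist_sq_nonneg[OF J] by (simp add: u_def s_def)
  have u_eq: "u = t - (2 / r - 2) * (J - r\<^sup>2) + X"
    using dist_sq_bound(1)[OF r(1) J] by (simp add: u_def X_def s_def t_def algebra_simps)
  have X1: "0 \<le> (s - 2 * r)\<^sup>2 / (2 * r)" "0 \<le> (2 - 1 / r) * (s\<^sup>2 / 2 - 2 * J)"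
    using pos s by auto
  then have X0: "0 \<le> X" unfolding X_def by simp
  have sX: "s = 2 * r" if "X = 0"
  proof -
    have "(s - 2 * r)\<^sup>2 / (2 * r) = 0" using X1 that unfolding X_def by linarith
    then show ?thesis using pos by simp
  qed
  have t0: "0 \<le> t" "r < 1 \<Longrightarrow> 0 < t" by (auto simp: t_def)
  show "0 \<le> m" using q pos by (simp add: m_def)
  show "r < 1 \<Longrightarrow> 0 < m" using q pos t0 by (simp add: m_def)
  have tan: "?l + q * t powr (q - 1) * X \<le> u powr q + m * J" if "r < 1"
  proof -
    have "t powr q + q * t powr (q - 1) * (u - t) \<le> u powr q"
      using q t0(2)[OF that] u0 by (rule powr_above_tangent)
    moreover have "q * t powr (q - 1) * (u - t) = q * t powr (q - 1) * X - m * (J - r\<^sup>2)"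
    proof -
      have "u - t = X - (2 / r - 2) * (J - r\<^sup>2)" using u_eq by simp
      moreover have "a * (X - b * c) = a * X - a * b * c" for a b c :: real by (simp add: algebra_simps)
      ultimately show ?thesis by (simp only: m_def)
    qed
    ultimately show ?thesis by (simp add: algebra_simps)
  qed
  \<comment> \<open>At \<open>r = 1\<close> the tangent point is \<open>t = 0\<close> and both
    constants vanish, so the inequality merely says that the power is non-negative.\<close>
  have one: "?l = 0" "m = 0" if "r = 1" using that q by (auto simp: m_def t_def)
  show "?l \<le> ?r"
  proof (cases "r < 1")
    case True
    then have "0 \<le> q * t powr (q - 1) * X" using X0 q by simp
    then show ?thesis using tan[OF True] by (simp add: u_def s_def)
  next
    case False
    then show ?thesis using one r by simp
  qed
  assume eq: "?l = ?r"
  have "X = 0"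
  proof (cases "r < 1")
    case True
    then have "q * t powr (q - 1) * X \<le> 0" using tan eq by (simp add: u_def s_def)
    moreover have "0 < q * t powr (q - 1)" using q t0(2)[OF True] by simp
    ultimately show ?thesis using X0 by (metis linorder_not_less mult_pos_pos order_le_less)
  next
    case False
    then have "u powr q = 0" using one eq r by (simp add: u_def s_def)
    then show ?thesis using u_eq False r by (simp add: t_def)
  qed
  then have sr: "s = 2 * r" by (rule sX)
  \<comment> \<open>Here the weight \<open>2 - 1 / r\<close> equals 1, so \<open>X = 0\<close> also
    removes the conformality deficit.\<close>
  have "J = 1" if "r = 1"
    using \<open>X = 0\<close> sr that by (simp add: X_def)
  moreover have "e + 2 * J = 4 * r\<^sup>2" using s(2) sr by (simp add: power_mult_distrib)
  moreover have "J \<le> r\<^sup>2" using s(3) sr by (simp add: power_mult_distrib)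
  ultimately show "e + 2 * J = 4 * r\<^sup>2 \<and> J \<le> r\<^sup>2 \<and> (r = 1 \<longrightarrow> J = 1)" by blast
qed

text \<open>\<open>measure\<close> takes the value 0 on sets of infinite measure, so an area
  different from 0 is automatically finite.\<close>

lemma (in riemannian_surface) emeasure_area_pts:
  assumes "area M \<noteq> 0"
  shows "emeasure (area_measure M) (pts M) = ennreal (area M)"
  using assms emeasure_eq_ennreal_measure[of "area_measure M" "pts M"]
  by (cases "emeasure (area_measure M) (pts M) = top") (simp_all add: area_def measure_def)

section \<open>The energy of a competitor: lower bound, equality and homotheties\<close>

context surface_pair begin

definition dist_sq :: "('a \<Rightarrow> 'b) \<Rightarrow> 'a \<Rightarrow> real" where
  "dist_sq \<phi> x = energy_density_at \<phi> x - 2 * sqrt (energy_density_at \<phi> x + 2 * jacobian M N \<phi> x) + 2"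

lemma dist_SO_eq:
  assumes "x \<in> pts M" "\<phi> x \<in> pts N"
  shows "dist_SO M N \<phi> x = sqrt (dist_sq \<phi> x)"
  using INF_SO_iso[OF M.metric_spd[OF M.chart_at[OF assms(1)]] N.metric_spd[OF N.chart_at[OF assms(2)]]]
  by (simp add: dist_SO_def dist_sq_def energy_density_at_def jacobian_area_density Let_def)

lemma jacobian_le_energy_density:
  assumes "x \<in> pts M" "\<phi> x \<in> pts N"
  shows "2 * jacobian M N \<phi> x \<le> energy_density_at \<phi> x"
  using density_facts(1)[OF M.metric_spd[OF M.chart_at[OF assms(1)]] N.metric_spd[OF N.chart_at[OF assms(2)]]]
  by (simp add: energy_density_at_def jacobian_area_density Let_def)

lemma chart_pullback_conformal:
  assumes "x \<in> pts M" "\<phi> x \<in> pts N" "energy_density_at \<phi> x = 2 * r\<^sup>2" "jacobian M N \<phi> x = r\<^sup>2"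
  shows "chart_pullback (chart_at M x) (chart_at N (\<phi> x)) \<phi> x = r\<^sup>2 *\<^sub>R metric_at (chart_at M x) x"
  using density_facts(2)[OF M.metric_spd[OF M.chart_at[OF assms(1)]] N.metric_spd[OF N.chart_at[OF assms(2)]]] assms(3,4)
  by (simp add: chart_pullback_def energy_density_at_def jacobian_area_density Let_def)

lemma good_setD:
  assumes "\<phi> \<in> lip_inj_plus M N" "x \<in> good_set \<phi>"
  shows "x \<in> pts M" "\<phi> x \<in> pts N" "0 \<le> jacobian M N \<phi> x" "2 * jacobian M N \<phi> x \<le> energy_density_at \<phi> x"
    "differentiable_at_pt M N \<phi> x"
proof -
  show x: "x \<in> pts M" "0 \<le> jacobian M N \<phi> x" "differentiable_at_pt M N \<phi> x"
    using assms(2) by (auto simp: good_set_def differentiable_set_def)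
  show "\<phi> x \<in> pts N" using assms(1) x(1) by (auto simp: lip_inj_plus_def lipschitz_map_def)
  then show "2 * jacobian M N \<phi> x \<le> energy_density_at \<phi> x" by (rule jacobian_le_energy_density[OF x(1)])
qed

lemma AE_good_set:
  assumes "\<phi> \<in> lip_inj_plus M N"
  shows "AE x in area_measure M. x \<in> good_set \<phi>"
  by (rule AE_I'[OF good_set_null(1)[OF assms]]) (auto simp: M.space_area)

text \<open>The energy before division by the area, written with the squared distance and the
  exponent \<open>q = p / 2\<close>, and cut off to the good set so that the integrand is
  measurable.\<close>

definition energy_integral :: "real \<Rightarrow> ('a \<Rightarrow> 'b) \<Rightarrow> ennreal" where
  "energy_integral q \<phi> = (\<integral>\<^sup>+x. ennreal (if x \<in> good_set \<phi> then dist_sq \<phi> x powr q else 0) \<partial>area_measure M)"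

lemma energy_eq:
  assumes "\<phi> \<in> lip_inj_plus M N"
  shows "energy p M N \<phi> = energy_integral (p / 2) \<phi> / ennreal (area M)"
proof -
  have "(\<integral>\<^sup>+x. ennreal (dist_SO M N \<phi> x powr p) \<partial>area_measure M) = energy_integral (p / 2) \<phi>"
    unfolding energy_integral_def
  proof (rule nn_integral_cong_AE)
    show "AE x in area_measure M. ennreal (dist_SO M N \<phi> x powr p) =
        ennreal (if x \<in> good_set \<phi> then dist_sq \<phi> x powr (p / 2) else 0)"
      using AE_good_set[OF assms]
    proof eventually_elim
      case (elim x)
      note g = good_setD[OF assms elim]
      have "0 \<le> dist_sq \<phi> x" unfolding dist_sq_def by (rule dist_sq_nonneg[OF g(3,4)])
      then have "dist_SO M N \<phi> x = dist_sq \<phi> x powr (1 / 2)"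
        using dist_SO_eq[of x \<phi>] g(1,2) by (simp add: powr_half_sqrt)
      then show ?case using elim by (simp add: powr_powr)
    qed
  qed
  then show ?thesis by (simp add: energy_def)
qed

lemma energy_integral_conformal:
  assumes \<phi>: "\<phi> \<in> lip_inj_plus M N" and r: "0 \<le> r"
    and conf: "AE x in area_measure M. energy_density_at \<phi> x = 2 * r\<^sup>2 \<and> jacobian M N \<phi> x = r\<^sup>2"
    and area: "area M \<noteq> 0"
  shows "energy_integral q \<phi> = ennreal ((2 * (r - 1)\<^sup>2) powr q * area M)"
proof -
  have "energy_integral q \<phi> = (\<integral>\<^sup>+x. ennreal ((2 * (r - 1)\<^sup>2) powr q) \<partial>area_measure M)"
    unfolding energy_integral_def
  proof (rule nn_integral_cong_AE)
    show "AE x in area_measure M. ennreal (if x \<in> good_set \<phi> then dist_sq \<phi> x powr q else 0) =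
        ennreal ((2 * (r - 1)\<^sup>2) powr q)"
      using AE_good_set[OF \<phi>] conf
    proof eventually_elim
      case (elim x)
      have "sqrt (2 * r\<^sup>2 + 2 * r\<^sup>2) = 2 * r"
        using r by (intro real_sqrt_unique) (simp_all add: power_mult_distrib)
      then have "dist_sq \<phi> x = 2 * r\<^sup>2 - 2 * (2 * r) + 2" using elim by (simp add: dist_sq_def)
      then have "dist_sq \<phi> x = 2 * (r - 1)\<^sup>2" by (simp add: power2_eq_square algebra_simps)
      then show ?case using elim by simp
    qed
  qed
  also have "\<dots> = ennreal ((2 * (r - 1)\<^sup>2) powr q * area M)"
    by (simp add: M.space_area M.emeasure_area_pts[OF area] ennreal_mult')
  finally show ?thesis .
qed

lemma area_image_conformal:
  assumes \<phi>: "\<phi> \<in> lip_inj_plus M N"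
    and conf: "AE x in area_measure M. jacobian M N \<phi> x = r\<^sup>2" and area: "area M \<noteq> 0"
  shows "emeasure (area_measure N) (\<phi> ` pts M) = ennreal (r\<^sup>2 * area M)"
proof -
  have "emeasure (area_measure N) (\<phi> ` pts M) = (\<integral>\<^sup>+x. ennreal (r\<^sup>2) \<partial>area_measure M)"
    unfolding area_formula[OF \<phi>, symmetric]
  proof (rule nn_integral_cong_AE)
    show "AE x in area_measure M. ennreal (if x \<in> good_set \<phi> then jacobian M N \<phi> x else 0) = ennreal (r\<^sup>2)"
      using AE_good_set[OF \<phi>] conf by eventually_elim simp
  qed
  then show ?thesis by (simp add: M.space_area M.emeasure_area_pts[OF area] ennreal_mult')
qed

lemma surj_if_full_area:
  assumes \<phi>: "\<phi> \<in> lip_inj_plus M N" and area: "area N \<noteq> 0"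
    and full: "emeasure (area_measure N) (\<phi> ` pts M) = ennreal (area N)"
  shows "\<phi> ` pts M = pts N"
proof -
  have lip: "lipschitz_map M N \<phi>" using \<phi> by (simp add: lip_inj_plus_def)
  then have sub: "\<phi> ` pts M \<subseteq> pts N" by (auto simp: lipschitz_map_def)
  have "compact (\<phi> ` pts M)"
    using lipschitz_map_continuous[OF lip] M.compact_pts by (rule compact_continuous_image)
  then have "closed (\<phi> ` pts M)" by (rule compact_imp_closed)
  then have op: "openin (top_of_set (pts N)) (pts N - \<phi> ` pts M)"
    by (auto simp: openin_open intro!: exI[of _ "- \<phi> ` pts M"])
  then have m: "pts N - \<phi> ` pts M \<in> sets (area_measure N)"
    using N.openin_surface_sets by (simp add: N.sets_area)
  have "\<phi> ` pts M = pts N - (pts N - \<phi> ` pts M)" using sub by blast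
  then have mi: "\<phi> ` pts M \<in> sets (area_measure N)"
    using m by (metis N.space_area sets.compl_sets)
  have "emeasure (area_measure N) (pts N - \<phi> ` pts M) =
      emeasure (area_measure N) (pts N) - emeasure (area_measure N) (\<phi> ` pts M)"
    using mi sub full by (intro emeasure_Diff) (auto simp: N.space_area[symmetric])
  also have "\<dots> = 0" by (simp add: full N.emeasure_area_pts[OF area])
  finally have "pts N - \<phi> ` pts M \<in> null_sets (area_measure N)" using m by auto
  from N.open_null_empty[OF op this] show ?thesis using sub by blast
qed

text \<open>Integrating the pointwise inequality bounds \<open>E\<close> by the energy plus
  \<open>m\<close> times the excess of the integrated Jacobian over \<open>area N\<close>, and by
  the area formula this excess is not positive. If the energy is at most \<open>E\<close>, the
  pointwise defect and the excess term both integrate to zero.\<close>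

lemma energy_integral_bound:
  assumes \<phi>: "\<phi> \<in> lip_inj_plus M N" and r: "1/2 \<le> r" "r \<le> 1" and q: "1 \<le> q"
    and area: "area M \<noteq> 0" "area N \<noteq> 0" "area N = r\<^sup>2 * area M"
  defines "E \<equiv> (2 * (r - 1)\<^sup>2) powr q * area M"
  shows "ennreal E \<le> energy_integral q \<phi>"
    and "energy_integral q \<phi> \<le> ennreal E \<Longrightarrow>
      AE x in area_measure M. energy_density_at \<phi> x = 2 * r\<^sup>2 \<and> jacobian M N \<phi> x = r\<^sup>2"
proof -
  define t m where "t = 2 * (r - 1)\<^sup>2" and "m = q * t powr (q - 1) * (2 / r - 2)"
  note et = energy_tangent[OF r q, folded t_def, folded m_def]
  \<comment> \<open>The sign of \<open>m\<close> does not involve the energy and area densities, so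
    these are instantiated by zero.\<close>
  have m: "0 \<le> m" "r < 1 \<Longrightarrow> 0 < m" using et(1,2)[of 0 0] by auto
  let ?\<mu> = "area_measure M"
  define J where "J x = (if x \<in> good_set \<phi> then jacobian M N \<phi> x else 0)" for x
  define e where "e x = (if x \<in> good_set \<phi> then energy_density_at \<phi> x else 0)" for x
  define F where "F x = (if x \<in> good_set \<phi> then dist_sq \<phi> x powr q else 0)" for x
  have [measurable]: "J \<in> borel_measurable ?\<mu>" "e \<in> borel_measurable ?\<mu>"
    unfolding J_def e_def using densities_measurable[OF \<phi>] by auto
  have [measurable]: "good_set \<phi> \<in> sets ?\<mu>" using good_set_null(2)[OF \<phi>] by (simp add: M.sets_area)
  have "F = (\<lambda>x. if x \<in> good_set \<phi> then (e x - 2 * sqrt (e x + 2 * J x) + 2) powr q else 0)"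
    by (auto simp: F_def e_def J_def dist_sq_def)
  then have [measurable]: "F \<in> borel_measurable ?\<mu>" by simp
  have F0: "0 \<le> F x" for x by (simp add: F_def)
  have J0: "0 \<le> J x" for x using good_setD(3)[OF \<phi>] by (simp add: J_def)
  have EI: "energy_integral q \<phi> = (\<integral>\<^sup>+x. ennreal (F x) \<partial>?\<mu>)" by (simp add: energy_integral_def F_def)
  interpret finite_measure ?\<mu>
    by (rule finite_measureI) (simp add: M.space_area M.emeasure_area_pts[OF area(1)])
  have \<mu>: "measure ?\<mu> (space ?\<mu>) = area M" by (simp add: M.space_area area_def)
  have "(\<integral>\<^sup>+x. ennreal (J x) \<partial>?\<mu>) = emeasure (area_measure N) (\<phi> ` pts M)"
    unfolding J_def by (rule area_formula[OF \<phi>])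
  also have "\<dots> \<le> ennreal (area N)"
    using emeasure_space[of "area_measure N" "\<phi> ` pts M"]
    by (simp add: N.space_area N.emeasure_area_pts[OF area(2)])
  finally have Jle: "(\<integral>\<^sup>+x. ennreal (J x) \<partial>?\<mu>) \<le> ennreal (area N)" .
  have Jint: "integrable ?\<mu> J"
    using Jle J0 by (intro integrableI_nonneg) (auto simp: le_less_trans)
  have IJ: "integral\<^sup>L ?\<mu> J \<le> area N"
    using Jle J0 nn_integral_eq_integral[OF Jint] ennreal_le_iff[of "area N" "integral\<^sup>L ?\<mu> J"]
    by (simp add: area_def)
  have F_fin: "integrable ?\<mu> F \<and> (\<integral>\<^sup>+x. ennreal (F x) \<partial>?\<mu>) = ennreal (integral\<^sup>L ?\<mu> F)"
    if "(\<integral>\<^sup>+x. ennreal (F x) \<partial>?\<mu>) < \<infinity>"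
  proof -
    have "integrable ?\<mu> F" using that F0 by (intro integrableI_nonneg) auto
    then show ?thesis using nn_integral_eq_integral F0 by auto
  qed
  \<comment> \<open>The defect in the pointwise tangent inequality.\<close>
  define g where "g x = F x + m * J x - (t powr q + m * r\<^sup>2)" for x
  have g0: "AE x in ?\<mu>. 0 \<le> g x"
    using AE_good_set[OF \<phi>]
  proof eventually_elim
    case (elim x)
    from et(3)[OF good_setD(3,4)[OF \<phi> elim]] show ?case
      using elim by (simp add: g_def F_def J_def dist_sq_def)
  qed
  have gI: "integrable ?\<mu> g \<and> integral\<^sup>L ?\<mu> g = integral\<^sup>L ?\<mu> F - E + m * (integral\<^sup>L ?\<mu> J - area N)"
    if "integrable ?\<mu> F"
  proof
    show "integrable ?\<mu> g" unfolding g_def using that Jint by auto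
    have "integral\<^sup>L ?\<mu> g = integral\<^sup>L ?\<mu> F + m * integral\<^sup>L ?\<mu> J - area M * (t powr q + m * r\<^sup>2)"
      unfolding g_def using that Jint \<mu> by simp
    then show "integral\<^sup>L ?\<mu> g = integral\<^sup>L ?\<mu> F - E + m * (integral\<^sup>L ?\<mu> J - area N)"
      by (simp add: E_def t_def area(3) algebra_simps)
  qed
  have mIJ: "m * (integral\<^sup>L ?\<mu> J - area N) \<le> 0" using m(1) IJ by (simp add: mult_nonneg_nonpos)
  show "ennreal E \<le> energy_integral q \<phi>"
  proof (cases "(\<integral>\<^sup>+x. ennreal (F x) \<partial>?\<mu>) < \<infinity>")
    case True
    note F = F_fin[OF True]
    have "0 \<le> integral\<^sup>L ?\<mu> g" using g0 by (rule integral_nonneg_AE)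
    then have "E \<le> integral\<^sup>L ?\<mu> F" using gI F mIJ by auto
    then show ?thesis using F EI by (simp add: ennreal_leI)
  next
    case False
    then show ?thesis by (simp add: EI less_top[symmetric])
  qed
  assume le: "energy_integral q \<phi> \<le> ennreal E"
  then have "(\<integral>\<^sup>+x. ennreal (F x) \<partial>?\<mu>) < \<infinity>" unfolding EI by (simp add: le_less_trans)
  note F = F_fin[OF this]
  have E0: "0 \<le> E" by (simp add: E_def area_def)
  have "integral\<^sup>L ?\<mu> F \<le> E" using le F E0 unfolding EI by (simp add: ennreal_le_iff)
  moreover have "0 \<le> integral\<^sup>L ?\<mu> g" using g0 by (rule integral_nonneg_AE)
  moreover have "integral\<^sup>L ?\<mu> g = integral\<^sup>L ?\<mu> F - E + m * (integral\<^sup>L ?\<mu> J - area N)"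
    using gI F by blast
  ultimately have "integral\<^sup>L ?\<mu> g = 0" "m * (integral\<^sup>L ?\<mu> J - area N) = 0"
    using mIJ by linarith+
  then have gAE: "AE x in ?\<mu>. g x = 0"
    using integral_nonneg_eq_0_iff_AE[of ?\<mu> g] gI F g0 by blast
  have eqs: "AE x in ?\<mu>. e x + 2 * J x = 4 * r\<^sup>2 \<and> J x \<le> r\<^sup>2 \<and> (r = 1 \<longrightarrow> J x = 1)"
    using AE_good_set[OF \<phi>] gAE
  proof eventually_elim
    case (elim x)
    from et(4)[OF good_setD(3,4)[OF \<phi> elim(1)]] show ?case
      using elim by (simp add: g_def F_def J_def e_def dist_sq_def)
  qed
  \<comment> \<open>For \<open>r < 1\<close> the multiplier is positive, so the Jacobian has mean
    \<open>r^2\<close>; being at most \<open>r^2\<close> almost everywhere, it is constant. For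
    \<open>r = 1\<close> the multiplier is zero and the pointwise equality case decides.\<close>
  have "AE x in ?\<mu>. J x = r\<^sup>2"
  proof (cases "r < 1")
    case True
    then have "integral\<^sup>L ?\<mu> J = area N" using m(2) \<open>m * (integral\<^sup>L ?\<mu> J - area N) = 0\<close> by simp
    then have "integral\<^sup>L ?\<mu> (\<lambda>x. r\<^sup>2 - J x) = 0" using Jint \<mu> area(3) by simp
    moreover have "AE x in ?\<mu>. 0 \<le> r\<^sup>2 - J x" using eqs by eventually_elim simp
    ultimately have "AE x in ?\<mu>. r\<^sup>2 - J x = 0"
      using integral_nonneg_eq_0_iff_AE[of ?\<mu> "\<lambda>x. r\<^sup>2 - J x"] Jint by simp
    then show ?thesis by eventually_elim simp
  next
    case False
    then have "r = 1" using r by simp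
    then show ?thesis using eqs by simp
  qed
  then show "AE x in ?\<mu>. energy_density_at \<phi> x = 2 * r\<^sup>2 \<and> jacobian M N \<phi> x = r\<^sup>2"
    using AE_good_set[OF \<phi>] eqs by eventually_elim (simp add: e_def J_def)
qed

text \<open>The ratio \<open>k\<close> in the definition of a homothety is arbitrary. The area
  formula gives the image the area \<open>k^2 * area M\<close>, and surjectivity then leaves only
  \<open>k = r\<close>.\<close>

lemma surjective_homothety_conformal:
  assumes \<phi>: "\<phi> \<in> lip_inj_plus M N" and hom: "homothety M N \<phi>" and surj: "\<phi> ` pts M = pts N"
    and r: "0 \<le> r" and area: "area M \<noteq> 0" "area N \<noteq> 0" "area N = r\<^sup>2 * area M"
  shows "AE x in area_measure M. energy_density_at \<phi> x = 2 * r\<^sup>2 \<and> jacobian M N \<phi> x = r\<^sup>2"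
proof -
  obtain k where k: "0 < k" and h: "AE x in area_measure M. differentiable_at_pt M N \<phi> x \<and>
        chart_pullback (chart_at M x) (chart_at N (\<phi> x)) \<phi> x = k\<^sup>2 *\<^sub>R metric_at (chart_at M x) x"
    using hom unfolding homothety_def by blast
  have AE: "AE x in area_measure M. energy_density_at \<phi> x = 2 * k\<^sup>2 \<and> jacobian M N \<phi> x = k\<^sup>2"
    using h AE_good_set[OF \<phi>]
  proof eventually_elim
    case (elim x)
    note g = good_setD[OF \<phi> elim(2)]
    show ?case using conformal_densities[of x \<phi> k] g elim(1) by blast
  qed
  then have "AE x in area_measure M. jacobian M N \<phi> x = k\<^sup>2" by eventually_elim simp
  from area_image_conformal[OF \<phi> this area(1)]
  have "ennreal (area N) = ennreal (k\<^sup>2 * area M)"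
    unfolding surj N.emeasure_area_pts[OF area(2)] .
  moreover have "0 \<le> area N" "0 \<le> area M" by (simp_all add: area_def)
  ultimately have "area N = k\<^sup>2 * area M" by (simp add: ennreal_inj)
  then have "k\<^sup>2 = r\<^sup>2" using area by simp
  then have "k = r" using k r by (simp add: power2_eq_iff_nonneg)
  then show ?thesis using AE by simp
qed

end

theorem corollary1p3:
  fixes M :: "'a::t2_space surface" and N :: "'b::t2_space surface"
    and p :: real and \<phi> :: "'a \<Rightarrow> 'b"
  assumes "compact_oriented_riemannian_surface M"
    and "compact_oriented_riemannian_surface N"
    and "area N \<le> area M"
    and "2 \<le> p"
    and "homothetic M N"
    and "1 / 4 \<le> area N / area M"
    and "\<phi> \<in> lip_inj_plus M N"
  shows "minimizes_energy p M N \<phi> \<longleftrightarrow> homothety M N \<phi> \<and> \<phi> ` pts M = pts N"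
proof -
  interpret surface_pair M N
    using assms(1,2) by unfold_locales
  \<comment> \<open>Division by zero yields 0, so the lower bound on the quotient excludes a zero
    area on either side.\<close>
  have M0: "area M \<noteq> 0" and N0: "area N \<noteq> 0" using assms(6) by auto
  then have M1: "0 < area M" by (simp add: area_def less_le)
  define r where "r = sqrt (area N / area M)"
  have r2: "area N = r\<^sup>2 * area M" using M1 by (simp add: r_def area_def)
  have "sqrt ((1/2)\<^sup>2) \<le> r" unfolding r_def using assms(6) by (intro real_sqrt_le_mono) (simp add: power2_eq_square)
  then have r: "1/2 \<le> r" by simp
  have r1: "r \<le> 1" using assms(3) M1 by (simp add: r_def)
  define q where "q = p / 2"
  have q: "1 \<le> q" using assms(4) by (simp add: q_def)
  define E where "E = ennreal ((2 * (r - 1)\<^sup>2) powr q * area M)"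
  have E: "energy p M N \<psi> = energy_integral q \<psi> / ennreal (area M)" if "\<psi> \<in> lip_inj_plus M N" for \<psi>
    unfolding q_def by (rule energy_eq[OF that])
  have lower: "E \<le> energy_integral q \<psi>" if "\<psi> \<in> lip_inj_plus M N" for \<psi>
    unfolding E_def by (rule energy_integral_bound(1)[OF that r r1 q M0 N0 r2])
  have attained: "energy_integral q \<psi> = E"
    if "\<psi> \<in> lip_inj_plus M N" "homothety M N \<psi>" "\<psi> ` pts M = pts N" for \<psi>
    unfolding E_def
    using energy_integral_conformal[OF that(1) _ surjective_homothety_conformal[OF that _ M0 N0 r2] M0] r by simp
  show ?thesis
  proof
    assume "minimizes_energy p M N \<phi>"
    moreover obtain \<psi> where \<psi>: "\<psi> \<in> lip_inj_plus M N" "homothety M N \<psi>" "\<psi> ` pts M = pts N"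
      using homothetic_in_lip_inj_plus[OF assms(5)] by metis
    ultimately have "energy_integral q \<phi> / ennreal (area M) \<le> E / ennreal (area M)"
      using E attained[OF \<psi>] assms(7) by (auto simp: minimizes_energy_def)
    then have "energy_integral q \<phi> / ennreal (area M) * ennreal (area M) \<le> E / ennreal (area M) * ennreal (area M)"
      by (rule mult_right_mono) simp
    then have "energy_integral q \<phi> \<le> E"
      using M1 by (simp add: ennreal_divide_times ennreal_eq_0_iff)
    then have AE: "AE x in area_measure M. energy_density_at \<phi> x = 2 * r\<^sup>2 \<and> jacobian M N \<phi> x = r\<^sup>2"
      unfolding E_def by (rule energy_integral_bound(2)[OF assms(7) r r1 q M0 N0 r2])
    have "homothety M N \<phi>"
      unfolding homothety_def
    proof (intro exI conjI)
      show "0 < r" using r by simp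
      show "AE x in area_measure M. differentiable_at_pt M N \<phi> x \<and>
        chart_pullback (chart_at M x) (chart_at N (\<phi> x)) \<phi> x = r\<^sup>2 *\<^sub>R metric_at (chart_at M x) x"
        using AE AE_good_set[OF assms(7)]
      proof eventually_elim
        case (elim x)
        note g = good_setD[OF assms(7) elim(2)]
        show ?case using chart_pullback_conformal[of x \<phi> r] g(1,2) elim(1) g(5) by blast
      qed
    qed
    moreover have "\<phi> ` pts M = pts N"
    proof (rule surj_if_full_area[OF assms(7) N0])
      have "AE x in area_measure M. jacobian M N \<phi> x = r\<^sup>2" using AE by eventually_elim simp
      from area_image_conformal[OF assms(7) this M0]
      show "emeasure (area_measure N) (\<phi> ` pts M) = ennreal (area N)" by (simp add: r2)
    qed
    ultimately show "homothety M N \<phi> \<and> \<phi> ` pts M = pts N" by blast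
  next
    assume "homothety M N \<phi> \<and> \<phi> ` pts M = pts N"
    then have "energy_integral q \<phi> = E" using attained assms(7) by blast
    then show "minimizes_energy p M N \<phi>"
      using lower E assms(7) by (auto simp: minimizes_energy_def intro!: divide_right_mono_ennreal)
  qed
qed

end
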